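(* Let $n\ge1$ and let $(\mathcal{A},\mathcal{B})$ be an $n$-cotorsion pair in an abelian category $\mathcal{C}$. Then the following hold: (1) If there exists an integer $1\le m\le n$ such that $$\mathcal{A}\cap\mathcal{B}=\bigcap_{i=1}^m{}^{\perp_i}(\mathcal{A}\cap\mathcal{B})=\bigcap_{i=1}^m(\mathcal{A}\cap\mathcal{B})^{\perp_i},$$ then $\mathcal{A}=\mathcal{B}$ and the class $\mathcal{A}\cap\mathcal{B}=\mathcal{A}$ is special precovering and special preenveloping. (2) The class $\mathcal{A}\cap\mathcal{B}$ is an $(n+1)$-cluster tilting subcategory of $\mathcal{C}$ if, and only if, $\mathcal{A}=\mathcal{B}$.
   Context: $\mathrm{Ext}^i_{\mathcal{C}}$ is Yoneda Ext; ${}^{\perp_i}\mathcal{X}=\{C:\mathrm{Ext}^i_{\mathcal{C}}(C,X)=0\ \forall X\in\mathcal{X}\}$, $\mathcal{X}^{\perp_i}=\{C:\mathrm{Ext}^i_{\mathcal{C}}(X,C)=0\ \forall X\in\mathcal{X}\}$. $\mathcal{X}^\wedge_k$ (resp. $\mathcal{X}^\vee_k$) is the class of objects $C$ with an exact sequence $0\to X_k\to\cdots\to X_0\to C\to0$ (resp. $0\to C\to X_0\to\cdots\to X_k\to0$) of length at most $k$ with terms in $\mathcal{X}$. $n$-cotorsion pair $(\mathcal{A},\mathcal{B})$: $\mathcal{A}$ and $\mathcal{B}$ are closed under direct summands; $\mathrm{Ext}^i_{\mathcal{C}}(A,B)=0$ for all $A\in\mathcal{A}$, $B\in\mathcal{B}$,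 $1\le i\le n$; every $C\in\mathcal{C}$ fits in short exact sequences $0\to K\to A\to C\to0$ with $A\in\mathcal{A}$, $K\in\mathcal{B}^\wedge_{n-1}$, and $0\to C\to B\to L\to0$ with $B\in\mathcal{B}$, $L\in\mathcal{A}^\vee_{n-1}$. An $\mathcal{X}$-precover of $C$ is a morphism $f:X\to C$ with $X\in\mathcal{X}$ through which every morphism from an object of $\mathcal{X}$ to $C$ factors; it is special if it is epic with kernel in $\mathcal{X}^{\perp_1}$. Preenvelopes and special preenvelopes (monic with cokernel in ${}^{\perp_1}\mathcal{X}$) are dual. $\mathcal{X}$ is (special) precovering/preenveloping if every object of $\mathcal{C}$ has a (special) $\mathcal{X}$-precover/preenvelope. For $m\ge1$, a (full) subcategory $\mathcal{D}\subseteq\mathcal{C}$ is $m$-cluster tilting if it is precovering and preenveloping and $\mathcal{D}=\bigcap_{0<i<m}{}^{\perp_i}\mathcal{D}=\bigcap_{0<i<m}\mathcal{D}^{\perp_i}$. *)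

theory Defs
  imports "HOL-Algebra.Group"
begin

section \<open>Abelian categories\<close>

text \<open>
  Composition is written in the usual applicative order, so \<open>g \<cdot> f\<close> is \<open>g\<close> after \<open>f\<close>.
  Addition and zero arrows belong to the record: \<open>C\<close> is a category enriched in abelian groups.
  Classes of objects of \<open>C\<close> (full subcategories) are subsets of \<open>Obj C\<close>.
\<close>

record ('o, 'm) additive_data =
  Obj :: "'o set"
  Arr :: "'m set"
  Dom :: "'m \<Rightarrow> 'o"
  Cod :: "'m \<Rightarrow> 'o"
  Ide :: "'o \<Rightarrow> 'm"
  Comp :: "'m \<Rightarrow> 'm \<Rightarrow> 'm" (infixl "\<cdot>\<index>" 70)
  Add :: "'m \<Rightarrow> 'm \<Rightarrow> 'm" (infixl "\<boxplus>\<index>" 65)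
  Zero :: "'o \<Rightarrow> 'o \<Rightarrow> 'm"

definition Hom :: "('o, 'm) additive_data \<Rightarrow> 'o \<Rightarrow> 'o \<Rightarrow> 'm set" where
  "Hom C X Y = {f \<in> Arr C. Dom C f = X \<and> Cod C f = Y}"

definition hom_group :: "('o, 'm) additive_data \<Rightarrow> 'o \<Rightarrow> 'o \<Rightarrow> 'm monoid" where
  "hom_group C X Y = \<lparr>carrier = Hom C X Y, mult = Add C, one = Zero C X Y\<rparr>"

definition is_mono :: "('o, 'm) additive_data \<Rightarrow> 'm \<Rightarrow> bool" where
  "is_mono C f \<longleftrightarrow> f \<in> Arr C \<and>
     (\<forall>W \<in> Obj C. inj_on (\<lambda>g. f \<cdot>\<^bsub>C\<^esub> g) (Hom C W (Dom C f)))"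

definition is_epi :: "('o, 'm) additive_data \<Rightarrow> 'm \<Rightarrow> bool" where
  "is_epi C f \<longleftrightarrow> f \<in> Arr C \<and>
     (\<forall>W \<in> Obj C. inj_on (\<lambda>g. g \<cdot>\<^bsub>C\<^esub> f) (Hom C (Cod C f) W))"

definition is_kernel :: "('o, 'm) additive_data \<Rightarrow> 'm \<Rightarrow> 'm \<Rightarrow> bool" where
  "is_kernel C k f \<longleftrightarrow> k \<in> Arr C \<and> f \<in> Arr C \<and> Cod C k = Dom C f \<and>
     f \<cdot>\<^bsub>C\<^esub> k = Zero C (Dom C k) (Cod C f) \<and>
     (\<forall>W \<in> Obj C. \<forall>h \<in> Hom C W (Dom C f). f \<cdot>\<^bsub>C\<^esub> h = Zero C W (Cod C f) \<longrightarrow>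
        (\<exists>!u. u \<in> Hom C W (Dom C k) \<and> k \<cdot>\<^bsub>C\<^esub> u = h))"

definition is_cokernel :: "('o, 'm) additive_data \<Rightarrow> 'm \<Rightarrow> 'm \<Rightarrow> bool" where
  "is_cokernel C q f \<longleftrightarrow> q \<in> Arr C \<and> f \<in> Arr C \<and> Dom C q = Cod C f \<and>
     q \<cdot>\<^bsub>C\<^esub> f = Zero C (Dom C f) (Cod C q) \<and>
     (\<forall>W \<in> Obj C. \<forall>h \<in> Hom C (Cod C f) W. h \<cdot>\<^bsub>C\<^esub> f = Zero C (Dom C f) W \<longrightarrow>
        (\<exists>!u. u \<in> Hom C (Cod C q) W \<and> u \<cdot>\<^bsub>C\<^esub> q = h))"

definition is_zero_object :: "('o, 'm) additive_data \<Rightarrow> 'o \<Rightarrow> bool" where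
  "is_zero_object C Z \<longleftrightarrow> Z \<in> Obj C \<and>
     (\<forall>X \<in> Obj C. (\<exists>!f. f \<in> Hom C Z X) \<and> (\<exists>!f. f \<in> Hom C X Z))"

definition is_biproduct ::
  "('o, 'm) additive_data \<Rightarrow> 'o \<Rightarrow> 'o \<Rightarrow> 'o \<Rightarrow> 'm \<Rightarrow> 'm \<Rightarrow> 'm \<Rightarrow> 'm \<Rightarrow> bool" where
  "is_biproduct C P X Y i j p q \<longleftrightarrow> P \<in> Obj C \<and> X \<in> Obj C \<and> Y \<in> Obj C \<and>
     i \<in> Hom C X P \<and> j \<in> Hom C Y P \<and> p \<in> Hom C P X \<and> q \<in> Hom C P Y \<and>
     p \<cdot>\<^bsub>C\<^esub> i = Ide C X \<and> q \<cdot>\<^bsub>C\<^esub> j = Ide C Y \<and>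
     p \<cdot>\<^bsub>C\<^esub> j = Zero C Y X \<and> q \<cdot>\<^bsub>C\<^esub> i = Zero C X Y \<and>
     (i \<cdot>\<^bsub>C\<^esub> p) \<boxplus>\<^bsub>C\<^esub> (j \<cdot>\<^bsub>C\<^esub> q) = Ide C P"

locale abelian_category =
  fixes C :: "('o, 'm) additive_data" (structure)
  assumes Dom_in_Obj: "f \<in> Arr C \<Longrightarrow> Dom C f \<in> Obj C"
    and Cod_in_Obj: "f \<in> Arr C \<Longrightarrow> Cod C f \<in> Obj C"
    and Ide_in_Hom: "X \<in> Obj C \<Longrightarrow> Ide C X \<in> Hom C X X"
    and Comp_in_Hom: "\<lbrakk>f \<in> Hom C X Y; g \<in> Hom C Y Z\<rbrakk> \<Longrightarrow> g \<cdot> f \<in> Hom C X Z"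
    and Comp_Ide: "f \<in> Hom C X Y \<Longrightarrow> f \<cdot> Ide C X = f"
    and Ide_Comp: "f \<in> Hom C X Y \<Longrightarrow> Ide C Y \<cdot> f = f"
    and Comp_assoc: "\<lbrakk>f \<in> Hom C W X; g \<in> Hom C X Y; h \<in> Hom C Y Z\<rbrakk> \<Longrightarrow>
          h \<cdot> (g \<cdot> f) = (h \<cdot> g) \<cdot> f"
    and hom_comm_group: "\<lbrakk>X \<in> Obj C; Y \<in> Obj C\<rbrakk> \<Longrightarrow> comm_group (hom_group C X Y)"
    and Comp_Add: "\<lbrakk>f \<in> Hom C X Y; f' \<in> Hom C X Y; g \<in> Hom C Y Z\<rbrakk> \<Longrightarrow>
          g \<cdot> (f \<boxplus> f') = (g \<cdot> f) \<boxplus> (g \<cdot> f')"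
    and Add_Comp: "\<lbrakk>f \<in> Hom C X Y; g \<in> Hom C Y Z; g' \<in> Hom C Y Z\<rbrakk> \<Longrightarrow>
          (g \<boxplus> g') \<cdot> f = (g \<cdot> f) \<boxplus> (g' \<cdot> f)"
    and ex_zero_object: "\<exists>Z. is_zero_object C Z"
    and ex_biproduct: "\<lbrakk>X \<in> Obj C; Y \<in> Obj C\<rbrakk> \<Longrightarrow> \<exists>P i j p q. is_biproduct C P X Y i j p q"
    and ex_kernel: "f \<in> Arr C \<Longrightarrow> \<exists>k. is_kernel C k f"
    and ex_cokernel: "f \<in> Arr C \<Longrightarrow> \<exists>q. is_cokernel C q f"
    and mono_is_kernel: "is_mono C f \<Longrightarrow> \<exists>g. is_kernel C f g"
    and epi_is_cokernel: "is_epi C f \<Longrightarrow> \<exists>g. is_cokernel C f g"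


section \<open>Exact sequences\<close>

text \<open>
  Exactness of \<open>f, g\<close> at the middle object says that one arrow \<open>k\<close> is both the image of \<open>f\<close>
  (the kernel of its cokernel) and the kernel of \<open>g\<close>.
\<close>

definition exact_at :: "('o, 'm) additive_data \<Rightarrow> 'm \<Rightarrow> 'm \<Rightarrow> bool" where
  "exact_at C f g \<longleftrightarrow> Cod C f = Dom C g \<and>
     (\<exists>q k. is_cokernel C q f \<and> is_kernel C k q \<and> is_kernel C k g)"

text \<open>
  A nonempty list \<open>[f\<^sub>1, \<dots>, f\<^sub>r]\<close> stands for the sequence
  \<open>0 \<rightarrow> Dom f\<^sub>1 \<rightarrow> Cod f\<^sub>1 = Dom f\<^sub>2 \<rightarrow> \<dots> \<rightarrow> Cod f\<^sub>r \<rightarrow> 0\<close>, exact at every object, the two outer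
  ones included.
\<close>

definition exact_from_zero_to_zero :: "('o, 'm) additive_data \<Rightarrow> 'm list \<Rightarrow> bool" where
  "exact_from_zero_to_zero C fs \<longleftrightarrow> fs \<noteq> [] \<and> set fs \<subseteq> Arr C \<and>
     (\<exists>Z. is_zero_object C Z \<and>
       successively (exact_at C)
         (Zero C Z (Dom C (hd fs)) # fs @ [Zero C (Cod C (last fs)) Z]))"

definition short_exact :: "('o, 'm) additive_data \<Rightarrow> 'o \<Rightarrow> 'o \<Rightarrow> 'o \<Rightarrow> bool" where
  "short_exact C X Y Z \<longleftrightarrow>
     (\<exists>f g. f \<in> Hom C X Y \<and> g \<in> Hom C Y Z \<and> exact_from_zero_to_zero C [f, g])"


section \<open>Yoneda Ext\<close>

text \<open>
  For \<open>i \<ge> 1\<close>, an \<open>i\<close>-extension \<open>0 \<rightarrow> Y \<rightarrow> E\<^sub>i \<rightarrow> \<dots> \<rightarrow> E\<^sub>1 \<rightarrow> X \<rightarrow> 0\<close> of \<open>X\<close> by \<open>Y\<close> has \<open>i + 1\<close> arrows.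
\<close>

definition extensions :: "('o, 'm) additive_data \<Rightarrow> nat \<Rightarrow> 'o \<Rightarrow> 'o \<Rightarrow> 'm list set" where
  "extensions C i X Y = {fs. length fs = i + 1 \<and> exact_from_zero_to_zero C fs \<and>
     Dom C (hd fs) = Y \<and> Cod C (last fs) = X}"

definition ext_morphism ::
  "('o, 'm) additive_data \<Rightarrow> nat \<Rightarrow> 'o \<Rightarrow> 'o \<Rightarrow> 'm list \<Rightarrow> 'm list \<Rightarrow> bool" where
  "ext_morphism C i X Y fs gs \<longleftrightarrow> fs \<in> extensions C i X Y \<and> gs \<in> extensions C i X Y \<and>
     (\<exists>h :: nat \<Rightarrow> 'm. h 0 = Ide C Y \<and> h (i + 1) = Ide C X \<and>
       (\<forall>j \<le> i. h j \<in> Hom C (Dom C (fs ! j)) (Dom C (gs ! j)) \<and>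
                h (j + 1) \<in> Hom C (Cod C (fs ! j)) (Cod C (gs ! j)) \<and>
                (gs ! j) \<cdot>\<^bsub>C\<^esub> h j = h (j + 1) \<cdot>\<^bsub>C\<^esub> (fs ! j)))"

definition yoneda_equiv ::
  "('o, 'm) additive_data \<Rightarrow> nat \<Rightarrow> 'o \<Rightarrow> 'o \<Rightarrow> ('m list \<times> 'm list) set" where
  "yoneda_equiv C i X Y = {(E, F). E \<in> extensions C i X Y \<and> F \<in> extensions C i X Y \<and>
     equivclp (ext_morphism C i X Y) E F}"

definition Ext :: "('o, 'm) additive_data \<Rightarrow> nat \<Rightarrow> 'o \<Rightarrow> 'o \<Rightarrow> 'm list set set" where
  "Ext C i X Y = extensions C i X Y // yoneda_equiv C i X Y"

text \<open>
  The neutral element of the Baer sum is the class of the split extension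
  \<open>0 \<rightarrow> Y \<rightarrow> Y \<oplus> X \<rightarrow> X \<rightarrow> 0\<close> if \<open>i = 1\<close>, and the class of
  \<open>0 \<rightarrow> Y = Y \<rightarrow> 0 \<rightarrow> \<dots> \<rightarrow> 0 \<rightarrow> X = X \<rightarrow> 0\<close> if \<open>i \<ge> 2\<close>; in the latter case \<open>os\<close> below lists the
  \<open>i + 2\<close> objects \<open>Y, Y, 0, \<dots>, 0, X, X\<close>.
\<close>

definition trivial_extension ::
  "('o, 'm) additive_data \<Rightarrow> nat \<Rightarrow> 'o \<Rightarrow> 'o \<Rightarrow> 'm list \<Rightarrow> bool" where
  "trivial_extension C i X Y T \<longleftrightarrow>
     (if i = 1 then \<exists>P s t p q. is_biproduct C P Y X s t p q \<and> T = [s, q]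
      else \<exists>Z. is_zero_object C Z \<and>
        (let os = [Y, Y] @ replicate (i - 2) Z @ [X, X] in
         T = map (\<lambda>j. if j = 0 then Ide C Y else if j = i then Ide C X
                       else Zero C (os ! j) (os ! (j + 1))) [0..<i + 1]))"

definition Ext_zero :: "('o, 'm) additive_data \<Rightarrow> nat \<Rightarrow> 'o \<Rightarrow> 'o \<Rightarrow> 'm list set" where
  "Ext_zero C i X Y = {E. \<exists>T. trivial_extension C i X Y T \<and> (T, E) \<in> yoneda_equiv C i X Y}"

text \<open>
  An abelian group vanishes iff its only element is the neutral one, so the Baer sum itself does
  not enter the definition.
\<close>

definition Ext_vanishes :: "('o, 'm) additive_data \<Rightarrow> nat \<Rightarrow> 'o \<Rightarrow> 'o \<Rightarrow> bool" where
  "Ext_vanishes C i X Y \<longleftrightarrow> Ext C i X Y = {Ext_zero C i X Y}"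

definition left_perp :: "('o, 'm) additive_data \<Rightarrow> nat \<Rightarrow> 'o set \<Rightarrow> 'o set" where
  "left_perp C i S = {X \<in> Obj C. \<forall>S' \<in> S. Ext_vanishes C i X S'}"

definition right_perp :: "('o, 'm) additive_data \<Rightarrow> nat \<Rightarrow> 'o set \<Rightarrow> 'o set" where
  "right_perp C i S = {X \<in> Obj C. \<forall>S' \<in> S. Ext_vanishes C i S' X}"


section \<open>Higher cotorsion pairs and cluster tilting\<close>

text \<open>
  A sequence \<open>0 \<rightarrow> X\<^sub>j \<rightarrow> \<dots> \<rightarrow> X\<^sub>0 \<rightarrow> M \<rightarrow> 0\<close> has \<open>j + 1\<close> arrows, and its terms \<open>X\<^sub>j, \<dots>, X\<^sub>0\<close> are the
  domains of these; dually for coresolutions.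
\<close>

definition res_class :: "('o, 'm) additive_data \<Rightarrow> nat \<Rightarrow> 'o set \<Rightarrow> 'o set" where
  "res_class C k S = {M \<in> Obj C. \<exists>j \<le> k. \<exists>fs. length fs = j + 1 \<and> exact_from_zero_to_zero C fs \<and>
     Cod C (last fs) = M \<and> Dom C ` set fs \<subseteq> S}"

definition cores_class :: "('o, 'm) additive_data \<Rightarrow> nat \<Rightarrow> 'o set \<Rightarrow> 'o set" where
  "cores_class C k S = {M \<in> Obj C. \<exists>j \<le> k. \<exists>fs. length fs = j + 1 \<and> exact_from_zero_to_zero C fs \<and>
     Dom C (hd fs) = M \<and> Cod C ` set fs \<subseteq> S}"

definition closed_under_summands :: "('o, 'm) additive_data \<Rightarrow> 'o set \<Rightarrow> bool" where
  "closed_under_summands C S \<longleftrightarrow>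
     (\<forall>P X Y i j p q. is_biproduct C P X Y i j p q \<and> P \<in> S \<longrightarrow> X \<in> S)"

definition n_cotorsion_pair ::
  "('o, 'm) additive_data \<Rightarrow> nat \<Rightarrow> 'o set \<Rightarrow> 'o set \<Rightarrow> bool" where
  "n_cotorsion_pair C n \<A> \<B> \<longleftrightarrow> \<A> \<subseteq> Obj C \<and> \<B> \<subseteq> Obj C \<and>
     closed_under_summands C \<A> \<and> closed_under_summands C \<B> \<and>
     (\<forall>A \<in> \<A>. \<forall>B \<in> \<B>. \<forall>i \<in> {1..n}. Ext_vanishes C i A B) \<and>
     (\<forall>X \<in> Obj C. \<exists>A \<in> \<A>. \<exists>K \<in> res_class C (n - 1) \<B>. short_exact C K A X) \<and>
     (\<forall>X \<in> Obj C. \<exists>B \<in> \<B>. \<exists>L \<in> cores_class C (n - 1) \<A>. short_exact C X B L)"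

definition is_precover :: "('o, 'm) additive_data \<Rightarrow> 'o set \<Rightarrow> 'o \<Rightarrow> 'm \<Rightarrow> bool" where
  "is_precover C S X f \<longleftrightarrow> f \<in> Arr C \<and> Dom C f \<in> S \<and> Cod C f = X \<and>
     (\<forall>S' \<in> S. \<forall>g \<in> Hom C S' X. \<exists>h \<in> Hom C S' (Dom C f). f \<cdot>\<^bsub>C\<^esub> h = g)"

definition is_preenvelope :: "('o, 'm) additive_data \<Rightarrow> 'o set \<Rightarrow> 'o \<Rightarrow> 'm \<Rightarrow> bool" where
  "is_preenvelope C S X f \<longleftrightarrow> f \<in> Arr C \<and> Cod C f \<in> S \<and> Dom C f = X \<and>
     (\<forall>S' \<in> S. \<forall>g \<in> Hom C X S'. \<exists>h \<in> Hom C (Cod C f) S'. h \<cdot>\<^bsub>C\<^esub> f = g)"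

definition is_special_precover :: "('o, 'm) additive_data \<Rightarrow> 'o set \<Rightarrow> 'o \<Rightarrow> 'm \<Rightarrow> bool" where
  "is_special_precover C S X f \<longleftrightarrow> is_precover C S X f \<and> is_epi C f \<and>
     (\<exists>k. is_kernel C k f \<and> Dom C k \<in> right_perp C 1 S)"

definition is_special_preenvelope :: "('o, 'm) additive_data \<Rightarrow> 'o set \<Rightarrow> 'o \<Rightarrow> 'm \<Rightarrow> bool" where
  "is_special_preenvelope C S X f \<longleftrightarrow> is_preenvelope C S X f \<and> is_mono C f \<and>
     (\<exists>q. is_cokernel C q f \<and> Cod C q \<in> left_perp C 1 S)"

definition precovering :: "('o, 'm) additive_data \<Rightarrow> 'o set \<Rightarrow> bool" where
  "precovering C S \<longleftrightarrow> (\<forall>X \<in> Obj C. \<exists>f. is_precover C S X f)"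

definition preenveloping :: "('o, 'm) additive_data \<Rightarrow> 'o set \<Rightarrow> bool" where
  "preenveloping C S \<longleftrightarrow> (\<forall>X \<in> Obj C. \<exists>f. is_preenvelope C S X f)"

definition special_precovering :: "('o, 'm) additive_data \<Rightarrow> 'o set \<Rightarrow> bool" where
  "special_precovering C S \<longleftrightarrow> (\<forall>X \<in> Obj C. \<exists>f. is_special_precover C S X f)"

definition special_preenveloping :: "('o, 'm) additive_data \<Rightarrow> 'o set \<Rightarrow> bool" where
  "special_preenveloping C S \<longleftrightarrow> (\<forall>X \<in> Obj C. \<exists>f. is_special_preenvelope C S X f)"

text \<open>
  The intersections are taken inside \<open>Obj C\<close>, so for \<open>m = 1\<close> the empty intersection is \<open>Obj C\<close>.
\<close>

definition cluster_tilting :: "('o, 'm) additive_data \<Rightarrow> nat \<Rightarrow> 'o set \<Rightarrow> bool" where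
  "cluster_tilting C m D \<longleftrightarrow> 1 \<le> m \<and> D \<subseteq> Obj C \<and> precovering C D \<and> preenveloping C D \<and>
     D = Obj C \<inter> (\<Inter>i \<in> {0<..<m}. left_perp C i D) \<and>
     D = Obj C \<inter> (\<Inter>i \<in> {0<..<m}. right_perp C i D)"

end

theory Submission
  imports Defs
begin

text \<open>
  Both parts reduce to one fact: if \<open>Ext\<^sup>i(X, B) = 0\<close> for all \<open>B \<in> \<B>\<close> and \<open>1 \<le> i \<le> n\<close>, then
  \<open>Ext\<^sup>1(X, K) = 0\<close> for every \<open>K\<close> with a \<open>\<B>\<close>-resolution of length at most \<open>n - 1\<close>. For such \<open>X\<close> the
  approximation sequence \<open>0 \<rightarrow> K \<rightarrow> A \<rightarrow> X \<rightarrow> 0\<close> splits, so \<open>\<A>\<close> is the whole left orthogonal of \<open>\<B>\<close>.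
  Applied to the objects of \<open>\<A>\<close> in place of \<open>X\<close>, the fact shows that \<open>A \<rightarrow> X\<close> is a special \<open>\<A>\<close>-precover
  for every \<open>X\<close>. The statements about \<open>\<B>\<close> follow in the opposite category.

  The fact itself is a dimension shift. Instead of the long exact sequence and Baer sums, it rests
  on a criterion for a Yoneda extension \<open>0 \<rightarrow> Y \<rightarrow> E\<^sub>i \<rightarrow> \<dots> \<rightarrow> E\<^sub>1 \<rightarrow> X \<rightarrow> 0\<close> to be trivial that does not mention
  zigzags: some exact sequence \<open>0 \<rightarrow> M \<rightarrow> N\<^sub>i\<^sub>-\<^sub>1 \<rightarrow> \<dots> \<rightarrow> N\<^sub>1 \<rightarrow> X \<rightarrow> 0\<close> maps to it over the identity of \<open>X\<close> in such
  a way that the induced map from \<open>M\<close> to the image of \<open>E\<^sub>i\<close> lifts to \<open>E\<^sub>i\<close>.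
\<close>

text \<open>Equivalence of Yoneda extensions runs through zigzags, so an invariant has to be both
  preserved and reflected by every morphism of extensions. Preservation is a push-forward;
  reflection is the hard half and uses that the morphism is the identity on \<open>Y\<close>: a lift
  found in the target is corrected by an arrow into \<open>Y\<close>. Conversely, an extension that
  meets the criterion is joined to the trivial one: the sequence \<open>N\<close> is completed to an
  exact sequence with left term \<open>E_i\<close>, the object \<open>Y\<close> is added there as a
  direct summand, and the result maps to both extensions. Neither projective objects nor elements
  are available. Choosing a preimage is replaced by lifting an arrow after pulling back along an
  epimorphism, and the sequence \<open>N\<close> collects the epimorphisms and kernels that arise on
  the way. The counting behind the fact: a resolution with terms \<open>B_j, ..., B_0\<close> uses
  Ext in the degrees \<open>1\<close> to \<open>j + 1\<close>, and \<open>j \<le> n - 1\<close>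
  keeps these within the \<open>n\<close> degrees of orthogonality.\<close>

context abelian_category
begin

subsection \<open>Additive structure\<close>

lemma Hom_iff: "f \<in> Hom C X Y \<longleftrightarrow> f \<in> Arr C \<and> Dom C f = X \<and> Cod C f = Y"
  by (simp add: Hom_def)

lemma Arr_in_Hom: "f \<in> Arr C \<Longrightarrow> f \<in> Hom C (Dom C f) (Cod C f)"
  by (simp add: Hom_iff)

lemma Arr_objs [simp]: "f \<in> Arr C \<Longrightarrow> Dom C f \<in> Obj C" "f \<in> Arr C \<Longrightarrow> Cod C f \<in> Obj C"
  by (rule Dom_in_Obj Cod_in_Obj; assumption)+

lemma comp_simps [simp]:
  assumes "f \<in> Arr C" "g \<in> Arr C" "Cod C f = Dom C g"
  shows "g \<cdot> f \<in> Arr C" "Dom C (g \<cdot> f) = Dom C f" "Cod C (g \<cdot> f) = Cod C g"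
  using Comp_in_Hom[of f "Dom C f" "Cod C f" g "Cod C g"] assms by (auto simp: Hom_iff)

lemma ide_simps [simp]:
  assumes "X \<in> Obj C"
  shows "Ide C X \<in> Arr C" "Dom C (Ide C X) = X" "Cod C (Ide C X) = X"
  using Ide_in_Hom[OF assms] by (auto simp: Hom_iff)

lemma comp_ide [simp]: "f \<in> Arr C \<Longrightarrow> X = Dom C f \<Longrightarrow> f \<cdot> Ide C X = f"
  by (auto intro: Comp_Ide simp: Hom_iff)

lemma ide_comp [simp]: "f \<in> Arr C \<Longrightarrow> X = Cod C f \<Longrightarrow> Ide C X \<cdot> f = f"
  by (auto intro: Ide_Comp simp: Hom_iff)

lemma comp_assoc:
  "\<lbrakk>f \<in> Arr C; g \<in> Arr C; h \<in> Arr C; Cod C f = Dom C g; Cod C g = Dom C h\<rbrakk> \<Longrightarrow>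
    (h \<cdot> g) \<cdot> f = h \<cdot> (g \<cdot> f)"
  by (rule Comp_assoc[symmetric]) (auto simp: Hom_iff)

text \<open>Diagram chases apply a commuting square to an arrow \<open>x\<close>; this form
  discharges the typing conditions once and keeps products bracketed to the right.\<close>

lemma comp_reassoc:
  assumes "b \<cdot> a = d \<cdot> c" "a \<in> Arr C" "b \<in> Arr C" "Cod C a = Dom C b"
    "x \<in> Arr C" "Cod C x = Dom C a" "c \<in> Arr C" "d \<in> Arr C" "Cod C c = Dom C d" "Dom C c = Dom C a"
  shows "b \<cdot> (a \<cdot> x) = d \<cdot> (c \<cdot> x)"
  using assms comp_assoc[of x a b] comp_assoc[of x c d] by simp

lemma zero_simps [simp]:
  assumes "X \<in> Obj C" "Y \<in> Obj C"
  shows "Zero C X Y \<in> Arr C" "Dom C (Zero C X Y) = X" "Cod C (Zero C X Y) = Y"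
proof -
  interpret G: comm_group "hom_group C X Y" using hom_comm_group assms .
  have "Zero C X Y \<in> Hom C X Y" using G.one_closed by (simp add: hom_group_def)
  thus "Zero C X Y \<in> Arr C" "Dom C (Zero C X Y) = X" "Cod C (Zero C X Y) = Y"
    by (auto simp: Hom_iff)
qed

text \<open>The record has an addition but no negation, so the inverse is taken in the hom group
  that \<open>f\<close> itself determines.\<close>

definition Neg :: "'m \<Rightarrow> 'm" where
  "Neg f = inv\<^bsub>hom_group C (Dom C f) (Cod C f)\<^esub> f"

definition Sub :: "'m \<Rightarrow> 'm \<Rightarrow> 'm" where
  "Sub f g = f \<boxplus> Neg g"

lemma add_simps [simp]:
  assumes "f \<in> Arr C" "g \<in> Arr C" "Dom C f = Dom C g" "Cod C f = Cod C g"
  shows "f \<boxplus> g \<in> Arr C" "Dom C (f \<boxplus> g) = Dom C g" "Cod C (f \<boxplus> g) = Cod C g"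
proof -
  interpret G: comm_group "hom_group C (Dom C g) (Cod C g)" using assms by (intro hom_comm_group) auto
  have "f \<boxplus> g \<in> Hom C (Dom C g) (Cod C g)"
    using G.m_closed[of f g] assms by (simp add: hom_group_def Hom_iff)
  thus "f \<boxplus> g \<in> Arr C" "Dom C (f \<boxplus> g) = Dom C g" "Cod C (f \<boxplus> g) = Cod C g"
    by (auto simp: Hom_iff)
qed

lemma neg_simps [simp]:
  assumes "g \<in> Arr C"
  shows "Neg g \<in> Arr C" "Dom C (Neg g) = Dom C g" "Cod C (Neg g) = Cod C g"
proof -
  interpret G: comm_group "hom_group C (Dom C g) (Cod C g)" using assms by (intro hom_comm_group) auto
  have "Neg g \<in> Hom C (Dom C g) (Cod C g)"
    using G.inv_closed[of g] assms by (simp add: hom_group_def Hom_iff Neg_def)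
  thus "Neg g \<in> Arr C" "Dom C (Neg g) = Dom C g" "Cod C (Neg g) = Cod C g"
    by (auto simp: Hom_iff)
qed

lemma add_commute:
  "\<lbrakk>f \<in> Arr C; g \<in> Arr C; Dom C f = Dom C g; Cod C f = Cod C g\<rbrakk> \<Longrightarrow> f \<boxplus> g = g \<boxplus> f"
  using comm_group.axioms(1)[OF hom_comm_group, of "Dom C g" "Cod C g"]
    comm_monoid.m_comm[of "hom_group C (Dom C g) (Cod C g)" f g]
  by (simp add: hom_group_def Hom_iff)

lemma add_assoc:
  assumes "f \<in> Arr C" "g \<in> Arr C" "h \<in> Arr C"
    "Dom C f = Dom C g" "Cod C f = Cod C g" "Dom C h = Dom C g" "Cod C h = Cod C g"
  shows "f \<boxplus> g \<boxplus> h = f \<boxplus> (g \<boxplus> h)"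
proof -
  interpret G: comm_group "hom_group C (Dom C g) (Cod C g)" using assms by (intro hom_comm_group) auto
  show ?thesis using G.m_assoc[of f g h] assms by (simp add: hom_group_def Hom_iff)
qed

lemma add_zero [simp]:
  assumes "f \<in> Arr C" "X = Dom C f" "Y = Cod C f"
  shows "f \<boxplus> Zero C X Y = f" "Zero C X Y \<boxplus> f = f"
proof -
  interpret G: comm_group "hom_group C X Y" using assms by (intro hom_comm_group) auto
  show "f \<boxplus> Zero C X Y = f" "Zero C X Y \<boxplus> f = f"
    using G.r_one[of f] G.l_one[of f] assms by (simp_all add: hom_group_def Hom_iff)
qed

lemma add_neg [simp]:
  assumes "f \<in> Arr C"
  shows "f \<boxplus> Neg f = Zero C (Dom C f) (Cod C f)" "Neg f \<boxplus> f = Zero C (Dom C f) (Cod C f)"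
proof -
  interpret G: comm_group "hom_group C (Dom C f) (Cod C f)" using assms by (intro hom_comm_group) auto
  show "f \<boxplus> Neg f = Zero C (Dom C f) (Cod C f)" "Neg f \<boxplus> f = Zero C (Dom C f) (Cod C f)"
    using G.r_inv[of f] G.l_inv[of f] assms by (simp_all add: hom_group_def Hom_iff Neg_def)
qed

lemma add_left_cancel:
  assumes "f \<in> Arr C" "g \<in> Arr C" "h \<in> Arr C"
    "Dom C g = Dom C f" "Cod C g = Cod C f" "Dom C h = Dom C f" "Cod C h = Cod C f"
    "f \<boxplus> g = f \<boxplus> h"
  shows "g = h"
proof -
  have "Neg f \<boxplus> f \<boxplus> g = Neg f \<boxplus> f \<boxplus> h" using assms by (simp add: add_assoc del: add_neg)
  thus ?thesis using assms by simp
qed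

lemma comp_add:
  "\<lbrakk>f \<in> Arr C; f' \<in> Arr C; g \<in> Arr C; Dom C f = Dom C f'; Cod C f = Cod C f'; Cod C f' = Dom C g\<rbrakk>
    \<Longrightarrow> g \<cdot> (f \<boxplus> f') = g \<cdot> f \<boxplus> g \<cdot> f'"
  by (rule Comp_Add) (auto simp: Hom_iff)

lemma add_comp:
  "\<lbrakk>f \<in> Arr C; g \<in> Arr C; g' \<in> Arr C; Dom C g = Dom C g'; Cod C g = Cod C g'; Cod C f = Dom C g'\<rbrakk>
    \<Longrightarrow> (g \<boxplus> g') \<cdot> f = g \<cdot> f \<boxplus> g' \<cdot> f"
  by (rule Add_Comp) (auto simp: Hom_iff)

lemma comp_zero [simp]:
  assumes "g \<in> Arr C" "Y = Dom C g" "X \<in> Obj C"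
  shows "g \<cdot> Zero C X Y = Zero C X (Cod C g)"
proof -
  let ?z = "Zero C X Y"
  have "g \<cdot> ?z \<boxplus> g \<cdot> ?z = g \<cdot> ?z \<boxplus> Zero C X (Cod C g)"
    using assms by (simp flip: comp_add)
  thus ?thesis using assms by - (rule add_left_cancel[of "g \<cdot> ?z"], auto)
qed

lemma zero_comp [simp]:
  assumes "g \<in> Arr C" "X = Cod C g" "Y \<in> Obj C"
  shows "Zero C X Y \<cdot> g = Zero C (Dom C g) Y"
proof -
  let ?z = "Zero C X Y"
  have "?z \<cdot> g \<boxplus> ?z \<cdot> g = ?z \<cdot> g \<boxplus> Zero C (Dom C g) Y"
    using assms by (simp flip: add_comp)
  thus ?thesis using assms by - (rule add_left_cancel[of "?z \<cdot> g"], auto)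
qed

lemma comp_neg:
  assumes "g \<in> Arr C" "f \<in> Arr C" "Cod C f = Dom C g"
  shows "g \<cdot> Neg f = Neg (g \<cdot> f)"
proof -
  have "g \<cdot> f \<boxplus> g \<cdot> Neg f = g \<cdot> (f \<boxplus> Neg f)"
    using assms by (intro comp_add[symmetric]) auto
  also have "\<dots> = g \<cdot> f \<boxplus> Neg (g \<cdot> f)"
    using assms by simp
  finally have "g \<cdot> f \<boxplus> g \<cdot> Neg f = g \<cdot> f \<boxplus> Neg (g \<cdot> f)" .
  thus ?thesis using assms by - (rule add_left_cancel[of "g \<cdot> f"], auto)
qed

lemma neg_comp:
  assumes "g \<in> Arr C" "f \<in> Arr C" "Cod C f = Dom C g"
  shows "Neg g \<cdot> f = Neg (g \<cdot> f)"
proof -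
  have "g \<cdot> f \<boxplus> Neg g \<cdot> f = (g \<boxplus> Neg g) \<cdot> f"
    using assms by (intro add_comp[symmetric]) auto
  also have "\<dots> = g \<cdot> f \<boxplus> Neg (g \<cdot> f)"
    using assms by simp
  finally have "g \<cdot> f \<boxplus> Neg g \<cdot> f = g \<cdot> f \<boxplus> Neg (g \<cdot> f)" .
  thus ?thesis using assms by - (rule add_left_cancel[of "g \<cdot> f"], auto)
qed

lemma sub_simps [simp]:
  assumes "f \<in> Arr C" "g \<in> Arr C" "Dom C f = Dom C g" "Cod C f = Cod C g"
  shows "Sub f g \<in> Arr C" "Dom C (Sub f g) = Dom C g" "Cod C (Sub f g) = Cod C g"
  using assms by (simp_all add: Sub_def)

lemma comp_sub:
  "\<lbrakk>f \<in> Arr C; f' \<in> Arr C; g \<in> Arr C; Dom C f = Dom C f'; Cod C f = Cod C f'; Cod C f' = Dom C g\<rbrakk>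
    \<Longrightarrow> g \<cdot> Sub f f' = Sub (g \<cdot> f) (g \<cdot> f')"
  by (simp add: Sub_def comp_add comp_neg)

lemma sub_comp:
  "\<lbrakk>f \<in> Arr C; g \<in> Arr C; g' \<in> Arr C; Dom C g = Dom C g'; Cod C g = Cod C g'; Cod C f = Dom C g'\<rbrakk>
    \<Longrightarrow> Sub g g' \<cdot> f = Sub (g \<cdot> f) (g' \<cdot> f)"
  by (simp add: Sub_def add_comp neg_comp)

lemma sub_self [simp]: "f \<in> Arr C \<Longrightarrow> Sub f f = Zero C (Dom C f) (Cod C f)"
  by (simp add: Sub_def)

lemma sub_add:
  assumes "f \<in> Arr C" "g \<in> Arr C" "Dom C f = Dom C g" "Cod C f = Cod C g"
  shows "Sub f g \<boxplus> g = f"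
  using assms by (simp add: Sub_def add_assoc)

lemma sub_eq_zero:
  assumes "f \<in> Arr C" "g \<in> Arr C" "Dom C f = Dom C g" "Cod C f = Cod C g"
    "Sub f g = Zero C (Dom C g) (Cod C g)"
  shows "f = g"
  using sub_add[OF assms(1-4)] assms by simp

lemma sub_zero [simp]:
  assumes "f \<in> Arr C" "X = Dom C f" "Y = Cod C f"
  shows "Sub f (Zero C X Y) = f"
  using sub_add[of f "Zero C X Y"] add_zero(1)[of "Sub f (Zero C X Y)" X Y] assms by (metis Arr_objs sub_simps zero_simps)

lemma sub_eq_iff:
  assumes "f \<in> Arr C" "g \<in> Arr C" "h \<in> Arr C"
    "Dom C f = Dom C g" "Cod C f = Cod C g" "Dom C h = Dom C g" "Cod C h = Cod C g"
  shows "Sub f g = h \<longleftrightarrow> f = g \<boxplus> h"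
proof
  assume "Sub f g = h"
  thus "f = g \<boxplus> h" using sub_add[of f g] add_commute[of g h] assms by metis
next
  assume "f = g \<boxplus> h"
  hence "g \<boxplus> Sub f g = g \<boxplus> h"
    using sub_add[of f g] add_commute[of g "Sub f g"] assms by (metis sub_simps)
  thus "Sub f g = h" using assms by - (rule add_left_cancel[of g], auto)
qed

subsection \<open>Monomorphisms, epimorphisms and kernels\<close>

text \<open>Differences of parallel arrows exist, so cancellation only has to be tested against
  zero.\<close>

lemma monoI:
  assumes "f \<in> Arr C"
    "\<And>g. \<lbrakk>g \<in> Arr C; Cod C g = Dom C f; f \<cdot> g = Zero C (Dom C g) (Cod C f)\<rbrakk>
      \<Longrightarrow> g = Zero C (Dom C g) (Dom C f)"
  shows "is_mono C f"
  unfolding is_mono_def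
proof (intro conjI ballI inj_onI)
  fix W g h assume "W \<in> Obj C" "g \<in> Hom C W (Dom C f)" "h \<in> Hom C W (Dom C f)" "f \<cdot> g = f \<cdot> h"
  thus "g = h" using assms(1) assms(2)[of "Sub g h"]
    by - (rule sub_eq_zero, auto simp: Hom_iff comp_sub)
qed fact

lemma epiI:
  assumes "f \<in> Arr C"
    "\<And>g. \<lbrakk>g \<in> Arr C; Dom C g = Cod C f; g \<cdot> f = Zero C (Dom C f) (Cod C g)\<rbrakk>
      \<Longrightarrow> g = Zero C (Cod C f) (Cod C g)"
  shows "is_epi C f"
  unfolding is_epi_def
proof (intro conjI ballI inj_onI)
  fix W g h assume "W \<in> Obj C" "g \<in> Hom C (Cod C f) W" "h \<in> Hom C (Cod C f) W" "g \<cdot> f = h \<cdot> f"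
  thus "g = h" using assms(1) assms(2)[of "Sub g h"]
    by - (rule sub_eq_zero, auto simp: Hom_iff sub_comp)
qed fact

lemma mono_arr [simp]: "is_mono C f \<Longrightarrow> f \<in> Arr C"
  and epi_arr [simp]: "is_epi C f \<Longrightarrow> f \<in> Arr C"
  by (simp_all add: is_mono_def is_epi_def)

lemma mono_cancel:
  "\<lbrakk>is_mono C f; g \<in> Arr C; h \<in> Arr C; Dom C g = Dom C h; Cod C g = Dom C f; Cod C h = Dom C f;
    f \<cdot> g = f \<cdot> h\<rbrakk> \<Longrightarrow> g = h"
  unfolding is_mono_def by (auto simp: Hom_iff dest!: bspec[of _ _ "Dom C h"] dest: inj_onD)

lemma epi_cancel:
  "\<lbrakk>is_epi C f; g \<in> Arr C; h \<in> Arr C; Cod C g = Cod C h; Dom C g = Cod C f; Dom C h = Cod C f;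
    g \<cdot> f = h \<cdot> f\<rbrakk> \<Longrightarrow> g = h"
  unfolding is_epi_def by (auto simp: Hom_iff dest!: bspec[of _ _ "Cod C h"] dest: inj_onD)

lemma mono_zero:
  "\<lbrakk>is_mono C f; g \<in> Arr C; Cod C g = Dom C f; f \<cdot> g = Zero C (Dom C g) (Cod C f)\<rbrakk>
    \<Longrightarrow> g = Zero C (Dom C g) (Dom C f)"
  by (rule mono_cancel[of f]) auto

lemma epi_zero:
  "\<lbrakk>is_epi C f; g \<in> Arr C; Dom C g = Cod C f; g \<cdot> f = Zero C (Dom C f) (Cod C g)\<rbrakk>
    \<Longrightarrow> g = Zero C (Cod C f) (Cod C g)"
  by (rule epi_cancel[of f]) auto

lemma mono_comp:
  assumes "is_mono C f" "is_mono C g" "Cod C f = Dom C g"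
  shows "is_mono C (g \<cdot> f)"
proof (rule monoI)
  fix t assume t: "t \<in> Arr C" "Cod C t = Dom C (g \<cdot> f)" "(g \<cdot> f) \<cdot> t = Zero C (Dom C t) (Cod C (g \<cdot> f))"
  hence "f \<cdot> t = Zero C (Dom C t) (Cod C f)"
    using assms mono_zero[of g "f \<cdot> t"] by (simp add: comp_assoc)
  thus "t = Zero C (Dom C t) (Dom C (g \<cdot> f))" using assms t mono_zero[of f t] by simp
qed (use assms in simp)

lemma epi_comp:
  assumes "is_epi C f" "is_epi C g" "Cod C f = Dom C g"
  shows "is_epi C (g \<cdot> f)"
proof (rule epiI)
  fix t assume t: "t \<in> Arr C" "Dom C t = Cod C (g \<cdot> f)" "t \<cdot> (g \<cdot> f) = Zero C (Dom C (g \<cdot> f)) (Cod C t)"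
  hence "t \<cdot> g = Zero C (Cod C f) (Cod C t)"
    using assms epi_zero[of f "t \<cdot> g"] by (simp add: comp_assoc)
  thus "t = Zero C (Cod C (g \<cdot> f)) (Cod C t)" using assms t epi_zero[of g t] by simp
qed (use assms in simp)

lemma ide_mono: "X \<in> Obj C \<Longrightarrow> is_mono C (Ide C X)"
  and ide_epi: "X \<in> Obj C \<Longrightarrow> is_epi C (Ide C X)"
  by (rule monoI; simp) (rule epiI; simp)

lemma epi_of_comp:
  assumes "is_epi C (g \<cdot> f)" "f \<in> Arr C" "g \<in> Arr C" "Cod C f = Dom C g"
  shows "is_epi C g"
proof (rule epiI)
  fix t assume t: "t \<in> Arr C" "Dom C t = Cod C g" "t \<cdot> g = Zero C (Dom C g) (Cod C t)"
  have "t \<cdot> (g \<cdot> f) = Zero C (Dom C f) (Cod C t)"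
    using t assms comp_assoc[of f g t] by simp
  thus "t = Zero C (Cod C g) (Cod C t)" using epi_zero[OF assms(1), of t] t assms by simp
qed fact

lemma mono_of_comp:
  assumes "is_mono C (g \<cdot> f)" "f \<in> Arr C" "g \<in> Arr C" "Cod C f = Dom C g"
  shows "is_mono C f"
proof (rule monoI)
  fix t assume t: "t \<in> Arr C" "Cod C t = Dom C f" "f \<cdot> t = Zero C (Dom C t) (Cod C f)"
  have "(g \<cdot> f) \<cdot> t = Zero C (Dom C t) (Cod C g)"
    using t assms by (simp add: comp_assoc)
  thus "t = Zero C (Dom C t) (Dom C f)" using mono_zero[OF assms(1), of t] t assms by simp
qed fact

lemma kernelD:
  assumes "is_kernel C k f"
  shows "k \<in> Arr C" "f \<in> Arr C" "Cod C k = Dom C f" "f \<cdot> k = Zero C (Dom C k) (Cod C f)"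
  using assms by (simp_all add: is_kernel_def)

lemma kernel_lift:
  assumes "is_kernel C k f" "h \<in> Arr C" "Cod C h = Dom C f" "f \<cdot> h = Zero C (Dom C h) (Cod C f)"
  obtains u where "u \<in> Arr C" "Dom C u = Dom C h" "Cod C u = Dom C k" "k \<cdot> u = h"
  using assms unfolding is_kernel_def by (metis Arr_in_Hom Hom_iff Dom_in_Obj)

lemma kernel_mono: 
  assumes "is_kernel C k f"
  shows "is_mono C k"
  unfolding is_mono_def
proof (intro conjI ballI inj_onI)
  fix W g h assume W: "W \<in> Obj C" "g \<in> Hom C W (Dom C k)" "h \<in> Hom C W (Dom C k)" "k \<cdot> g = k \<cdot> h"
  have "f \<cdot> (k \<cdot> g) = Zero C W (Cod C f)"
    using W(1,2) kernelD[OF assms] by (simp add: Hom_iff flip: comp_assoc)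
  hence "\<exists>!u. u \<in> Hom C W (Dom C k) \<and> k \<cdot> u = k \<cdot> g"
    using assms W kernelD[OF assms] unfolding is_kernel_def by (auto simp: Hom_iff)
  thus "g = h" using W by metis
qed (use kernelD[OF assms] in simp)

text \<open>Uniqueness of the factorization is the monomorphism hypothesis, which leaves only
  existence to supply.\<close>

lemma kernelI:
  assumes "is_mono C k" "f \<in> Arr C" "Cod C k = Dom C f" "f \<cdot> k = Zero C (Dom C k) (Cod C f)"
    "\<And>h. \<lbrakk>h \<in> Arr C; Cod C h = Dom C f; f \<cdot> h = Zero C (Dom C h) (Cod C f)\<rbrakk> \<Longrightarrow>
      \<exists>u \<in> Arr C. Dom C u = Dom C h \<and> Cod C u = Dom C k \<and> k \<cdot> u = h"
  shows "is_kernel C k f"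
  unfolding is_kernel_def
proof (intro conjI ballI impI)
  fix W h assume W: "W \<in> Obj C" "h \<in> Hom C W (Dom C f)" "f \<cdot> h = Zero C W (Cod C f)"
  with assms(5)[of h] obtain u where u: "u \<in> Hom C W (Dom C k)" "k \<cdot> u = h" by (auto simp: Hom_iff)
  show "\<exists>!u. u \<in> Hom C W (Dom C k) \<and> k \<cdot> u = h"
    by (rule ex1I[of _ u]) (use u mono_cancel[OF assms(1), of _ u] in \<open>auto simp: Hom_iff\<close>)
qed (use assms in auto)

end

subsection \<open>The opposite category\<close>

text \<open>The arrows themselves are kept, so the double opposite is literally \<open>C\<close> and
  dual statements can be rewritten back without transport along an isomorphism.\<close>

definition op_cat :: "('o, 'm) additive_data \<Rightarrow> ('o, 'm) additive_data" where
  "op_cat C = \<lparr>Obj = Obj C, Arr = Arr C, Dom = Cod C, Cod = Dom C, Ide = Ide C,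
     Comp = (\<lambda>g f. Comp C f g), Add = Add C, Zero = (\<lambda>X Y. Zero C Y X)\<rparr>"

lemma op_simps [simp]:
  "Obj (op_cat C) = Obj C" "Arr (op_cat C) = Arr C" "Dom (op_cat C) = Cod C"
  "Cod (op_cat C) = Dom C" "Ide (op_cat C) = Ide C" "Comp (op_cat C) g f = Comp C f g"
  "Add (op_cat C) = Add C" "Zero (op_cat C) X Y = Zero C Y X"
  by (simp_all add: op_cat_def)

lemma op_op [simp]: "op_cat (op_cat C) = C"
  by (simp add: op_cat_def)

lemma op_Hom [simp]: "Hom (op_cat C) X Y = Hom C Y X"
  by (auto simp: Hom_def)

lemma op_hom_group [simp]: "hom_group (op_cat C) X Y = hom_group C Y X"
  by (simp add: hom_group_def)

lemma op_mono [simp]: "is_mono (op_cat C) f = is_epi C f"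
  and op_epi [simp]: "is_epi (op_cat C) f = is_mono C f"
  by (simp_all add: is_mono_def is_epi_def)

lemma op_kernel [simp]: "is_kernel (op_cat C) f g = is_cokernel C f g"
  and op_cokernel [simp]: "is_cokernel (op_cat C) f g = is_kernel C f g"
  by (auto simp: is_kernel_def is_cokernel_def)

lemma op_zero_object [simp]: "is_zero_object (op_cat C) Z = is_zero_object C Z"
  by (auto simp: is_zero_object_def)

lemma op_biproduct [simp]: "is_biproduct (op_cat C) P X Y i j p q = is_biproduct C P X Y p q i j"
  by (auto simp: is_biproduct_def)

context abelian_category
begin

text \<open>The axioms come in dual pairs, and each is met by its partner. Facts about kernels and
  monomorphisms then yield their duals by instantiation at \<open>op_cat C\<close>.\<close>

lemma op_abelian: "abelian_category (op_cat C)"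
proof (rule abelian_category.intro, goal_cases)
  case (11)
  then show ?case using ex_zero_object by simp
next
  case (12 X Y)
  then obtain P i j p q where "is_biproduct C P X Y i j p q" using ex_biproduct[of X Y] by (metis op_simps(1))
  \<comment> \<open>Injections and projections trade places, so the witnesses are given in a
    different order.\<close>
  hence "is_biproduct (op_cat C) P X Y p q i j" by simp
  then show ?case by blast
qed (auto simp: Hom_iff hom_comm_group comp_add add_comp comp_assoc
     intro: mono_is_kernel epi_is_cokernel ex_cokernel ex_kernel)

lemmas cokernelD = abelian_category.kernelD[OF op_abelian, simplified]
lemmas cokernel_desc = abelian_category.kernel_lift[OF op_abelian, simplified]
lemmas cokernel_epi = abelian_category.kernel_mono[OF op_abelian, simplified]
lemmas cokernelI = abelian_category.kernelI[OF op_abelian, simplified]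

subsection \<open>Short exact sequences and exactness\<close>

text \<open>The axiom presents \<open>m\<close> as the kernel of some \<open>g\<close>. Since
  \<open>g\<close> kills \<open>m\<close>, it factors through \<open>q\<close>, so whatever
  \<open>q\<close> kills is killed by \<open>g\<close> and lifts to \<open>Dom m\<close>.\<close>

lemma mono_kernel_cokernel:
  assumes "is_mono C m" "is_cokernel C q m"
  shows "is_kernel C m q"
proof -
  obtain g where g: "is_kernel C m g" using mono_is_kernel assms(1) by blast
  note G = kernelD[OF g] and Q = cokernelD[OF assms(2)]
  obtain u where u: "u \<in> Arr C" "Cod C u = Cod C g" "Dom C u = Cod C q" "u \<cdot> q = g"
    using cokernel_desc[OF assms(2), of g] G by auto
  show ?thesis
  proof (rule kernelI)
    fix h assume h: "h \<in> Arr C" "Cod C h = Dom C q" "q \<cdot> h = Zero C (Dom C h) (Cod C q)"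
    have "g \<cdot> h = u \<cdot> (q \<cdot> h)" using h u Q comp_assoc[of h q u] by simp
    hence "g \<cdot> h = Zero C (Dom C h) (Cod C g)" using h u Q by simp
    with h show "\<exists>u\<in>Arr C. Dom C u = Dom C h \<and> Cod C u = Dom C m \<and> m \<cdot> u = h"
      using kernel_lift[OF g, of h] G Q by metis
  qed (use assms Q in auto)
qed

lemmas epi_cokernel_kernel = abelian_category.mono_kernel_cokernel[OF op_abelian, simplified]

definition ses :: "'m \<Rightarrow> 'm \<Rightarrow> bool" where
  "ses k e \<longleftrightarrow> is_kernel C k e \<and> is_cokernel C e k"

lemma sesD:
  assumes "ses k e"
  shows "is_kernel C k e" "is_cokernel C e k" "is_mono C k" "is_epi C e" "k \<in> Arr C" "e \<in> Arr C"
    "Cod C k = Dom C e" "e \<cdot> k = Zero C (Dom C k) (Cod C e)"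
  using assms kernel_mono[of k e] cokernel_epi[of e k] kernelD[of k e] by (auto simp: ses_def)

lemma ses_kernel: "\<lbrakk>is_epi C e; is_kernel C k e\<rbrakk> \<Longrightarrow> ses k e"
  using epi_cokernel_kernel by (auto simp: ses_def)

lemma ses_cokernel: "\<lbrakk>is_mono C k; is_cokernel C e k\<rbrakk> \<Longrightarrow> ses k e"
  using mono_kernel_cokernel by (auto simp: ses_def)

text \<open>A monomorphism applied after \<open>g\<close> does not change which arrows are killed.
  The dual is used for cokernels.\<close>

lemma kernel_mono_comp:
  assumes "is_mono C n" "g \<in> Arr C" "Cod C g = Dom C n"
  shows "is_kernel C k (n \<cdot> g) \<longleftrightarrow> is_kernel C k g"
proof -
  have *: "n \<cdot> g \<cdot> h = Zero C W (Cod C n) \<longleftrightarrow> g \<cdot> h = Zero C W (Cod C g)"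
    if "h \<in> Arr C" "Dom C h = W" "Cod C h = Dom C g" for h W
    using that assms mono_zero[of n "g \<cdot> h"] by (auto simp: comp_assoc)
  have "n \<in> Arr C" using assms by simp
  thus ?thesis using * assms
    unfolding is_kernel_def by (auto simp: Hom_iff)
qed

text \<open>The image is the kernel of the cokernel; the work is in showing that the induced
  \<open>e\<close> is epi. The last clause ranges over all cokernels of \<open>f\<close> because
  \<open>exact_at\<close> chooses one existentially.\<close>

lemma image_factorization:
  assumes "f \<in> Arr C"
  obtains m e where "is_mono C m" "is_epi C e" "Cod C e = Dom C m" "f = m \<cdot> e"
    "\<And>q. is_cokernel C q f \<Longrightarrow> is_kernel C m q"
proof -
  obtain q where q: "is_cokernel C q f" using assms ex_cokernel by blast
  note Q = cokernelD[OF q]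
  obtain m where m: "is_kernel C m q" using Q ex_kernel by blast
  note M = kernelD[OF m] kernel_mono[OF m]
  obtain e where e: "e \<in> Arr C" "Dom C e = Dom C f" "Cod C e = Dom C m" "m \<cdot> e = f"
    using kernel_lift[OF m, of f] Q by auto
  have "is_epi C e"
  proof (rule epiI)
    fix t assume t: "t \<in> Arr C" "Dom C t = Cod C e" "t \<cdot> e = Zero C (Dom C e) (Cod C t)"
    obtain n where n: "is_kernel C n t" using t ex_kernel by blast
    note N = kernelD[OF n] kernel_mono[OF n]
    obtain e' where e': "e' \<in> Arr C" "Dom C e' = Dom C e" "Cod C e' = Dom C n" "n \<cdot> e' = e"
      using kernel_lift[OF n, of e] t e by auto
    \<comment> \<open>The arrow \<open>f\<close> factors through the subobject
      \<open>m \<cdot> n\<close>, which is the kernel of some \<open>w\<close>. So \<open>w\<close>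
      kills \<open>f\<close>, hence factors through \<open>q\<close> and kills \<open>m\<close>;
      therefore \<open>m\<close> factors through \<open>m \<cdot> n\<close>, which makes
      \<open>n\<close> a split epimorphism, and \<open>t \<cdot> n = 0\<close> forces
      \<open>t = 0\<close>.\<close>
    have mn: "is_mono C (m \<cdot> n)" using N M t e by (intro mono_comp) auto
    then obtain w where w: "is_kernel C (m \<cdot> n) w" using mono_is_kernel by blast
    note W = kernelD[OF w]
    have W': "Dom C w = Cod C m" using W N M t e by simp
    have "(m \<cdot> n) \<cdot> e' = f"
      using N M t e e' by (simp add: comp_assoc)
    moreover have "w \<cdot> (m \<cdot> n) \<cdot> e' = w \<cdot> ((m \<cdot> n) \<cdot> e')"
      using W(2) W' N M t e e' by (intro comp_assoc) auto
    ultimately have "w \<cdot> f = w \<cdot> (m \<cdot> n) \<cdot> e'" by simp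
    hence "w \<cdot> f = Zero C (Dom C f) (Cod C w)" using W W' N M t e e' by simp
    then obtain w' where w': "w' \<in> Arr C" "Dom C w' = Cod C q" "Cod C w' = Cod C w" "w' \<cdot> q = w"
      using cokernel_desc[OF q, of w] W W' M Q by auto
    have "w \<cdot> m = w' \<cdot> (q \<cdot> m)" using w' M Q comp_assoc[of m q w'] by simp
    hence "w \<cdot> m = Zero C (Dom C m) (Cod C w)" using w' M Q by simp
    then obtain s where s: "s \<in> Arr C" "Dom C s = Dom C m" "Cod C s = Dom C n" "m \<cdot> n \<cdot> s = m"
      using kernel_lift[OF w, of m] W W' M N t e by auto
    have "n \<cdot> s = Ide C (Dom C m)"
      using s M N t e mono_cancel[OF M(5), of "n \<cdot> s" "Ide C (Dom C m)"] comp_assoc[of s n m] by simp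
    hence "t = t \<cdot> (n \<cdot> s)" using s M N t e by simp
    also have "\<dots> = t \<cdot> n \<cdot> s" using s M N t e comp_assoc[of s n t] by simp
    also have "\<dots> = Zero C (Cod C e) (Cod C t)" using s M N t e by simp
    finally show "t = Zero C (Cod C e) (Cod C t)" .
  qed fact
  moreover have "is_kernel C m q'" if q': "is_cokernel C q' f" for q'
  proof -
    note Q' = cokernelD[OF q']
    obtain a where a: "a \<in> Arr C" "Dom C a = Cod C q" "Cod C a = Cod C q'" "a \<cdot> q = q'"
      using cokernel_desc[OF q, of q'] Q' by auto
    obtain b where b: "b \<in> Arr C" "Dom C b = Cod C q'" "Cod C b = Cod C q" "b \<cdot> q' = q"
      using cokernel_desc[OF q', of q] Q Q' by auto
    have "b \<cdot> a = Ide C (Cod C q)"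
      using epi_cancel[OF cokernel_epi[OF q], of "b \<cdot> a" "Ide C (Cod C q)"] a b Q by (simp add: comp_assoc)
    hence "is_mono C a" using mono_of_comp[of b a] a b Q ide_mono[of "Cod C q"] by simp
    thus ?thesis using kernel_mono_comp[of a q m] a m Q by simp
  qed
  ultimately show ?thesis using that[of m e] M e by metis
qed

text \<open>This form supplies an epimorphism onto the kernel of \<open>g\<close>, which is what
  local lifting consumes. Forwards, the image \<open>m\<close> and the given \<open>k\<close> are
  kernels of the same \<open>q\<close> and differ by an epimorphism \<open>a\<close>; backwards, the
  epimorphism \<open>e\<close> does not affect the cokernel.\<close>

lemma exact_at_iff:
  "exact_at C f g \<longleftrightarrow> (\<exists>m e. is_epi C e \<and> is_kernel C m g \<and> Cod C e = Dom C m \<and> f = m \<cdot> e)"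
proof
  assume "exact_at C f g"
  then obtain q k where qk: "is_cokernel C q f" "is_kernel C k q" "is_kernel C k g"
    by (auto simp: exact_at_def)
  obtain m e where me: "is_mono C m" "is_epi C e" "Cod C e = Dom C m" "f = m \<cdot> e" "is_kernel C m q"
    using image_factorization[of f] cokernelD[OF qk(1)] qk(1) by metis
  note K = kernelD[OF qk(2)] and M = kernelD[OF me(5)] and G = kernelD[OF qk(3)]
  have [simp]: "is_epi C e" by fact
  obtain a where a: "a \<in> Arr C" "Dom C a = Dom C m" "Cod C a = Dom C k" "k \<cdot> a = m"
    using kernel_lift[OF qk(2), of m] M by auto
  obtain b where b: "b \<in> Arr C" "Dom C b = Dom C k" "Cod C b = Dom C m" "m \<cdot> b = k"
    using kernel_lift[OF me(5), of k] K by auto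
  have "a \<cdot> b = Ide C (Dom C k)"
    using mono_cancel[OF kernel_mono[OF qk(2)], of "a \<cdot> b" "Ide C (Dom C k)"] a b K
    by (simp flip: comp_assoc)
  hence "is_epi C a" using epi_of_comp[of a b] a b K ide_epi[of "Dom C k"] by simp
  hence "is_epi C (a \<cdot> e)" using me a by (intro epi_comp) auto
  moreover have "f = k \<cdot> (a \<cdot> e)" using a me K by (simp flip: comp_assoc)
  ultimately show "\<exists>m e. is_epi C e \<and> is_kernel C m g \<and> Cod C e = Dom C m \<and> f = m \<cdot> e"
    using qk(3) a me by (intro exI[of _ k] exI[of _ "a \<cdot> e"]) simp
next
  assume "\<exists>m e. is_epi C e \<and> is_kernel C m g \<and> Cod C e = Dom C m \<and> f = m \<cdot> e"
  then obtain m e where me: "is_epi C e" "is_kernel C m g" "Cod C e = Dom C m" "f = m \<cdot> e" by blast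
  note M = kernelD[OF me(2)] kernel_mono[OF me(2)]
  obtain q where q: "is_cokernel C q m" using M ex_cokernel by blast
  have "is_cokernel C q f"
    using abelian_category.kernel_mono_comp[OF op_abelian, of e m q] me M q by simp
  thus "exact_at C f g" unfolding exact_at_def
    using mono_kernel_cokernel[OF M(5) q] me M by auto
qed

text \<open>The witnesses exchange roles: the kernel \<open>k\<close> of \<open>g\<close> becomes
  the cokernel in the opposite category, and \<open>q\<close> is the cokernel of \<open>k\<close>
  because an epimorphism is the cokernel of its kernel.\<close>

lemma op_exact_at: "exact_at C f g \<Longrightarrow> exact_at (op_cat C) g f"
  unfolding exact_at_def
  by (auto dest: cokernel_epi intro: epi_cokernel_kernel)

lemma exact_arr [simp]:
  "exact_at C f g \<Longrightarrow> f \<in> Arr C" "exact_at C f g \<Longrightarrow> g \<in> Arr C" "exact_at C f g \<Longrightarrow> Cod C f = Dom C g"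
  by (auto simp: exact_at_def dest: cokernelD kernelD)

lemma exact_comp_zero:
  assumes "exact_at C f g"
  shows "g \<cdot> f = Zero C (Dom C f) (Cod C g)"
proof -
  obtain m e where me: "is_epi C e" "is_kernel C m g" "Cod C e = Dom C m" "f = m \<cdot> e"
    using assms exact_at_iff by blast
  thus ?thesis using kernelD[OF me(2)] comp_assoc[of e m g] by simp
qed

lemma zero_object_arr:
  assumes "is_zero_object C Z" "f \<in> Arr C"
  shows "Dom C f = Z \<Longrightarrow> f = Zero C Z (Cod C f)" "Cod C f = Z \<Longrightarrow> f = Zero C (Dom C f) Z"
  using assms zero_simps[of Z "Cod C f"] zero_simps[of "Dom C f" Z] unfolding is_zero_object_def
  by (metis Hom_iff Arr_objs)+

lemma zero_object_obj: "is_zero_object C Z \<Longrightarrow> Z \<in> Obj C"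
  by (simp add: is_zero_object_def)

lemma kernel_zero_of_mono:
  assumes "is_mono C g" "is_zero_object C Z"
  shows "is_kernel C (Zero C Z (Dom C g)) g"
proof (rule kernelI)
  note [simp] = zero_object_obj[OF assms(2)]
  show "is_mono C (Zero C Z (Dom C g))"
    using assms zero_object_arr(2)[OF assms(2)] by (intro monoI) auto
  fix h assume h: "h \<in> Arr C" "Cod C h = Dom C g" "g \<cdot> h = Zero C (Dom C h) (Cod C g)"
  hence "h = Zero C (Dom C h) (Dom C g)" using mono_zero[OF assms(1)] by auto
  thus "\<exists>u\<in>Arr C. Dom C u = Dom C h \<and> Cod C u = Dom C (Zero C Z (Dom C g)) \<and> Zero C Z (Dom C g) \<cdot> u = h"
    using assms h by (intro bexI[of _ "Zero C (Dom C h) Z"]) auto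
qed (use assms zero_object_obj in auto)

text \<open>The zero arrow is an epimorphism onto a zero object followed by the kernel of
  \<open>g\<close>. The object \<open>W\<close> is arbitrary: in a trivial 2-extension the middle
  zero arrow goes from \<open>Y\<close> to \<open>X\<close>.\<close>

lemma exact_zero_mono:
  assumes "is_mono C g" "W \<in> Obj C" "X = Dom C g"
  shows "exact_at C (Zero C W X) g"
proof -
  obtain Z where Z: "is_zero_object C Z" using ex_zero_object by blast
  note [simp] = zero_object_obj[OF Z]
  have "is_epi C (Zero C W Z)"
    using zero_object_arr(1)[OF Z] assms by (intro epiI) auto
  thus ?thesis using kernel_zero_of_mono[OF assms(1) Z] assms unfolding exact_at_iff
    by (intro exI[of _ "Zero C Z X"] exI[of _ "Zero C W Z"]) simp
qed

lemma exact_epi_zero: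
  assumes "is_epi C f" "W \<in> Obj C" "X = Cod C f"
  shows "exact_at C f (Zero C X W)"
proof -
  interpret op: abelian_category "op_cat C" by (rule op_abelian)
  have "exact_at (op_cat C) (Zero (op_cat C) W X) f"
    by (rule op.exact_zero_mono) (simp_all add: assms)
  from op.op_exact_at[OF this] show ?thesis by (simp only: op_op op_simps)
qed

lemma mono_of_exact_zero:
  assumes "exact_at C (Zero C W X) g" "W \<in> Obj C" "X = Dom C g"
  shows "is_mono C g"
proof -
  have X: "X = Dom C g" "g \<in> Arr C" using assms by auto
  obtain m e where me: "is_epi C e" "is_kernel C m g" "Cod C e = Dom C m" "Zero C W X = m \<cdot> e"
    using assms exact_at_iff by blast
  note M = kernelD[OF me(2)]
  have "Dom C e = W" using me M X assms by (metis Arr_objs(1) comp_simps(2) epi_arr zero_simps(2))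
  hence "m = Zero C (Cod C e) (Cod C m)" using epi_zero[OF me(1), of m] me M X by simp
  show ?thesis
  proof (rule monoI)
    fix t assume t: "t \<in> Arr C" "Cod C t = Dom C g" "g \<cdot> t = Zero C (Dom C t) (Cod C g)"
    obtain u where "u \<in> Arr C" "Dom C u = Dom C t" "Cod C u = Dom C m" "m \<cdot> u = t"
      using kernel_lift[OF me(2) t] by auto
    thus "t = Zero C (Dom C t) (Dom C g)" using \<open>m = _\<close> M me
      by (metis Arr_objs(2) zero_comp)
  qed fact
qed

subsection \<open>Pushouts and pullbacks\<close>

lemma biproductD:
  assumes "is_biproduct C P X Y i j p q"
  shows "P \<in> Obj C" "X \<in> Obj C" "Y \<in> Obj C"
    "i \<in> Arr C" "Dom C i = X" "Cod C i = P" "j \<in> Arr C" "Dom C j = Y" "Cod C j = P"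
    "p \<in> Arr C" "Dom C p = P" "Cod C p = X" "q \<in> Arr C" "Dom C q = P" "Cod C q = Y"
    "p \<cdot> i = Ide C X" "q \<cdot> j = Ide C Y" "p \<cdot> j = Zero C Y X" "q \<cdot> i = Zero C X Y"
    "(i \<cdot> p) \<boxplus> (j \<cdot> q) = Ide C P"
  using assms by (auto simp: is_biproduct_def Hom_iff)

lemma biproduct_joint_epi:
  assumes "is_biproduct C P X Y i j p q" "s \<in> Arr C" "t \<in> Arr C" "Dom C s = P" "Dom C t = P"
    "Cod C s = Cod C t" "s \<cdot> i = t \<cdot> i" "s \<cdot> j = t \<cdot> j"
  shows "s = t"
proof -
  note B = biproductD[OF assms(1)]
  have *: "u = (u \<cdot> i) \<cdot> p \<boxplus> (u \<cdot> j) \<cdot> q" if "u \<in> Arr C" "Dom C u = P" for u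
  proof -
    have "u = u \<cdot> ((i \<cdot> p) \<boxplus> (j \<cdot> q))" using that B by simp
    also have "\<dots> = u \<cdot> (i \<cdot> p) \<boxplus> u \<cdot> (j \<cdot> q)" by (rule comp_add) (use that B(1-15) in simp_all)
    also have "\<dots> = (u \<cdot> i) \<cdot> p \<boxplus> (u \<cdot> j) \<cdot> q" using that B(1-15) by (simp add: comp_assoc)
    finally show ?thesis .
  qed
  show ?thesis using *[OF assms(2,4)] *[OF assms(3,5)] assms(7,8) by simp
qed

lemma biproduct_copair:
  assumes "is_biproduct C P X Y i j p q" "f \<in> Arr C" "g \<in> Arr C" "Dom C f = X" "Dom C g = Y"
    "Cod C f = Cod C g"
  obtains w where "w \<in> Arr C" "Dom C w = P" "Cod C w = Cod C g" "w \<cdot> i = f" "w \<cdot> j = g"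
proof -
  note B = biproductD[OF assms(1)]
  let ?w = "f \<cdot> p \<boxplus> g \<cdot> q"
  have "?w \<cdot> i = f" "?w \<cdot> j = g"
    using B assms(2-) by (simp_all add: add_comp comp_assoc)
  with that[of ?w] show ?thesis using B assms(2-) by simp
qed

lemma biproduct_ses:
  assumes "is_biproduct C P X Y i j p q"
  shows "ses i q"
proof (rule ses_cokernel)
  note B = biproductD[OF assms(1)]
  show "is_mono C i" using mono_of_comp[of p i] B ide_mono[of X] by simp
  show "is_cokernel C q i"
  proof (rule cokernelI)
    show "is_epi C q" using epi_of_comp[of q j] B ide_epi[of Y] by simp
    fix h assume h: "h \<in> Arr C" "Dom C h = Cod C i" "h \<cdot> i = Zero C (Dom C i) (Cod C h)"
    have "(h \<cdot> j) \<cdot> q = h"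
      by (rule biproduct_joint_epi[OF assms]) (use B h in \<open>simp_all add: comp_assoc\<close>)
    thus "\<exists>u\<in>Arr C. Cod C u = Cod C h \<and> Dom C u = Cod C q \<and> u \<cdot> q = h"
      using B h by (intro bexI[of _ "h \<cdot> j"]) auto
  qed (use B in auto)
qed

text \<open>The construction is the cokernel of \<open>(l, -m)\<close> into the biproduct of
  \<open>Cod l\<close> and \<open>Cod m\<close>. The point is that pushing out a short exact
  sequence along an arrow from its left term keeps its right term. The last two clauses are
  existence and uniqueness in the universal property.\<close>

lemma pushout:
  assumes "ses m p" "l \<in> Arr C" "Dom C l = Dom C m"
  obtains k e v where "ses k e" "Dom C k = Cod C l" "Cod C e = Cod C p"
    "v \<in> Arr C" "Dom C v = Dom C p" "Cod C v = Dom C e" "v \<cdot> m = k \<cdot> l" "e \<cdot> v = p"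
    "\<And>f c. \<lbrakk>f \<in> Arr C; c \<in> Arr C; Dom C f = Dom C p; Dom C c = Cod C l; Cod C c = Cod C f;
        f \<cdot> m = c \<cdot> l\<rbrakk> \<Longrightarrow> \<exists>w\<in>Arr C. Dom C w = Dom C e \<and> Cod C w = Cod C f \<and> w \<cdot> v = f \<and> w \<cdot> k = c"
    "\<And>s t. \<lbrakk>s \<in> Arr C; t \<in> Arr C; Dom C s = Dom C e; Dom C t = Dom C e; Cod C s = Cod C t;
        s \<cdot> v = t \<cdot> v; s \<cdot> k = t \<cdot> k\<rbrakk> \<Longrightarrow> s = t"
proof -
  note S = sesD[OF assms(1)]
  obtain P iB iN pB pN where bp: "is_biproduct C P (Cod C l) (Cod C m) iB iN pB pN"
    using ex_biproduct[of "Cod C l" "Cod C m"] assms S by auto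
  note B = biproductD[OF bp]
  define j where "j = Sub (iB \<cdot> l) (iN \<cdot> m)"
  have j: "j \<in> Arr C" "Dom C j = Dom C m" "Cod C j = P"
    using B S assms by (simp_all add: j_def)
  have hj: "h \<cdot> j = Sub (h \<cdot> iB \<cdot> l) (h \<cdot> iN \<cdot> m)" if "h \<in> Arr C" "Dom C h = P" for h
    unfolding j_def using B S assms that by (simp add: comp_sub comp_assoc)
  \<comment> \<open>Up to sign \<open>pN \<cdot> j\<close> is \<open>m\<close>, so \<open>j\<close>
    is monic because \<open>m\<close> is. The same computation shows below that
    \<open>iB \<cdot> t = j \<cdot> u\<close> forces both sides to vanish.\<close>
  have pj: "u = Zero C (Dom C u) (Dom C m)"
    if "u \<in> Arr C" "Cod C u = Dom C m" "pN \<cdot> (j \<cdot> u) = Zero C (Dom C u) (Cod C m)" for u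
  proof -
    have "pN \<cdot> (j \<cdot> u) = Sub (Zero C (Dom C m) (Cod C m)) m \<cdot> u"
      using hj[of pN] B j S that assms by (simp flip: comp_assoc)
    also have "\<dots> = Sub (Zero C (Dom C u) (Cod C m)) (m \<cdot> u)"
      using S that by (subst sub_comp) auto
    finally have "Zero C (Dom C u) (Cod C m) = m \<cdot> u"
      using that S by - (rule sub_eq_zero, auto)
    thus ?thesis using mono_zero[OF S(3), of u] that by simp
  qed
  have mj: "is_mono C j"
  proof (rule monoI)
    fix t assume "t \<in> Arr C" "Cod C t = Dom C j" "j \<cdot> t = Zero C (Dom C t) (Cod C j)"
    thus "t = Zero C (Dom C t) (Dom C j)" using pj[of t] B j by simp
  qed fact
  obtain q where q: "is_cokernel C q j" using ex_cokernel j by blast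
  note Q = cokernelD[OF q] cokernel_epi[OF q]
  have Q': "Dom C q = P" using Q j by simp
  define k v where "k = q \<cdot> iB" and "v = q \<cdot> iN"
  have kv: "k \<in> Arr C" "Dom C k = Cod C l" "Cod C k = Cod C q"
    "v \<in> Arr C" "Dom C v = Cod C m" "Cod C v = Cod C q"
    using B Q Q' by (simp_all add: k_def v_def)
  have vm: "v \<cdot> m = k \<cdot> l"
    using hj[of q] B Q j kv Q' assms(2,3) S unfolding k_def v_def
    by - (rule sym, rule sub_eq_zero, auto)
  have joint: "s = t" if "s \<in> Arr C" "t \<in> Arr C" "Dom C s = Cod C q" "Dom C t = Cod C q"
    "Cod C s = Cod C t" "s \<cdot> v = t \<cdot> v" "s \<cdot> k = t \<cdot> k" for s t
  proof -
    have "s \<cdot> q = t \<cdot> q"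
      by (rule biproduct_joint_epi[OF bp])
        (use that B Q(1) Q' in \<open>simp_all add: comp_assoc k_def v_def\<close>)
    thus ?thesis using epi_cancel[OF Q(5), of s t] that by simp
  qed
  have univ: "\<exists>w\<in>Arr C. Dom C w = Cod C q \<and> Cod C w = Cod C f \<and> w \<cdot> v = f \<and> w \<cdot> k = c"
    if fc: "f \<in> Arr C" "c \<in> Arr C" "Dom C f = Dom C p" "Dom C c = Cod C l" "Cod C c = Cod C f"
      "f \<cdot> m = c \<cdot> l" for f c
  proof -
    obtain h where h: "h \<in> Arr C" "Dom C h = P" "Cod C h = Cod C f" "h \<cdot> iB = c" "h \<cdot> iN = f"
      using biproduct_copair[OF bp, of c f] fc S by auto
    have "h \<cdot> j = Zero C (Dom C j) (Cod C h)"
      using hj[of h] h fc S j assms by simp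
    then obtain w where w: "w \<in> Arr C" "Cod C w = Cod C h" "Dom C w = Cod C q" "w \<cdot> q = h"
      using cokernel_desc[OF q, of h] h j by auto
    have "w \<cdot> v = h \<cdot> iN" "w \<cdot> k = h \<cdot> iB" unfolding v_def k_def w(4)[symmetric]
      using w(1-3) B Q(1) Q' by (simp_all add: comp_assoc)
    with w h show ?thesis by auto
  qed
  obtain e where e: "e \<in> Arr C" "Dom C e = Cod C q" "Cod C e = Cod C p" "e \<cdot> v = p"
    "e \<cdot> k = Zero C (Cod C l) (Cod C p)"
    using univ[of p "Zero C (Cod C l) (Cod C p)"] S assms by auto
  have "is_epi C e" using epi_of_comp[of e v] e kv S by simp
  moreover have "is_mono C k"
  proof (rule monoI)
    fix t assume t: "t \<in> Arr C" "Cod C t = Dom C k" "k \<cdot> t = Zero C (Dom C t) (Cod C k)"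
    have "q \<cdot> (iB \<cdot> t) = Zero C (Dom C t) (Cod C q)"
      using t(1,2,3) kv B Q(1) Q' comp_assoc[of t iB q] by (simp flip: k_def)
    then obtain u where u: "u \<in> Arr C" "Dom C u = Dom C t" "Cod C u = Dom C j" "j \<cdot> u = iB \<cdot> t"
      using kernel_lift[OF mono_kernel_cokernel[OF mj q], of "iB \<cdot> t"] t B kv Q' by auto
    have "pN \<cdot> (iB \<cdot> t) = Zero C (Dom C t) (Cod C m)"
      using B t kv comp_assoc[of t iB pN] by simp
    hence "u = Zero C (Dom C u) (Dom C m)" using pj[of u] u j by simp
    hence "iB \<cdot> t = Zero C (Dom C t) P" using u j by (metis Arr_objs(1) comp_zero)
    hence "pB \<cdot> (iB \<cdot> t) = Zero C (Dom C t) (Cod C l)" using B t by simp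
    thus "t = Zero C (Dom C t) (Dom C k)"
      using B(1-19) t(1,2) kv comp_assoc[of t iB pB] by simp
  qed (use kv in simp)
  moreover have "is_cokernel C e k"
  proof (rule cokernelI)
    fix h assume h: "h \<in> Arr C" "Dom C h = Cod C k" "h \<cdot> k = Zero C (Dom C k) (Cod C h)"
    have "(h \<cdot> v) \<cdot> m = h \<cdot> k \<cdot> l"
      using h(1,2) kv S assms vm comp_assoc[of m v h] comp_assoc[of l k h] by simp
    hence "(h \<cdot> v) \<cdot> m = Zero C (Dom C m) (Cod C h)" using h kv assms by simp
    then obtain s where s: "s \<in> Arr C" "Cod C s = Cod C h" "Dom C s = Cod C p" "s \<cdot> p = h \<cdot> v"
      using cokernel_desc[OF S(2), of "h \<cdot> v"] h kv S by auto
    have "(s \<cdot> e) \<cdot> v = h \<cdot> v" "(s \<cdot> e) \<cdot> k = h \<cdot> k"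
      using assms(2) s h kv e S comp_assoc[of v e s] comp_assoc[of k e s] by simp_all
    hence "s \<cdot> e = h"
      using joint[of "s \<cdot> e" h] s(1-3) h(1,2) kv e(1-3) by simp
    thus "\<exists>u\<in>Arr C. Cod C u = Cod C h \<and> Dom C u = Cod C e \<and> u \<cdot> e = h" using s e by auto
  qed (use \<open>is_epi C e\<close> kv e in auto)
  ultimately have "ses k e" by (simp add: ses_cokernel)
  show ?thesis
    by (rule that[OF \<open>ses k e\<close>, of v]) (use kv e vm S univ joint in auto)
qed

lemma op_ses: "abelian_category.ses (op_cat C) e k \<longleftrightarrow> ses k e"
  by (auto simp: ses_def abelian_category.ses_def[OF op_abelian])

lemma pullback:
  assumes "ses k g" "l \<in> Arr C" "Cod C l = Cod C g"
  obtains k' e v where "ses k' e" "Cod C e = Dom C l" "Dom C k' = Dom C k"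
    "v \<in> Arr C" "Cod C v = Dom C g" "Dom C v = Dom C e" "g \<cdot> v = l \<cdot> e"
proof -
  interpret op: abelian_category "op_cat C" by (rule op_abelian)
  have "op.ses g k" using assms op_ses by simp
  note S = sesD[OF assms(1)]
  show ?thesis
    by (rule op.pushout[OF \<open>op.ses g k\<close>, of l])
      (use assms op_ses S in \<open>simp_all, metis that sesD(7)\<close>)
qed

section \<open>Local lifting along epimorphisms in place of elements\<close>

lemma epi_kernel_ses: "is_epi C e \<Longrightarrow> \<exists>k. ses k e"
  using ex_kernel ses_kernel epi_arr by blast

text \<open>This replaces the choice of a preimage: any arrow into the codomain of an epimorphism
  lifts once it is restricted to an epimorphic cover of its domain.\<close>

lemma epi_pullback:
  assumes "is_epi C g" "l \<in> Arr C" "Cod C l = Cod C g"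
  obtains e v where "is_epi C e" "Cod C e = Dom C l"
    "v \<in> Arr C" "Cod C v = Dom C g" "Dom C v = Dom C e" "g \<cdot> v = l \<cdot> e"
  using epi_kernel_ses[OF assms(1)] pullback[OF _ assms(2,3)] sesD(4) by metis

text \<open>A cycle is locally a boundary: \<open>\<phi>\<close> lifts to the kernel of
  \<open>c\<close>, which \<open>d\<close> covers by an epimorphism.\<close>

lemma exact_local_lift:
  assumes "exact_at C d c" "\<phi> \<in> Arr C" "Cod C \<phi> = Dom C c" "c \<cdot> \<phi> = Zero C (Dom C \<phi>) (Cod C c)"
  obtains p f where "is_epi C p" "Cod C p = Dom C \<phi>" "f \<in> Arr C" "Dom C f = Dom C p" "Cod C f = Dom C d"
    "d \<cdot> f = \<phi> \<cdot> p"
proof -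
  obtain m e where me: "is_epi C e" "is_kernel C m c" "Cod C e = Dom C m" "d = m \<cdot> e"
    using assms(1) exact_at_iff by blast
  note M = kernelD[OF me(2)]
  obtain u where u: "u \<in> Arr C" "Dom C u = Dom C \<phi>" "Cod C u = Dom C m" "m \<cdot> u = \<phi>"
    using kernel_lift[OF me(2), of \<phi>] assms by auto
  obtain p f where pf: "is_epi C p" "Cod C p = Dom C u" "f \<in> Arr C" "Cod C f = Dom C e"
      "Dom C f = Dom C p" "e \<cdot> f = u \<cdot> p"
    using epi_pullback[OF me(1), of u] u me by metis
  have "d \<cdot> f = m \<cdot> (u \<cdot> p)" using pf(1-5) M me comp_assoc[of f e m] by (simp flip: pf(6))
  also have "\<dots> = \<phi> \<cdot> p" using u pf(1,2) M comp_assoc[of p u m] by simp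
  finally show ?thesis using that[of p f] pf me u M by simp
qed

subsection \<open>The triviality criterion\<close>

text \<open>
  Sequences are read from their right end from here on: \<open>[d\<^sub>1, \<dots>, d\<^sub>r]\<close> stands for
  \<open>0 \<rightarrow> Dom d\<^sub>r \<rightarrow> \<dots> \<rightarrow> Dom d\<^sub>1 \<rightarrow> Cod d\<^sub>1\<close>, and \<open>rev_exact\<close> leaves out exactness at \<open>Cod d\<^sub>1\<close>.
\<close>

fun rev_exact :: "'m list \<Rightarrow> bool" where
  "rev_exact [] \<longleftrightarrow> False"
| "rev_exact [d] \<longleftrightarrow> is_mono C d"
| "rev_exact (d # d' # ds) \<longleftrightarrow> exact_at C d' d \<and> rev_exact (d' # ds)"

text \<open>Dropping the leftmost arrow of an extension destroys \<open>rev_exact\<close>, since the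
  new last arrow need not be mono. The lemmas on \<open>lifts\<close> that only compose arrows
  therefore ask for this typing condition.\<close>

fun composable :: "'m list \<Rightarrow> bool" where
  "composable [] \<longleftrightarrow> True"
| "composable [d] \<longleftrightarrow> d \<in> Arr C"
| "composable (d # d' # ds) \<longleftrightarrow> d \<in> Arr C \<and> Cod C d' = Dom C d \<and> composable (d' # ds)"

text \<open>
  The triviality criterion relative to \<open>\<phi> : W \<rightarrow> Cod d\<^sub>1\<close>, by recursion along the sequence \<open>N\<close>, which
  ends in \<open>W\<close>. The list omits the leftmost arrow of the extension.
\<close>

fun lifts :: "'m list \<Rightarrow> 'm \<Rightarrow> bool" where
  "lifts [] \<phi> \<longleftrightarrow> False"
| "lifts [d] \<phi> \<longleftrightarrow> (\<exists>l. l \<in> Arr C \<and> Dom C l = Dom C \<phi> \<and> Cod C l = Dom C d \<and> d \<cdot> l = \<phi>)"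
| "lifts (d # d' # ds) \<phi> \<longleftrightarrow> (\<exists>p f m. is_epi C p \<and> Cod C p = Dom C \<phi> \<and> f \<in> Arr C \<and>
     Dom C f = Dom C p \<and> Cod C f = Dom C d \<and> d \<cdot> f = \<phi> \<cdot> p \<and> is_kernel C m p \<and>
     lifts (d' # ds) (f \<cdot> m))"

text \<open>The recursion starts at the right end, like that of \<open>lifts\<close>, so that both
  unfold together. The outer vertical arrows \<open>h\<close> (right) and \<open>g\<close> (left)
  are parameters because morphisms of extensions fix them.\<close>

fun chain_map :: "'m list \<Rightarrow> 'm list \<Rightarrow> 'm \<Rightarrow> 'm \<Rightarrow> bool" where
  "chain_map [] [] h g \<longleftrightarrow> h = g"
| "chain_map (d # ds) (d' # ds') h g \<longleftrightarrow> (\<exists>h'. h' \<in> Arr C \<and> Dom C h' = Dom C d \<and> Cod C h' = Dom C d' \<and>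
     d' \<cdot> h' = h \<cdot> d \<and> chain_map ds ds' h' g)"
| "chain_map _ _ _ _ \<longleftrightarrow> False"

lemma rev_exact_Cons: "rev_exact (d # ds) \<Longrightarrow> d \<in> Arr C"
  by (cases ds) auto

lemma rev_exact_composable: "rev_exact ds \<Longrightarrow> composable ds"
  by (induction ds rule: rev_exact.induct) (auto dest: exact_arr)

lemma composable_Cons: "composable (d # ds) \<Longrightarrow> d \<in> Arr C \<and> composable ds"
  by (cases ds) auto

lemma composable_appendD: "composable (xs @ ys) \<Longrightarrow> composable xs"
proof (induction xs rule: composable.induct)
  case (2 d) thus ?case using composable_Cons[of d ys] by simp
qed auto

lemma chain_map_append:
  "length A = length A' \<Longrightarrow>
    chain_map (A @ B) (A' @ B') h g \<longleftrightarrow> (\<exists>h'. chain_map A A' h h' \<and> chain_map B B' h' g)"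
  by (induction A A' arbitrary: h rule: list_induct2) auto

section \<open>Stability of the lifting criterion under composition, addition and chain maps\<close>

lemma lifts_ConsI:
  "\<lbrakk>is_epi C p; Cod C p = Dom C \<phi>; f \<in> Arr C; Dom C f = Dom C p; Cod C f = Dom C d;
    d \<cdot> f = \<phi> \<cdot> p; is_kernel C m p; lifts (d' # ds) (f \<cdot> m)\<rbrakk> \<Longrightarrow> lifts (d # d' # ds) \<phi>"
  by auto

text \<open>The epimorphism \<open>p\<close> is pulled back along \<open>r\<close>. The kernel of
  the pullback maps to the kernel of \<open>p\<close>, and the induction hypothesis is applied to
  that map \<open>s\<close>.\<close>

lemma lifts_comp:
  assumes "lifts ds \<phi>" "composable ds" "\<phi> \<in> Arr C" "Cod C \<phi> = Cod C (hd ds)"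
    "r \<in> Arr C" "Cod C r = Dom C \<phi>"
  shows "lifts ds (\<phi> \<cdot> r)"
  using assms
proof (induction ds \<phi> arbitrary: r rule: lifts.induct)
  case (2 d \<phi>)
  then obtain l where l: "l \<in> Arr C" "Dom C l = Dom C \<phi>" "Cod C l = Dom C d" "d \<cdot> l = \<phi>" by auto
  have "d \<cdot> (l \<cdot> r) = \<phi> \<cdot> r" using comp_assoc[of r l d] l 2(2-) by simp
  with l 2(2-) show ?case unfolding lifts.simps by (intro exI[of _ "l \<cdot> r"]) simp
next
  case (3 d d' ds \<phi>)
  then obtain p f m where p: "is_epi C p" "Cod C p = Dom C \<phi>" "f \<in> Arr C" "Dom C f = Dom C p"
    "Cod C f = Dom C d" "d \<cdot> f = \<phi> \<cdot> p" "is_kernel C m p" "lifts (d' # ds) (f \<cdot> m)" by auto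
  note M = kernelD[OF p(7)]
  have d: "d \<in> Arr C" using 3 by simp
  obtain p' r' where p': "is_epi C p'" "Cod C p' = Dom C r" "r' \<in> Arr C" "Cod C r' = Dom C p"
    "Dom C r' = Dom C p'" "p \<cdot> r' = r \<cdot> p'"
    using epi_pullback[OF p(1), of r] 3 p by metis
  obtain m' where m': "is_kernel C m' p'" using p' ex_kernel by fastforce
  note M' = kernelD[OF m']
  have "p \<cdot> (r' \<cdot> m') = r \<cdot> (p' \<cdot> m')"
    by (rule comp_reassoc) (use p' p M' 3 in auto)
  then obtain s where s: "s \<in> Arr C" "Dom C s = Dom C m'" "Cod C s = Dom C m" "m \<cdot> s = r' \<cdot> m'"
    using kernel_lift[OF p(7), of "r' \<cdot> m'"] M' M p p' 3 by auto
  have "lifts (d' # ds) ((f \<cdot> m) \<cdot> s)"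
    by (rule 3(1)) (use p M s 3 in auto)
  moreover have "(f \<cdot> m) \<cdot> s = (f \<cdot> r') \<cdot> m'"
    using p(3-5) M s p' M' comp_assoc[of s m f] comp_assoc[of m' r' f] by simp
  moreover have "d \<cdot> (f \<cdot> r') = (\<phi> \<cdot> r) \<cdot> p'"
    using p(1-5) p' 3(4-7) d comp_assoc[of r' f d] comp_assoc[of r' p \<phi>] comp_assoc[of p' r \<phi>]
    by (simp add: p(6))
  ultimately show ?case
    using p' p(3-5) m' 3(4-7) by (intro lifts_ConsI[of p' _ "f \<cdot> r'" _ m']) simp_all
qed simp

text \<open>Correcting \<open>f\<close> by \<open>l \<cdot> p\<close> leaves
  \<open>f \<cdot> m\<close> unchanged because \<open>p\<close> kills its kernel \<open>m\<close>,
  so nothing beyond the first arrow is affected.\<close>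

lemma lifts_add:
  assumes "lifts (d # ds) \<phi>" "d \<in> Arr C" "\<phi> \<in> Arr C" "Cod C \<phi> = Cod C d"
    "l \<in> Arr C" "Dom C l = Dom C \<phi>" "Cod C l = Dom C d"
  shows "lifts (d # ds) (\<phi> \<boxplus> d \<cdot> l)"
proof (cases ds)
  case Nil
  then obtain l' where "l' \<in> Arr C" "Dom C l' = Dom C \<phi>" "Cod C l' = Dom C d" "d \<cdot> l' = \<phi>"
    using assms by auto
  thus ?thesis using Nil assms by (auto simp: comp_add intro!: exI[of _ "l' \<boxplus> l"])
next
  case (Cons d' ds')
  then obtain p f m where p: "is_epi C p" "Cod C p = Dom C \<phi>" "f \<in> Arr C" "Dom C f = Dom C p"
    "Cod C f = Dom C d" "d \<cdot> f = \<phi> \<cdot> p" "is_kernel C m p" "lifts (d' # ds') (f \<cdot> m)"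
    using assms by auto
  note M = kernelD[OF p(7)]
  have "(f \<boxplus> l \<cdot> p) \<cdot> m = f \<cdot> m"
    using p(1-5) M assms by (simp add: add_comp comp_assoc)
  moreover have "d \<cdot> (f \<boxplus> l \<cdot> p) = (\<phi> \<boxplus> d \<cdot> l) \<cdot> p"
    using p(1-6) assms by (simp add: add_comp comp_add comp_assoc)
  ultimately show ?thesis
    unfolding Cons using p assms
    by (intro lifts_ConsI[of p _ "f \<boxplus> l \<cdot> p" _ m]) simp_all
qed

text \<open>The identity serves as the epimorphism; its kernel has a zero object as domain, and the
  recursion goes on with a zero arrow.\<close>

lemma lifts_zero:
  assumes "composable ds" "ds \<noteq> []" "W \<in> Obj C" "X = Cod C (hd ds)"
  shows "lifts ds (Zero C W X)"
  using assms
proof (induction ds arbitrary: W X rule: composable.induct)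
  case (2 d) thus ?case by (auto intro!: exI[of _ "Zero C W (Dom C d)"])
next
  case (3 d d' ds)
  obtain Z where Z: "is_zero_object C Z" using ex_zero_object by blast
  note [simp] = zero_object_obj[OF Z]
  have "is_kernel C (Zero C Z W) (Ide C W)"
    using kernel_zero_of_mono[OF ide_mono[of W] Z] 3 by simp
  moreover have "lifts (d' # ds) (Zero C Z (Dom C d))" by (rule 3(1)) (use 3 in auto)
  ultimately show ?case using 3 ide_epi[of W]
    by (intro lifts_ConsI[of "Ide C W" _ "Zero C W (Dom C d)" _ "Zero C Z W"]) simp_all
qed simp

lemma lifts_factor:
  assumes "composable (d # ds)" "l \<in> Arr C" "Cod C l = Dom C d"
  shows "lifts (d # ds) (d \<cdot> l)"
proof -
  have "d \<in> Arr C" using composable_Cons assms by blast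
  thus ?thesis
    using lifts_add[OF lifts_zero[OF assms(1), of "Dom C l" "Cod C d"], of l] assms by simp
qed

text \<open>The epimorphisms live over the domain of \<open>\<phi>\<close> and can be kept; only the
  lifts are composed with the vertical arrows.\<close>

lemma lifts_chain_map:
  assumes "chain_map ds ds' h g" "lifts ds \<phi>" "composable ds" "composable ds'"
    "\<phi> \<in> Arr C" "Cod C \<phi> = Cod C (hd ds)"
    "h \<in> Arr C" "Dom C h = Cod C (hd ds)" "Cod C h = Cod C (hd ds')"
  shows "lifts ds' (h \<cdot> \<phi>)"
  using assms
proof (induction ds \<phi> arbitrary: h ds' rule: lifts.induct)
  case (2 d \<phi>)
  then obtain l where l: "l \<in> Arr C" "Dom C l = Dom C \<phi>" "Cod C l = Dom C d" "d \<cdot> l = \<phi>" by auto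
  obtain d' where ds': "ds' = [d']" using 2(1) by (cases ds'; cases "tl ds'") auto
  then obtain h' where h': "h' \<in> Arr C" "Dom C h' = Dom C d" "Cod C h' = Dom C d'" "d' \<cdot> h' = h \<cdot> d"
    using 2 by auto
  have "d' \<cdot> (h' \<cdot> l) = h \<cdot> (d \<cdot> l)"
    by (rule comp_reassoc) (use l h' 2 ds' in auto)
  hence "d' \<cdot> (h' \<cdot> l) = h \<cdot> \<phi>" using l(4) by simp
  with l h' 2(2-) show ?case unfolding ds' lifts.simps by (intro exI[of _ "h' \<cdot> l"]) simp
next
  case (3 d d2 ds \<phi>)
  obtain d' d2' ds2' where ds': "ds' = d' # d2' # ds2'"
    using 3(2) by (cases ds'; cases "tl ds'") auto
  obtain h' where h': "h' \<in> Arr C" "Dom C h' = Dom C d" "Cod C h' = Dom C d'" "d' \<cdot> h' = h \<cdot> d"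
    "chain_map (d2 # ds) (d2' # ds2') h' g" using 3(2) ds' by auto
  obtain p f m where p: "is_epi C p" "Cod C p = Dom C \<phi>" "f \<in> Arr C" "Dom C f = Dom C p"
    "Cod C f = Dom C d" "d \<cdot> f = \<phi> \<cdot> p" "is_kernel C m p" "lifts (d2 # ds) (f \<cdot> m)"
    using 3 by auto
  note M = kernelD[OF p(7)]
  have d: "d \<in> Arr C" "d' \<in> Arr C" "Dom C d' = Cod C d2'" "Cod C d = Cod C \<phi>" "Cod C d' = Cod C h"
    "Cod C d2 = Dom C d"
    using 3 ds' by auto
  have "lifts (d2' # ds2') (h' \<cdot> (f \<cdot> m))"
    by (rule 3(1)) (use p h' M 3 ds' in auto)
  moreover have "h' \<cdot> (f \<cdot> m) = (h' \<cdot> f) \<cdot> m"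
    using p(1-5) M h'(1-3) comp_assoc[of m f h'] by simp
  moreover have "d' \<cdot> (h' \<cdot> f) = h \<cdot> (d \<cdot> f)"
    by (rule comp_reassoc) (use p h' 3 ds' d in auto)
  hence "d' \<cdot> (h' \<cdot> f) = (h \<cdot> \<phi>) \<cdot> p"
    using p(1-6) 3(6-10) d comp_assoc[of p \<phi> h] by simp
  ultimately show ?case unfolding ds' using p h' 3(6-10)
    by (intro lifts_ConsI[of p _ "h' \<cdot> f" _ m]) simp_all
qed simp

section \<open>Cutting and splicing exact sequences\<close>

lemma epi_descend:
  assumes "is_epi C p" "f \<in> Arr C" "Dom C f = Dom C p"
    "\<And>m. is_kernel C m p \<Longrightarrow> f \<cdot> m = Zero C (Dom C m) (Cod C f)"
  obtains w where "w \<in> Arr C" "Dom C w = Cod C p" "Cod C w = Cod C f" "w \<cdot> p = f"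
proof -
  obtain m where m: "ses m p" using epi_kernel_ses assms(1) by blast
  note M = sesD[OF m]
  show ?thesis using cokernel_desc[OF M(2), of f] assms M that by (metis (no_types))
qed

text \<open>Local lifts along a monomorphism are unique, so a local lift kills the kernel of its
  cover and descends to a global one.\<close>

lemma exact_mono_kernel:
  assumes "exact_at C f g" "is_mono C f"
  shows "is_kernel C f g"
proof (rule kernelI[OF assms(2)])
  fix h assume h: "h \<in> Arr C" "Cod C h = Dom C g" "g \<cdot> h = Zero C (Dom C h) (Cod C g)"
  obtain p f' where p: "is_epi C p" "Cod C p = Dom C h" "f' \<in> Arr C" "Dom C f' = Dom C p"
    "Cod C f' = Dom C f" "f \<cdot> f' = h \<cdot> p"
    using exact_local_lift[OF assms(1) h] by metis
  have A: "f \<in> Arr C" "Cod C f = Dom C g" using assms by auto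
  have "f' \<cdot> m = Zero C (Dom C m) (Cod C f')" if m: "is_kernel C m p" for m
  proof -
    note M = kernelD[OF m]
    have "f \<cdot> (f' \<cdot> m) = h \<cdot> (p \<cdot> m)"
      by (rule comp_reassoc) (use p M A h in auto)
    thus ?thesis using mono_zero[OF assms(2), of "f' \<cdot> m"] M p A h by simp
  qed
  then obtain w where w: "w \<in> Arr C" "Dom C w = Cod C p" "Cod C w = Cod C f'" "w \<cdot> p = f'"
    using epi_descend[OF p(1,3,4)] by metis
  have "f \<cdot> w \<cdot> p = h \<cdot> p" using w p comp_assoc[of p w f] A by simp
  hence "f \<cdot> w = h" by (rule epi_cancel[OF p(1), rotated -1]) (use w(1-3) p(1-5) A h(1,2) in simp_all)
  thus "\<exists>u\<in>Arr C. Dom C u = Dom C h \<and> Cod C u = Dom C f \<and> f \<cdot> u = h" using w p by auto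
qed (use assms exact_comp_zero[OF assms(1)] in auto)

lemma exact_mono_comp:
  assumes "is_mono C m" "g \<in> Arr C" "Cod C g = Dom C m"
  shows "exact_at C f (m \<cdot> g) \<longleftrightarrow> exact_at C f g"
  unfolding exact_at_iff kernel_mono_comp[OF assms] ..

lemma exact_epi_comp:
  assumes "exact_at C f g" "is_epi C e" "Cod C e = Dom C f"
  shows "exact_at C (f \<cdot> e) g"
proof -
  obtain m e' where me: "is_epi C e'" "is_kernel C m g" "Cod C e' = Dom C m" "f = m \<cdot> e'"
    using assms(1) exact_at_iff by blast
  note M = kernelD[OF me(2)]
  have E: "Cod C e = Dom C e'" using me M assms by simp
  hence "is_epi C (e' \<cdot> e)" using me assms by (intro epi_comp) auto
  moreover have "f \<cdot> e = m \<cdot> (e' \<cdot> e)" using me M assms(2) E comp_assoc[of e e' m] by simp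
  ultimately show ?thesis using me E assms(2) unfolding exact_at_iff
    by (intro exI[of _ m] exI[of _ "e' \<cdot> e"]) simp
qed

lemma ses_exact: "ses m p \<Longrightarrow> exact_at C m p"
  unfolding exact_at_iff using sesD[of m p]
  by (intro exI[of _ m] exI[of _ "Ide C (Dom C m)"]) (auto intro: ide_epi)

text \<open>Yoneda splice at the right end: \<open>e # R\<close> resolves the left term of the short
  exact sequence.\<close>

lemma rev_exact_ConsI:
  assumes "rev_exact (e # R)" "ses m p" "Cod C e = Dom C m" "is_epi C e"
  shows "rev_exact (p # (m \<cdot> e) # R)"
proof -
  note S = sesD[OF assms(2)]
  have "rev_exact ((m \<cdot> e) # R)"
    using assms S by (cases R) (auto intro: mono_comp simp: exact_mono_comp)
  thus ?thesis using exact_epi_comp[OF ses_exact[OF assms(2)] assms(4)] assms by simp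
qed

text \<open>The inverse of the splice: \<open>Dom m\<close> is the first syzygy and
  \<open>e # R\<close> resolves it. This drives the induction along a resolution.\<close>

lemma rev_exact_ConsE:
  assumes "rev_exact (p # f # R)" "is_epi C p"
  obtains m e where "f = m \<cdot> e" "ses m p" "Cod C e = Dom C m" "is_epi C e" "rev_exact (e # R)"
proof -
  obtain m e where me: "is_epi C e" "is_kernel C m p" "Cod C e = Dom C m" "f = m \<cdot> e"
    using assms(1) exact_at_iff by (metis rev_exact.simps(3))
  note M = kernelD[OF me(2)] kernel_mono[OF me(2)]
  have "rev_exact (e # R)"
    using assms me M by (cases R) (auto simp: exact_mono_comp dest: mono_of_comp)
  thus ?thesis using that me ses_kernel[OF assms(2) me(2)] by metis
qed

text \<open>Precomposition with the epimorphism \<open>g\<close> does not change the image of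
  \<open>k\<close>, so exactness to the right of it persists.\<close>

lemma rev_exact_append_comp:
  assumes "rev_exact (R @ [k])" "R \<noteq> []" "is_epi C g" "Cod C g = Dom C k" "rev_exact ((k \<cdot> g) # S)"
  shows "rev_exact (R @ (k \<cdot> g) # S)"
  using assms
proof (induction R rule: rev_exact.induct)
  case (2 d) thus ?case by (auto intro: exact_epi_comp)
qed auto

lemma rev_exact_snoc_ses:
  assumes "rev_exact (R @ [k])" "R \<noteq> []" "ses k' g" "Cod C g = Dom C k" "is_mono C k"
  shows "rev_exact (R @ [k \<cdot> g, k'])"
  using rev_exact_append_comp[of R k g "[k']"] assms sesD[OF assms(3)] ses_exact[OF assms(3)]
  by (simp add: exact_mono_comp)

lemma rev_exact_last: "rev_exact R \<Longrightarrow> is_mono C (last R)"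
  by (induction R rule: rev_exact.induct) auto

text \<open>
  The epimorphism \<open>p0\<close> says that \<open>\<phi>\<close> factors through the image of the first arrow of \<open>ds\<close>. Two
  local lifts of \<open>h \<cdot> \<phi>\<close>, one given and one pushed forward from \<open>ds\<close>, differ by something that locally
  lifts one step further, which by \<open>lifts_add\<close> does not matter.
\<close>

lemma lifts_chain_map_back:
  assumes "chain_map (ds @ [k]) (ds' @ [k']) h (Ide C (Dom C k))" "length ds = length ds'"
    "rev_exact (ds @ [k])" "rev_exact (ds' @ [k'])" "lifts ds' (h \<cdot> \<phi>)"
    "\<phi> \<in> Arr C" "Cod C \<phi> = Cod C (hd ds)"
    "h \<in> Arr C" "Dom C h = Cod C (hd ds)" "Cod C h = Cod C (hd ds')"
    "is_epi C p0" "Cod C p0 = Dom C \<phi>" "f0 \<in> Arr C" "Dom C f0 = Dom C p0"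
    "Cod C f0 = Dom C (hd ds)" "hd ds \<cdot> f0 = \<phi> \<cdot> p0"
  shows "lifts ds \<phi>"
  using assms
proof (induction ds arbitrary: ds' h \<phi> p0 f0)
  case Nil thus ?case by simp
next
  case (Cons d ds)
  then obtain d' ds2' where ds': "ds' = d' # ds2'" by (cases ds') auto
  have len: "length ds = length ds2'" using Cons.prems ds' by simp
  from Cons.prems(1) ds' obtain h1 where h1: "h1 \<in> Arr C" "Dom C h1 = Dom C d" "Cod C h1 = Dom C d'"
    "d' \<cdot> h1 = h \<cdot> d" "chain_map (ds @ [k]) (ds2' @ [k']) h1 (Ide C (Dom C k))" by auto
  have d: "d \<in> Arr C" "d' \<in> Arr C"
    using Cons.prems(3,4) ds' rev_exact_Cons by auto
  have \<phi>: "\<phi> \<in> Arr C" "Cod C \<phi> = Cod C d" "h \<in> Arr C" "Dom C h = Cod C d" "Cod C h = Cod C d'"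
    "is_epi C p0" "p0 \<in> Arr C" "Cod C p0 = Dom C \<phi>" "f0 \<in> Arr C" "Dom C f0 = Dom C p0" "Cod C f0 = Dom C d"
    "d \<cdot> f0 = \<phi> \<cdot> p0"
    using Cons.prems ds' by auto
  show ?case
  proof (cases ds)
    case Nil
    with len ds' have N: "ds' = [d']" "ds2' = []" by auto
    have k: "exact_at C k d" "is_mono C k" "exact_at C k' d'" "is_mono C k'"
      using Cons.prems(3,4) Nil ds' N by auto
    have K: "is_kernel C k d" "is_kernel C k' d'" using k exact_mono_kernel by auto
    note K1 = kernelD[OF K(1)] and K2 = kernelD[OF K(2)]
    have hk: "h1 \<cdot> k = k'" "Dom C k' = Dom C k"
      using h1(5) Nil N K1 K2 by (auto dest: sym)
    obtain l where l: "l \<in> Arr C" "Dom C l = Dom C \<phi>" "Cod C l = Dom C d'" "d' \<cdot> l = h \<cdot> \<phi>"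
      using Cons.prems(5) N \<phi> by auto
    have "d' \<cdot> (h1 \<cdot> f0) = h \<cdot> (d \<cdot> f0)"
      by (rule comp_reassoc) (use h1 \<phi> d in auto)
    moreover have "d' \<cdot> (l \<cdot> p0) = h \<cdot> (\<phi> \<cdot> p0)"
      by (rule comp_reassoc) (use l \<phi> d in auto)
    ultimately have "d' \<cdot> Sub (h1 \<cdot> f0) (l \<cdot> p0) = Zero C (Dom C p0) (Cod C d')"
      using h1(1-3) l(1-3) \<phi> d by (simp add: comp_sub)
    then obtain y where y: "y \<in> Arr C" "Dom C y = Dom C p0" "Cod C y = Dom C k"
      "k' \<cdot> y = Sub (h1 \<cdot> f0) (l \<cdot> p0)"
      using kernel_lift[OF K(2), of "Sub (h1 \<cdot> f0) (l \<cdot> p0)"] h1 l \<phi> d hk by auto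
    \<comment> \<open>Both \<open>d\<close> and \<open>d'\<close> have the same kernel object, and
      \<open>h1\<close> matches \<open>k\<close> with \<open>k'\<close>. The correction by
      \<open>k \<cdot> y\<close> turns \<open>h1 \<cdot> f\<close> into \<open>l \<cdot> p0\<close>,
      which vanishes on the kernel of \<open>p0\<close>; injectivity of \<open>k'\<close> then gives
      the same for \<open>f\<close>, so \<open>f\<close> descends to a global lift.\<close>
    define f where "f = Sub f0 (k \<cdot> y)"
    have f: "f \<in> Arr C" "Dom C f = Dom C p0" "Cod C f = Dom C d"
      unfolding f_def using \<phi> y K1 by auto
    have "d \<cdot> (k \<cdot> y) = Zero C (Dom C p0) (Cod C d)"
      using \<phi> y(1-3) K1 d comp_assoc[of y k d] by simp
    hence df: "d \<cdot> f = \<phi> \<cdot> p0"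
      unfolding f_def using \<phi> y(1-3) K1 d by (simp add: comp_sub)
    have "h1 \<cdot> (k \<cdot> y) = k' \<cdot> y"
      using y(1-3) K1 h1(1-3) hk comp_assoc[of y k h1] by simp
    hence "h1 \<cdot> f = Sub (h1 \<cdot> f0) (Sub (h1 \<cdot> f0) (l \<cdot> p0))"
      unfolding f_def using \<phi> y K1 h1(1-3) by (simp add: comp_sub)
    also have "\<dots> = l \<cdot> p0"
      using sub_add[of "h1 \<cdot> f0" "l \<cdot> p0"] h1(1-3) \<phi> l(1-3)
      by (subst sub_eq_iff) auto
    finally have h1f: "h1 \<cdot> f = l \<cdot> p0" .
    have "f \<cdot> m = Zero C (Dom C m) (Cod C f)" if m: "is_kernel C m p0" for m
    proof -
      note M = kernelD[OF m]
      have "d \<cdot> (f \<cdot> m) = \<phi> \<cdot> (p0 \<cdot> m)"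
        by (rule comp_reassoc) (use df f M \<phi> d in auto)
      then obtain z where z: "z \<in> Arr C" "Dom C z = Dom C m" "Cod C z = Dom C k" "k \<cdot> z = f \<cdot> m"
        using kernel_lift[OF K(1), of "f \<cdot> m"] f M \<phi> d by auto
      have "k' \<cdot> z = h1 \<cdot> (k \<cdot> z)"
        using z(1-3) K1 h1(1-3) hk comp_assoc[of z k h1] by simp
      also have "\<dots> = h1 \<cdot> (f \<cdot> m)" using z by simp
      also have "\<dots> = l \<cdot> (p0 \<cdot> m)"
        by (rule comp_reassoc) (use h1f f M \<phi> h1 l in auto)
      also have "\<dots> = Zero C (Dom C z) (Cod C k')" using M l \<phi> z K2 by simp
      finally have "z = Zero C (Dom C z) (Dom C k')"
        using mono_zero[OF k(4), of z] z(1-3) hk by simp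
      hence "k \<cdot> z = Zero C (Dom C m) (Cod C k)" using z(1-3) hk K1
        by (metis Arr_objs(1) comp_zero)
      thus ?thesis using z(4) K1 f by simp
    qed
    then obtain w where w: "w \<in> Arr C" "Dom C w = Cod C p0" "Cod C w = Cod C f" "w \<cdot> p0 = f"
      using epi_descend[OF \<phi>(6) f(1,2)] by metis
    have "d \<cdot> w \<cdot> p0 = \<phi> \<cdot> p0" using w \<phi> d f df comp_assoc[of p0 w d] by simp
    hence "d \<cdot> w = \<phi>" by (rule epi_cancel[OF \<phi>(6), rotated -1]) (use w(1-3) \<phi> d f in simp_all)
    thus ?thesis using Nil w(1-3) \<phi> f by auto
  next
    case (Cons e ds1)
    then obtain e' ds1' where e': "ds2' = e' # ds1'" using len by (cases ds2') auto
    have ex: "exact_at C e d" "exact_at C e' d'" "rev_exact (ds @ [k])" "rev_exact (ds2' @ [k'])"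
      using Cons.prems(3,4) Cons ds' e' by auto
    have comp': "composable ds2'" using rev_exact_composable[OF ex(4)] composable_appendD by blast
    have ee: "e \<in> Arr C" "Cod C e = Dom C d" "e' \<in> Arr C" "Cod C e' = Dom C d'" using ex by auto
    obtain p1 f1 m where p1: "is_epi C p1" "Cod C p1 = Dom C \<phi>" "f1 \<in> Arr C" "Dom C f1 = Dom C p1"
      "Cod C f1 = Dom C d'" "d' \<cdot> f1 = h \<cdot> \<phi> \<cdot> p1" "is_kernel C m p1" "lifts ds2' (f1 \<cdot> m)"
      using Cons.prems(5) \<phi> ds' e' by auto
    note M = kernelD[OF p1(7)]
    \<comment> \<open>A common refinement \<open>P\<close> of the covers \<open>p0\<close> and
      \<open>p1\<close>, over which the two local lifts of \<open>h \<cdot> \<phi>\<close> can be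
      compared; \<open>\<delta>\<close> is their difference.\<close>
    obtain r v where rv: "is_epi C r" "Cod C r = Dom C p0" "v \<in> Arr C" "Cod C v = Dom C p1"
      "Dom C v = Dom C r" "p1 \<cdot> v = p0 \<cdot> r"
      using epi_pullback[OF p1(1), of p0] \<phi> p1 by metis
    define P where "P = p0 \<cdot> r"
    have P: "is_epi C P" "P \<in> Arr C" "Dom C P = Dom C r" "Cod C P = Dom C \<phi>"
      unfolding P_def using epi_comp[of r p0] rv \<phi> by auto
    define F0 F1 where "F0 = f0 \<cdot> r" and "F1 = f1 \<cdot> v"
    have F: "F0 \<in> Arr C" "Dom C F0 = Dom C r" "Cod C F0 = Dom C d"
      "F1 \<in> Arr C" "Dom C F1 = Dom C r" "Cod C F1 = Dom C d'"
      unfolding F0_def F1_def using rv \<phi> p1 by auto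
    have dF0: "d \<cdot> F0 = \<phi> \<cdot> P" unfolding F0_def P_def
      by (rule comp_reassoc) (use rv \<phi> d in auto)
    have "d' \<cdot> F1 = h \<cdot> \<phi> \<cdot> (p1 \<cdot> v)" unfolding F1_def
      by (rule comp_reassoc) (use rv \<phi> d p1 in auto)
    hence dF1: "d' \<cdot> F1 = h \<cdot> \<phi> \<cdot> P" using rv by (simp add: P_def)
    define \<delta> where "\<delta> = Sub (h1 \<cdot> F0) F1"
    have \<delta>: "\<delta> \<in> Arr C" "Dom C \<delta> = Dom C r" "Cod C \<delta> = Dom C d'"
      unfolding \<delta>_def using F h1 by auto
    have "d' \<cdot> (h1 \<cdot> F0) = h \<cdot> (d \<cdot> F0)"
      by (rule comp_reassoc) (use h1 \<phi> d F in auto)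
    hence "d' \<cdot> (h1 \<cdot> F0) = h \<cdot> \<phi> \<cdot> P" using dF0 \<phi> P comp_assoc[of P \<phi> h] by simp
    hence "d' \<cdot> \<delta> = Zero C (Dom C \<delta>) (Cod C d')"
      unfolding \<delta>_def using h1(1-3) F d dF1 \<phi>(1-5) P(2-4) by (simp add: comp_sub)
    then obtain q l where q: "is_epi C q" "Cod C q = Dom C \<delta>" "l \<in> Arr C" "Dom C l = Dom C q"
      "Cod C l = Dom C e'" "e' \<cdot> l = \<delta> \<cdot> q"
      using exact_local_lift[OF ex(2) \<delta>(1,3)] by metis
    define Q where "Q = P \<cdot> q"
    have Q: "is_epi C Q" "Q \<in> Arr C" "Dom C Q = Dom C q" "Cod C Q = Dom C \<phi>"
      unfolding Q_def using epi_comp[of q P] q P \<delta> by auto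
    obtain n where n: "is_kernel C n Q" using ex_kernel Q by blast
    note N = kernelD[OF n]
    \<comment> \<open>On the kernel of the refined cover \<open>Q\<close> two things meet:
      \<open>v \<cdot> u\<close> goes into the kernel of \<open>p1\<close>, so the given lift
      applies to \<open>F1 \<cdot> u\<close>, and \<open>\<delta> \<cdot> u\<close> factors through
      \<open>e'\<close>.\<close>
    define u where "u = q \<cdot> n"
    have u: "u \<in> Arr C" "Dom C u = Dom C n" "Cod C u = Dom C r"
      unfolding u_def using q N Q \<delta> by auto
    have Pu: "P \<cdot> u = Zero C (Dom C n) (Dom C \<phi>)"
      using N Q q P \<delta> comp_assoc[of n q P] by (simp add: Q_def u_def)
    have "p1 \<cdot> (v \<cdot> u) = Zero C (Dom C n) (Dom C \<phi>)"
      using Pu u rv p1 comp_assoc[of u v p1] by (simp add: P_def)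
    then obtain s where s: "s \<in> Arr C" "Dom C s = Dom C n" "Cod C s = Dom C m" "m \<cdot> s = v \<cdot> u"
      using kernel_lift[OF p1(7), of "v \<cdot> u"] u rv p1 by auto
    have "lifts ds2' ((f1 \<cdot> m) \<cdot> s)"
      by (rule lifts_comp) (use p1 comp' M s e' ee in auto)
    moreover have "(f1 \<cdot> m) \<cdot> s = F1 \<cdot> u"
      unfolding F1_def using p1(1-5) M s rv(1-5) u comp_assoc[of s m f1] comp_assoc[of u v f1] by simp
    ultimately have "lifts ds2' (F1 \<cdot> u)" by simp
    hence "lifts ds2' (F1 \<cdot> u \<boxplus> e' \<cdot> (l \<cdot> n))"
      unfolding e' by (intro lifts_add) (use ee F u q N Q in auto)
    moreover have "e' \<cdot> (l \<cdot> n) = \<delta> \<cdot> u" unfolding u_def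
      by (rule comp_reassoc) (use q N Q \<delta> ee in auto)
    moreover have "h1 \<cdot> F0 = F1 \<boxplus> \<delta>"
      using sub_eq_iff[of "h1 \<cdot> F0" F1 \<delta>] h1(1-3) F \<delta> by (simp add: \<delta>_def)
    hence "h1 \<cdot> (F0 \<cdot> u) = F1 \<cdot> u \<boxplus> \<delta> \<cdot> u"
      using comp_assoc[of u F0 h1] h1(1-3) F \<delta> u by (simp add: add_comp)
    ultimately have L: "lifts ds2' (h1 \<cdot> (F0 \<cdot> u))" by simp
    have "d \<cdot> (F0 \<cdot> u) = \<phi> \<cdot> (P \<cdot> u)"
      using comp_assoc[of u F0 d] comp_assoc[of u P \<phi>] dF0 F P(2-4) u \<phi>(1,2) d by simp
    hence "d \<cdot> (F0 \<cdot> u) = Zero C (Dom C (F0 \<cdot> u)) (Cod C d)" using Pu \<phi> u F N by simp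
    \<comment> \<open>These provide the local lift that the induction hypothesis demands of
      \<open>F0 \<cdot> u\<close>; it exists because \<open>d\<close> kills
      \<open>F0 \<cdot> u\<close>.\<close>
    then obtain p2 f2 where p2: "is_epi C p2" "Cod C p2 = Dom C (F0 \<cdot> u)" "f2 \<in> Arr C"
      "Dom C f2 = Dom C p2" "Cod C f2 = Dom C e" "e \<cdot> f2 = (F0 \<cdot> u) \<cdot> p2"
      using exact_local_lift[OF ex(1), of "F0 \<cdot> u"] F u by auto
    have "lifts ds (F0 \<cdot> u)"
      by (rule Cons.IH[OF h1(5) len ex(3,4) L, of p2 f2])
        (use Cons e' F u ee h1 p2 in simp_all)
    moreover have "F0 \<cdot> u = (F0 \<cdot> q) \<cdot> n" unfolding u_def
      using F q N Q \<delta> comp_assoc[of n q F0] by simp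
    moreover have "d \<cdot> (F0 \<cdot> q) = \<phi> \<cdot> Q" unfolding Q_def
      by (rule comp_reassoc) (use dF0 F q P \<phi> d \<delta> in auto)
    ultimately show ?thesis unfolding Cons using Q n F q \<delta>
      by (intro lifts_ConsI[of Q _ "F0 \<cdot> q" _ n]) simp_all
  qed
qed

text \<open>
  With \<open>c = k \<cdot> g\<close> for an extension ending in \<open>k\<close>, this says that if the image under a connecting
  homomorphism is trivial, then the extension comes from one by \<open>Dom c\<close>.
\<close>

lemma lifts_extract:
  assumes "lifts (ds @ [c]) \<phi>" "ds \<noteq> []" "rev_exact (ds @ [c, z])" "\<phi> \<in> Arr C" "Cod C \<phi> = Cod C (hd ds)"
  obtains F k where "rev_exact (F @ [k])" "F \<noteq> []" "is_epi C (hd F)" "length F = length ds"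
    "Cod C (hd F) = Dom C \<phi>" "Dom C k = Dom C c" "chain_map (F @ [k]) (ds @ [c]) \<phi> (Ide C (Dom C c))"
  using assms
proof (induction ds arbitrary: \<phi> thesis)
  case Nil thus ?case by simp
next
  case (Cons d ds)
  have d: "d \<in> Arr C" "Cod C d = Cod C \<phi>" using Cons.prems rev_exact_Cons by auto
  obtain p f m where p: "is_epi C p" "Cod C p = Dom C \<phi>" "f \<in> Arr C" "Dom C f = Dom C p"
      "Cod C f = Dom C d" "d \<cdot> f = \<phi> \<cdot> p" "is_kernel C m p" "lifts (ds @ [c]) (f \<cdot> m)"
    using Cons.prems(2) by (cases ds) auto
  note M = kernelD[OF p(7)]
  have mp: "ses m p" using p ses_kernel by blast
  show ?case
  proof (cases ds)
    case Nil
    have c: "exact_at C c d" "c \<in> Arr C" "Cod C c = Dom C d"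
      using Cons.prems(4) Nil by auto
    obtain l where l: "l \<in> Arr C" "Dom C l = Dom C (f \<cdot> m)" "Cod C l = Dom C c" "c \<cdot> l = f \<cdot> m"
      using p Nil by auto
    \<comment> \<open>Pushing out the short exact sequence of \<open>p\<close> along
      \<open>l\<close> replaces its left term by \<open>Dom c\<close>. Since
      \<open>f \<cdot> m = c \<cdot> l\<close>, the arrows \<open>f\<close> and \<open>c\<close>
      glue to the vertical arrow \<open>w\<close>.\<close>
    obtain k e v where po: "ses k e" "Dom C k = Cod C l" "Cod C e = Cod C p"
      "v \<in> Arr C" "Dom C v = Dom C p" "Cod C v = Dom C e" "v \<cdot> m = k \<cdot> l" "e \<cdot> v = p"
      "\<exists>w\<in>Arr C. Dom C w = Dom C e \<and> Cod C w = Cod C f \<and> w \<cdot> v = f \<and> w \<cdot> k = c"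
      "\<And>s t. \<lbrakk>s \<in> Arr C; t \<in> Arr C; Dom C s = Dom C e; Dom C t = Dom C e; Cod C s = Cod C t;
        s \<cdot> v = t \<cdot> v; s \<cdot> k = t \<cdot> k\<rbrakk> \<Longrightarrow> s = t"
    proof (rule pushout[OF mp l(1)], goal_cases)
      case 1 thus ?case using l p M by simp
    next
      case (2 k e v)
      show ?case
        by (rule 2(1)[OF 2(2-9)]) (use 2(10)[of f c] 2(11) c l p M in auto)
    qed
    from po(9) obtain w where w: "w \<in> Arr C" "Dom C w = Dom C e" "Cod C w = Cod C f"
      "w \<cdot> v = f" "w \<cdot> k = c" by blast
    note S = sesD[OF po(1)]
    have "(d \<cdot> w) \<cdot> v = (\<phi> \<cdot> e) \<cdot> v"
      using w p(1-6) po d S Cons.prems(5) comp_assoc[of v w d] comp_assoc[of v e \<phi>] by simp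
    moreover have "(d \<cdot> w) \<cdot> k = (\<phi> \<cdot> e) \<cdot> k"
      using w p(1-6) po(2-6) d c(2) S Cons.prems(5) exact_comp_zero[OF c(1)] l(3)
        comp_assoc[of k w d] comp_assoc[of k e \<phi>] by simp
    ultimately have dw: "d \<cdot> w = \<phi> \<cdot> e"
      by (rule po(10)[rotated 5]) (use w p(1-5) po(2-6) d S Cons.prems(5) in simp_all)
    have "chain_map ([e] @ [k]) ([d] @ [c]) \<phi> (Ide C (Dom C c))"
      unfolding append_Cons append_Nil chain_map.simps
      by (rule exI[of _ w]) (use w(1-3,5) p(5) dw S po(2) l(3) c(2,3) in simp)
    moreover have "rev_exact ([e] @ [k])" using S ses_exact[OF po(1)] by simp
    ultimately show ?thesis
      using Cons.prems(1)[of "[e]" k] Nil S po(2,3) p(2) l(3) by simp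
  next
    case (Cons d2 ds2)
    have r: "rev_exact (ds @ [c, z])" "exact_at C d2 d" using Cons.prems(4) Cons by auto
    \<comment> \<open>The sequence obtained for \<open>f \<cdot> m\<close> ends in
      \<open>Dom m\<close>, so it can be spliced with \<open>m\<close> and \<open>p\<close>.\<close>
    obtain F k where F: "rev_exact (F @ [k])" "F \<noteq> []" "is_epi C (hd F)" "length F = length ds"
      "Cod C (hd F) = Dom C (f \<cdot> m)" "Dom C k = Dom C c"
      "chain_map (F @ [k]) (ds @ [c]) (f \<cdot> m) (Ide C (Dom C c))"
      by (rule Cons.IH[OF _ p(8) _ r(1)]) (use Cons r p M in auto)
    then obtain e F' where F': "F = e # F'" by (cases F) auto
    have e: "is_epi C e" "e \<in> Arr C" "Cod C e = Dom C m" using F F' p M by auto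
    from F(7) obtain h' where h': "h' \<in> Arr C" "Dom C h' = Dom C e" "Cod C h' = Dom C d2"
       "d2 \<cdot> h' = f \<cdot> m \<cdot> e" "chain_map (F' @ [k]) (ds2 @ [c]) h' (Ide C (Dom C c))"
      using F' Cons by auto
    have "chain_map (p # (m \<cdot> e) # F' @ [k]) (d # d2 # ds2 @ [c]) \<phi> (Ide C (Dom C c))"
      unfolding chain_map.simps
      by (rule exI[of _ f], intro conjI, use p in simp_all, rule exI[of _ h'])
        (use h' e M p comp_assoc[of e m f] in simp_all)
    moreover have "rev_exact (p # (m \<cdot> e) # F' @ [k])"
      using rev_exact_ConsI[OF _ mp e(3,1)] F(1) F' by simp
    ultimately show ?thesis
      using Cons.prems(1)[of "p # (m \<cdot> e) # F'" k] Cons p(1,2) F(4,6) F' by simp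
  qed
qed

subsection \<open>Yoneda extensions\<close>

lemma epi_of_exact_zero:
  assumes "exact_at C f (Zero C X W)" "W \<in> Obj C" "X = Cod C f"
  shows "is_epi C f"
proof -
  have "is_mono (op_cat C) f"
  proof (rule abelian_category.mono_of_exact_zero[OF op_abelian])
    show "exact_at (op_cat C) (Zero (op_cat C) W X) f"
      using op_exact_at[OF assms(1)] by (simp only: op_simps)
  qed (simp_all only: op_simps assms)
  thus ?thesis by (simp only: op_mono)
qed

lemma exact_epi_zero_iff:
  "f \<in> Arr C \<Longrightarrow> W \<in> Obj C \<Longrightarrow> exact_at C f (Zero C (Cod C f) W) \<longleftrightarrow> is_epi C f"
  using exact_epi_zero epi_of_exact_zero by blast

lemma rev_exact_arrs: "rev_exact R \<Longrightarrow> set R \<subseteq> Arr C"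
  by (induction R rule: rev_exact.induct) (auto dest: exact_arr)

lemma successively_exact_iff_rev_exact:
  assumes "set R \<subseteq> Arr C" "R \<noteq> []" "Z \<in> Obj C"
  shows "successively (\<lambda>d c. exact_at C c d) (R @ [Zero C Z (Dom C (last R))]) \<longleftrightarrow> rev_exact R"
  using assms
proof (induction R rule: rev_exact.induct)
  case (2 d)
  thus ?case using exact_zero_mono[of d Z] mono_of_exact_zero[of Z "Dom C d" d] by auto
qed auto

text \<open>Exactness next to the outer zero objects amounts to mono on the left and epi on the
  right, so the choice of zero object disappears.\<close>

lemma exact_from_zero_to_zero_iff:
  "exact_from_zero_to_zero C fs \<longleftrightarrow> rev_exact (rev fs) \<and> is_epi C (last fs)"
proof (cases "fs \<noteq> [] \<and> set fs \<subseteq> Arr C")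
  case True
  hence l: "last fs \<in> Arr C" "hd (rev fs) = last fs" "last (rev fs) = hd fs"
    by (auto simp: hd_rev last_rev)
  have "successively (exact_at C) (Zero C Z (Dom C (hd fs)) # fs @ [Zero C (Cod C (last fs)) Z]) \<longleftrightarrow>
      rev_exact (rev fs) \<and> is_epi C (last fs)" if Z: "is_zero_object C Z" for Z
  proof -
    have Z': "Z \<in> Obj C" using Z zero_object_obj by blast
    have "successively (exact_at C) (Zero C Z (Dom C (hd fs)) # fs @ [Zero C (Cod C (last fs)) Z]) \<longleftrightarrow>
      successively (\<lambda>d c. exact_at C c d) (rev (Zero C Z (Dom C (hd fs)) # fs @ [Zero C (Cod C (last fs)) Z]))"
      by (simp only: successively_rev)
    also have "\<dots> \<longleftrightarrow> exact_at C (last fs) (Zero C (Cod C (last fs)) Z) \<and>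
       successively (\<lambda>d c. exact_at C c d) (rev fs @ [Zero C Z (Dom C (last (rev fs)))])"
      using True l(2,3) successively_Cons[of _ _ "rev fs @ [_]"]
      by (simp only: rev.simps rev_append append_Nil append_Cons append_assoc hd_append
          rev_is_Nil_conv append_is_Nil_conv if_False simp_thms)
    also have "\<dots> \<longleftrightarrow> is_epi C (last fs) \<and> rev_exact (rev fs)"
      using successively_exact_iff_rev_exact[of "rev fs" Z] True Z'
      by (simp only: exact_epi_zero_iff[OF l(1) Z'] set_rev rev_is_Nil_conv simp_thms)
    finally show ?thesis by blast
  qed
  thus ?thesis using True ex_zero_object unfolding exact_from_zero_to_zero_def by blast
next
  case False
  thus ?thesis using rev_exact_arrs[of "rev fs"] by (auto simp: exact_from_zero_to_zero_def)
qed

lemma extensions_iff: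
  "fs \<in> extensions C i X Y \<longleftrightarrow> length fs = i + 1 \<and> rev_exact (rev fs) \<and> is_epi C (last fs) \<and>
     Dom C (hd fs) = Y \<and> Cod C (last fs) = X"
  by (auto simp: extensions_def exact_from_zero_to_zero_iff)

lemma extensions_rev:
  assumes "rev_exact (R @ [k])" "length R = i" "R \<noteq> []" "is_epi C (hd R)" "Dom C k = Y" "Cod C (hd R) = X"
  shows "k # rev R \<in> extensions C i X Y"
  using assms by (simp add: extensions_iff last_rev)

lemma extensionsE:
  assumes "fs \<in> extensions C i X Y" "i \<ge> 1"
  obtains R k where "fs = k # rev R" "R = rev (tl fs)" "rev_exact (R @ [k])" "length R = i" "R \<noteq> []" "is_epi C (hd R)"
    "Dom C k = Y" "Cod C (hd R) = X" "is_mono C k"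
proof -
  obtain k gs where fs: "fs = k # gs" using assms by (cases fs) (auto simp: extensions_iff)
  have "gs \<noteq> []" using assms fs by (auto simp: extensions_iff)
  hence gs: "gs \<noteq> []" "length gs = i" "rev_exact (rev gs @ [k])" "is_epi C (last gs)" "Dom C k = Y" "Cod C (last gs) = X"
    using assms fs by (auto simp: extensions_iff)
  show ?thesis
    by (rule that[of k "rev gs"]) (use fs gs rev_exact_last[OF gs(3)] in \<open>simp_all add: hd_rev\<close>)
qed

section \<open>Morphisms of extensions as chain maps\<close>

lemma chain_map_iff:
  assumes "length ds = length ds'"
  shows "chain_map ds ds' h g \<longleftrightarrow> (\<exists>H. H 0 = h \<and> H (length ds) = g \<and>
    (\<forall>j<length ds. H (Suc j) \<in> Hom C (Dom C (ds ! j)) (Dom C (ds' ! j)) \<and>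
       ds' ! j \<cdot> H (Suc j) = H j \<cdot> (ds ! j)))"
  using assms
proof (induction ds ds' arbitrary: h rule: list_induct2)
  case Nil thus ?case by auto
next
  case (Cons d ds d' ds')
  show ?case
  proof
    assume "chain_map (d # ds) (d' # ds') h g"
    then obtain h' where h': "h' \<in> Hom C (Dom C d) (Dom C d')" "d' \<cdot> h' = h \<cdot> d" "chain_map ds ds' h' g"
      by (auto simp: Hom_iff)
    from h'(3) obtain H where H: "H 0 = h'" "H (length ds) = g"
      "\<forall>j<length ds. H (Suc j) \<in> Hom C (Dom C (ds ! j)) (Dom C (ds' ! j)) \<and>
         ds' ! j \<cdot> H (Suc j) = H j \<cdot> (ds ! j)"
      unfolding Cons.IH by blast
    show "\<exists>H. H 0 = h \<and> H (length (d # ds)) = g \<and>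
      (\<forall>j<length (d # ds). H (Suc j) \<in> Hom C (Dom C ((d # ds) ! j)) (Dom C ((d' # ds') ! j)) \<and>
       (d' # ds') ! j \<cdot> H (Suc j) = H j \<cdot> ((d # ds) ! j))"
      by (rule exI[of _ "\<lambda>j. case j of 0 \<Rightarrow> h | Suc j' \<Rightarrow> H j'"])
        (use H h' in \<open>auto simp: less_Suc_eq_0_disj\<close>)
  next
    assume "\<exists>H. H 0 = h \<and> H (length (d # ds)) = g \<and>
      (\<forall>j<length (d # ds). H (Suc j) \<in> Hom C (Dom C ((d # ds) ! j)) (Dom C ((d' # ds') ! j)) \<and>
       (d' # ds') ! j \<cdot> H (Suc j) = H j \<cdot> ((d # ds) ! j))"
    then obtain H where H: "H 0 = h" "H (Suc (length ds)) = g"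
      "\<forall>j<Suc (length ds). H (Suc j) \<in> Hom C (Dom C ((d # ds) ! j)) (Dom C ((d' # ds') ! j)) \<and>
       (d' # ds') ! j \<cdot> H (Suc j) = H j \<cdot> ((d # ds) ! j)" by auto
    have "chain_map ds ds' (H 1) g"
      unfolding Cons.IH by (rule exI[of _ "\<lambda>j. H (Suc j)"]) (use H in force)
    thus "chain_map (d # ds) (d' # ds') h g"
      using H(1) H(3)[rule_format, of 0] by (auto simp: Hom_iff)
  qed
qed

lemma rev_exact_nth: "rev_exact R \<Longrightarrow> Suc j < length R \<Longrightarrow> exact_at C (R ! Suc j) (R ! j)"
proof (induction R arbitrary: j rule: rev_exact.induct)
  case (3 d d' ds) thus ?case by (cases j) auto
qed auto

lemma rev_exactI_nth:
  assumes "R \<noteq> []" "is_mono C (last R)" "\<And>j. Suc j < length R \<Longrightarrow> exact_at C (R ! Suc j) (R ! j)"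
  shows "rev_exact R"
  using assms
proof (induction R rule: rev_exact.induct)
  case (3 d d' ds)
  have "rev_exact (d' # ds)" by (rule 3(1)) (use 3(3) 3(4)[of "Suc _"] in auto)
  thus ?case using 3(4)[of 0] by simp
qed auto

text \<open>The two notions index the vertical arrows from opposite ends;
  \<open>j \<mapsto> i + 1 - j\<close> translates between them.\<close>

lemma ext_morphism_iff:
  "ext_morphism C i X Y fs gs \<longleftrightarrow> fs \<in> extensions C i X Y \<and> gs \<in> extensions C i X Y \<and>
     chain_map (rev fs) (rev gs) (Ide C X) (Ide C Y)"
proof (cases "fs \<in> extensions C i X Y \<and> gs \<in> extensions C i X Y")
  case True
  hence E: "length fs = i + 1" "length gs = i + 1" "rev_exact (rev fs)" "rev_exact (rev gs)"
    "Cod C (last fs) = X" "Cod C (last gs) = X" "is_epi C (last fs)"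
    by (auto simp: extensions_iff)
  have X: "X \<in> Obj C" using E epi_arr by auto
  have nth: "rev fs ! j = fs ! (i - j)" "rev gs ! j = gs ! (i - j)" if "j \<le> i" for j
    using E that by (auto simp: rev_nth)
  have cod: "Cod C (fs ! j) = Dom C (fs ! Suc j)" "Cod C (gs ! j) = Dom C (gs ! Suc j)" if "j < i" for j
    using that E rev_exact_nth[of "rev fs" "i - Suc j"] rev_exact_nth[of "rev gs" "i - Suc j"]
    by (auto simp: nth Suc_diff_Suc dest: exact_arr)
  have codi: "Cod C (fs ! i) = X" "Cod C (gs ! i) = X"
    using E by (cases fs rule: rev_cases; cases gs rule: rev_cases; simp add: nth_append)+
  let ?P = "\<lambda>h. h 0 = Ide C Y \<and> h (i + 1) = Ide C X \<and>
       (\<forall>j \<le> i. h j \<in> Hom C (Dom C (fs ! j)) (Dom C (gs ! j)) \<and>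
                h (j + 1) \<in> Hom C (Cod C (fs ! j)) (Cod C (gs ! j)) \<and>
                (gs ! j) \<cdot> h j = h (j + 1) \<cdot> (fs ! j))"
  let ?Q = "\<lambda>H. H 0 = Ide C X \<and> H (i + 1) = Ide C Y \<and>
    (\<forall>j\<le>i. H (Suc j) \<in> Hom C (Dom C (fs ! (i - j))) (Dom C (gs ! (i - j))) \<and>
       gs ! (i - j) \<cdot> H (Suc j) = H j \<cdot> (fs ! (i - j)))"
  have PQ: "?Q (\<lambda>j. h (i + 1 - j))" if h: "?P h" for h
  proof -
    have "h (i - j) \<in> Hom C (Dom C (fs ! (i - j))) (Dom C (gs ! (i - j))) \<and>
       gs ! (i - j) \<cdot> h (i - j) = h (i + 1 - j) \<cdot> (fs ! (i - j))" if "j \<le> i" for j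
    proof -
      have "i - j \<le> i" "i - j + 1 = i + 1 - j" using that by auto
      thus ?thesis using h by (metis (no_types, lifting))
    qed
    thus ?thesis using h by auto
  qed
  have QP: "?P (\<lambda>j. H (i + 1 - j))" if H: "?Q H" for H
  proof -
    have A: "H (i + 1 - j) \<in> Hom C (Dom C (fs ! j)) (Dom C (gs ! j)) \<and>
       gs ! j \<cdot> H (i + 1 - j) = H (i + 1 - (j + 1)) \<cdot> (fs ! j)" if "j \<le> i" for j
    proof -
      have "i - j \<le> i" "i - (i - j) = j" "Suc (i - j) = i + 1 - j" "i + 1 - (j + 1) = i - j" using that by auto
      thus ?thesis using H by (metis (no_types, lifting))
    qed
    \<comment> \<open>\<open>ext_morphism\<close> also types each vertical arrow at codomains.
      Inside the sequence a codomain is the next domain; at \<open>j = i\<close> the arrow is the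
      identity of \<open>X\<close>.\<close>
    have "H (i + 1 - (j + 1)) \<in> Hom C (Cod C (fs ! j)) (Cod C (gs ! j))" if "j \<le> i" for j
    proof (cases "j = i")
      case True
      thus ?thesis using H codi Ide_in_Hom[OF X] by simp
    next
      case False
      thus ?thesis using A[of "j + 1"] cod[of j] that by simp
    qed
    thus ?thesis using A H by simp
  qed
  have "(\<exists>h. ?P h) \<longleftrightarrow> (\<exists>H. ?Q H)"
    by (rule iffI; erule exE; rule exI) (erule PQ QP)+
  moreover have "chain_map (rev fs) (rev gs) (Ide C X) (Ide C Y) \<longleftrightarrow> (\<exists>H. ?Q H)"
    using E by (subst chain_map_iff) (auto simp: nth less_Suc_eq_le)
  ultimately show ?thesis using True unfolding ext_morphism_def by simp
qed (auto simp: ext_morphism_def)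

text \<open>The arrow removed by \<open>tl\<close> is the embedding of \<open>Y\<close>, and
  \<open>rev\<close> gives the reading order of \<open>lifts\<close>. For \<open>i = 1\<close> the
  condition says that the epimorphism onto \<open>X\<close> has a section.\<close>

definition null_extension :: "'m list \<Rightarrow> bool" where
  "null_extension fs \<longleftrightarrow> lifts (rev (tl fs)) (Ide C (Cod C (last fs)))"

lemma null_extension_rev: "R \<noteq> [] \<Longrightarrow> null_extension (k # rev R) \<longleftrightarrow> lifts R (Ide C (Cod C (hd R)))"
  by (simp add: null_extension_def last_rev)

lemma null_extension_cong_morphism:
  assumes "ext_morphism C i X Y fs gs" "i \<ge> 1"
  shows "null_extension fs \<longleftrightarrow> null_extension gs"
proof -
  have E: "fs \<in> extensions C i X Y" "gs \<in> extensions C i X Y" "chain_map (rev fs) (rev gs) (Ide C X) (Ide C Y)"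
    using assms(1) ext_morphism_iff by auto
  from E(1) assms(2) obtain R k where R: "fs = k # rev R" "rev_exact (R @ [k])" "length R = i" "R \<noteq> []"
    "is_epi C (hd R)" "Dom C k = Y" "Cod C (hd R) = X" by (metis extensionsE)
  from E(2) assms(2) obtain R' k' where R': "gs = k' # rev R'" "rev_exact (R' @ [k'])" "length R' = i" "R' \<noteq> []"
    "is_epi C (hd R')" "Dom C k' = Y" "Cod C (hd R') = X" by (metis extensionsE)
  have X: "X \<in> Obj C" using R(5,7) epi_arr by auto
  have cm: "chain_map (R @ [k]) (R' @ [k']) (Ide C X) (Ide C Y)" using E(3) R R' by simp
  then obtain h' where h': "chain_map R R' (Ide C X) h'" using chain_map_append[of R R'] R(3) R'(3) by auto
  have co: "composable R" "composable R'"
    using R(2) R'(2) rev_exact_composable composable_appendD by blast+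
  show ?thesis
  proof
    assume "null_extension fs"
    hence "lifts R (Ide C X)" using R null_extension_rev by simp
    hence "lifts R' (Ide C X \<cdot> Ide C X)"
      using lifts_chain_map[OF h' _ co, of "Ide C X"] X R R' by simp
    thus "null_extension gs" using R' null_extension_rev X by simp
  next
    assume "null_extension gs"
    hence "lifts R' (Ide C X \<cdot> Ide C X)" using R' null_extension_rev X by simp
    \<comment> \<open>The factorization hypothesis is met by \<open>hd R\<close> itself: it covers
      \<open>X\<close>, with the identity of its domain as local lift.\<close>
    hence "lifts R (Ide C X)"
      using lifts_chain_map_back[of R k R' k' "Ide C X" "Ide C X" "hd R" "Ide C (Dom C (hd R))"]
        cm X R R' by simp
    thus "null_extension fs" using R null_extension_rev by simp
  qed
qed

lemma null_extension_cong:
  assumes "equivclp (ext_morphism C i X Y) fs gs" "i \<ge> 1"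
  shows "null_extension fs \<longleftrightarrow> null_extension gs"
  using assms(1) by (induction rule: equivclp_induct) (use null_extension_cong_morphism assms(2) in blast)+

section \<open>The criterion characterizes the class of the trivial extension\<close>

lemma chain_map_end:
  "chain_map F ds h g \<Longrightarrow> F \<noteq> [] \<Longrightarrow> g \<in> Arr C \<and> Dom C g = Dom C (last F) \<and> Cod C g = Dom C (last ds)"
proof (induction F arbitrary: ds h)
  case (Cons d F)
  then obtain d' ds' h' where ds: "ds = d' # ds'" "h' \<in> Arr C" "Dom C h' = Dom C d" "Cod C h' = Dom C d'"
    "chain_map F ds' h' g"
    by (cases ds) auto
  show ?case
  proof (cases "F = []")
    case True
    hence "ds' = []" "g = h'" using ds(5) by (cases ds'; simp)+
    thus ?thesis using True ds by simp
  next
    case False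
    hence "ds' \<noteq> []" using ds(5) by (cases F) auto
    thus ?thesis using Cons.IH[OF ds(5) False] False ds(1) by simp
  qed
qed simp

text \<open>A function \<open>os\<close> replaces the list of objects, so that later case
  distinctions concern indices only. The values at \<open>1\<close> and \<open>i\<close> are listed
  separately because for \<open>i = 2\<close> no zero object occurs among the terms.\<close>

lemma trivial_extension_two:
  assumes "trivial_extension C i X Y T" "i \<ge> 2" "X \<in> Obj C" "Y \<in> Obj C"
  obtains Z os where "is_zero_object C Z" "length T = i + 1" "T ! 0 = Ide C Y" "T ! i = Ide C X"
    "\<forall>j. 0 < j \<longrightarrow> j < i \<longrightarrow> T ! j = Zero C (os j) (os (Suc j))"
    "os 0 = Y" "os 1 = Y" "os i = X" "\<forall>j. 1 < j \<longrightarrow> j < i \<longrightarrow> os j = Z" "\<forall>j \<le> i. os j \<in> Obj C"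
proof -
  from assms(1,2) obtain Z where Z: "is_zero_object C Z"
    and T: "T = (let os = [Y, Y] @ replicate (i - 2) Z @ [X, X] in
         map (\<lambda>j. if j = 0 then Ide C Y else if j = i then Ide C X
                       else Zero C (os ! j) (os ! (j + 1))) [0..<i + 1])"
    by (auto simp: trivial_extension_def Let_def)
  let ?os = "[Y, Y] @ replicate (i - 2) Z @ [X, X]"
  have l: "length T = i + 1" using T by (simp add: Let_def)
  have Tn: "T ! j = (if j = 0 then Ide C Y else if j = i then Ide C X
                       else Zero C (?os ! j) (?os ! (j + 1)))" if "j \<le> i" for j
  proof -
    have "[0..<i + 1] ! j = j" "j < length [0..<i + 1]" using that by (auto simp del: upt_Suc)
    thus ?thesis unfolding T Let_def by (simp del: upt_Suc)
  qed
  have os: "?os ! j = (if j \<le> 1 then Y else if j < i then Z else X)" if "j \<le> i" for j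
  proof -
    consider "j = 0" | "j = 1" | "2 \<le> j" by linarith
    thus ?thesis
    proof cases
      case 3
      then obtain j' where "j = Suc (Suc j')" by (metis add_2_eq_Suc le_Suc_ex)
      with that assms(2) show ?thesis
        by (cases "j' < i - 2") (auto simp: nth_append)
    qed auto
  qed
  show ?thesis
    by (rule that[OF Z l, of "\<lambda>j. ?os ! j"])
      (use assms Tn os zero_object_obj[OF Z] in \<open>simp_all del: append.simps\<close>)
qed

lemma trivial_extension_ex:
  assumes "i \<ge> 1" "X \<in> Obj C" "Y \<in> Obj C"
  shows "\<exists>T. trivial_extension C i X Y T"
  using ex_biproduct[OF assms(3,2)] ex_zero_object unfolding trivial_extension_def Let_def
  by (cases "i = 1") auto

lemma trivial_extension_null_extension:
  assumes "trivial_extension C i X Y T" "i \<ge> 1" "X \<in> Obj C" "Y \<in> Obj C"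
  shows "T \<in> extensions C i X Y" "null_extension T"
proof -
  have "T \<in> extensions C i X Y \<and> null_extension T"
  proof (cases "i = 1")
    case True
    then obtain P s t p q where bp: "is_biproduct C P Y X s t p q" and T: "T = [s, q]"
      using assms(1) by (auto simp: trivial_extension_def)
    note B = biproductD[OF bp] and S = sesD[OF biproduct_ses[OF bp]]
    have "lifts [q] (Ide C X)" using B by auto
    moreover have "rev_exact [q, s]" using S ses_exact[OF biproduct_ses[OF bp]] by simp
    ultimately show ?thesis using B S T True by (simp add: extensions_iff null_extension_def)
  next
    case False
    hence i: "i \<ge> 2" using assms by simp
    obtain Z os where T: "is_zero_object C Z" "length T = i + 1" "T ! 0 = Ide C Y" "T ! i = Ide C X"
      "\<forall>j. 0 < j \<longrightarrow> j < i \<longrightarrow> T ! j = Zero C (os j) (os (Suc j))"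
      "os 0 = Y" "os 1 = Y" "os i = X" "\<forall>j. 1 < j \<longrightarrow> j < i \<longrightarrow> os j = Z" "\<forall>j \<le> i. os j \<in> Obj C"
      by (rule trivial_extension_two[OF assms(1) i assms(3,4)])
    have Z: "Z \<in> Obj C" using T(1) zero_object_obj by blast
    have ex: "exact_at C (T ! j) (T ! Suc j)" if j: "j < i" for j
    proof -
      consider "j = 0" | "0 < j" "Suc j = i" | "0 < j" "Suc j < i" using j by linarith
      thus ?thesis
      proof cases
        case 1
        \<comment> \<open>For \<open>i = 2\<close> the object \<open>os 2\<close> is
          \<open>X\<close>, otherwise it is \<open>Z\<close>; exactness after an identity holds in
          either case.\<close>
        have "T ! 1 = Zero C Y (os 2)" using T(5)[rule_format, of 1] T(7) i by (simp add: numeral_2_eq_2)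
        thus ?thesis using 1 T(3) T(10)[rule_format, of 2] i assms(4) exact_epi_zero[of "Ide C Y" "os 2" Y] ide_epi
          by simp
      next
        case 2
        have "T ! j = Zero C (os j) X" using T(5)[rule_format, of j] T(8) 2 by simp
        thus ?thesis using 2 T(4) T(10)[rule_format, of j] assms(3) exact_zero_mono[of "Ide C X" "os j" X] ide_mono
          by simp
      next
        case 3
        have t: "T ! j = Zero C (os j) Z" "T ! Suc j = Zero C Z (os (Suc (Suc j)))"
          using T(5)[rule_format, of j] T(5)[rule_format, of "Suc j"] T(9)[rule_format, of "Suc j"] 3 by auto
        have "is_epi C (Zero C (os j) Z)"
          using zero_object_arr(1)[OF T(1)] Z T(10)[rule_format, of j] 3 by (intro epiI) auto
        thus ?thesis using t exact_epi_zero[of "Zero C (os j) Z" "os (Suc (Suc j))" Z] T(10) Z 3 by simp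
      qed
    qed
    have ne: "T \<noteq> []" using T(2) by auto
    have hl: "hd T = Ide C Y" "last T = Ide C X"
      using T(2,3,4) ne by (simp_all add: hd_conv_nth last_conv_nth)
    have "rev_exact (rev T)"
    proof (rule rev_exactI_nth)
      show "is_mono C (last (rev T))" using hl ide_mono assms by (simp add: last_rev)
      fix j assume "Suc j < length (rev T)"
      hence j: "Suc j \<le> i" using T(2) by simp
      hence "rev T ! Suc j = T ! (i - Suc j)" "rev T ! j = T ! Suc (i - Suc j)"
        using T(2) by (auto simp: rev_nth Suc_diff_Suc)
      thus "exact_at C (rev T ! Suc j) (rev T ! j)" using ex[of "i - Suc j"] j i by simp
    qed (use ne in auto)
    hence E: "T \<in> extensions C i X Y"
      using T(2) hl assms ide_epi by (simp add: extensions_iff)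
    obtain R k where R: "T = k # rev R" "rev_exact (R @ [k])" "R \<noteq> []" "Cod C (hd R) = X"
      using extensionsE[OF E assms(2)] by metis
    have "hd R = Ide C X" using hl(2) R(1,3) by (simp add: last_rev)
    then obtain R' where R': "R = Ide C X # R'" using R(3) by (cases R) auto
    \<comment> \<open>The rightmost arrow is \<open>Ide C X\<close>, so the arrow to be lifted
      factors through it globally. The product is written out to match the form
      \<open>d \<cdot> l\<close> of \<open>lifts_factor\<close>.\<close>
    have "lifts R (Ide C X \<cdot> Ide C X)"
      unfolding R' using rev_exact_composable[OF R(2)] composable_appendD[of R "[k]"] R' assms
      by (intro lifts_factor) auto
    thus ?thesis using E R null_extension_rev assms by simp
  qed
  thus "T \<in> extensions C i X Y" "null_extension T" by auto
qed

text \<open>For \<open>i = 1\<close> a section of the epimorphism gives a morphism from the split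
  extension. For \<open>i \<ge> 2\<close> a third extension \<open>G\<close> is built that has
  morphisms to both \<open>E\<close> and \<open>T\<close>.\<close>

lemma null_extension_imp_equiv_trivial:
  assumes "E \<in> extensions C i X Y" "null_extension E" "i \<ge> 1" "trivial_extension C i X Y T"
  shows "equivclp (ext_morphism C i X Y) T E"
proof -
  obtain R k where R: "E = k # rev R" "rev_exact (R @ [k])" "length R = i" "R \<noteq> []" "is_epi C (hd R)"
    "Dom C k = Y" "Cod C (hd R) = X" "is_mono C k"
    using extensionsE[OF assms(1,3)] by metis
  have XY: "X \<in> Obj C" "Y \<in> Obj C" using R epi_arr[OF R(5)] mono_arr[OF R(8)] by auto
  have k: "k \<in> Arr C" using R by simp
  note TE = trivial_extension_null_extension[OF assms(4,3) XY]
  have L: "lifts R (Ide C X)" using assms(2) R null_extension_rev by simp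
  show ?thesis
  proof (cases "i = 1")
    case True
    then obtain P s t p q where bp: "is_biproduct C P Y X s t p q" and T: "T = [s, q]"
      using assms(4) by (auto simp: trivial_extension_def)
    note B = biproductD[OF bp]
    obtain d where d: "R = [d]" using R(3) True by (cases R) auto
    have ex: "exact_at C k d" using R(2) d by simp
    obtain l where l: "l \<in> Arr C" "Dom C l = X" "Cod C l = Dom C d" "d \<cdot> l = Ide C X"
      using L d XY by auto
    obtain w where w: "w \<in> Arr C" "Dom C w = P" "Cod C w = Cod C l" "w \<cdot> s = k" "w \<cdot> t = l"
      using biproduct_copair[OF bp, of k l] k l R ex by auto
    have dd: "d \<in> Arr C" "Cod C d = X" using ex d R by auto
    have "d \<cdot> w = Ide C X \<cdot> q"
    proof (rule biproduct_joint_epi[OF bp])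
      show "(d \<cdot> w) \<cdot> s = (Ide C X \<cdot> q) \<cdot> s"
        using comp_assoc[of s w d] B(1-19) w l dd exact_comp_zero[OF ex] R(6) by simp
      show "(d \<cdot> w) \<cdot> t = (Ide C X \<cdot> q) \<cdot> t"
        using comp_assoc[of t w d] B(1-19) w l dd R(6) by simp
    qed (use B(1-19) w l dd in auto)
    hence "chain_map [q, s] [d, k] (Ide C X) (Ide C Y)"
      unfolding chain_map.simps
      by (intro exI[of _ w]) (use w B(1-19) l k R(6) in simp)
    hence "ext_morphism C i X Y T E"
      using TE(1) assms(1) T R(1) d by (simp add: ext_morphism_iff)
    thus ?thesis by (rule r_into_equivclp)
  next
    case False
    hence i: "i \<ge> 2" using assms by simp
    obtain ds c where ds: "R = ds @ [c]" using R(4) by (cases R rule: rev_cases) auto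
    have ne: "ds \<noteq> []" using ds R(3) i by auto
    have rd: "rev_exact (ds @ [c, k])" "Cod C (hd ds) = X" using R ds ne by simp_all
    obtain F k' where F: "rev_exact (F @ [k'])" "F \<noteq> []" "is_epi C (hd F)" "length F = length ds"
      "Cod C (hd F) = Dom C (Ide C X)" "Dom C k' = Dom C c"
      "chain_map (F @ [k']) (ds @ [c]) (Ide C X) (Ide C (Dom C c))"
      by (rule lifts_extract[OF L[unfolded ds] ne rd(1)]) (use XY rd in simp_all)
    have FX: "Cod C (hd F) = X" using F(5) XY by simp
    have ex: "exact_at C k c" using rd(1) rev_exact_nth[of "ds @ [c, k]" "length ds"] by (simp add: nth_append)
    have c: "c \<in> Arr C" "Cod C k = Dom C c" using ex by auto
    have mk: "is_mono C k'" using rev_exact_last[OF F(1)] by simp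
    have k': "k' \<in> Arr C" using mk by simp
    obtain P s t p q where bp: "is_biproduct C P Y (Dom C c) s t p q"
      using ex_biproduct[OF XY(2)] c by (metis Arr_objs(1))
    note B = biproductD[OF bp] and S = biproduct_ses[OF bp]
    \<comment> \<open>The left term \<open>Dom c\<close> of the exact sequence
      \<open>F @ [k']\<close> is enlarged to \<open>Y \<oplus> Dom c\<close>; its kernel over the
      old sequence is \<open>Y\<close>, so \<open>G\<close> is one arrow longer and is an extension
      of \<open>X\<close> by \<open>Y\<close>.\<close>
    define G where "G = F @ [k' \<cdot> q, s]"
    have rG: "rev_exact G" unfolding G_def
      by (rule rev_exact_snoc_ses[OF F(1,2) S _ mk]) (use B F in auto)
    obtain h' where h': "chain_map F ds (Ide C X) h'" "chain_map [k'] [c] h' (Ide C (Dom C c))"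
      using F(7) chain_map_append[OF F(4)] by blast
    hence ch: "h' \<cdot> k' = c" using c by auto
    have "Cod C k' = Dom C (last F)"
      using F(1,2) rev_exact_nth[of "F @ [k']" "length F - 1"] by (auto simp: nth_append last_conv_nth)
    hence hk: "h' \<in> Arr C" "Dom C h' = Cod C k'" using chain_map_end[OF h'(1) F(2)] by auto
    have ch': "Cod C h' = Cod C c" using ch hk k' comp_simps(3)[of k' h'] by metis
    \<comment> \<open>The leftmost nontrivial component of the morphism from \<open>G\<close> to
      \<open>E\<close>: the embedding \<open>k\<close> on \<open>Y\<close> and the identity on
      \<open>Dom c\<close>.\<close>
    obtain w where w: "w \<in> Arr C" "Dom C w = P" "Cod C w = Dom C c" "w \<cdot> s = k" "w \<cdot> t = Ide C (Dom C c)"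
      using biproduct_copair[OF bp, of k "Ide C (Dom C c)"] k c R by auto
    have "c \<cdot> w = h' \<cdot> (k' \<cdot> q)"
    proof (rule biproduct_joint_epi[OF bp])
      show "(c \<cdot> w) \<cdot> s = (h' \<cdot> (k' \<cdot> q)) \<cdot> s"
        using comp_assoc[of s w c] comp_assoc[of s "k' \<cdot> q" h'] comp_assoc[of s q k']
          B(1-19) w k k' c hk F(6) exact_comp_zero[OF ex] R(6) ch' by simp
      show "(c \<cdot> w) \<cdot> t = (h' \<cdot> (k' \<cdot> q)) \<cdot> t"
        using comp_assoc[of t w c] comp_assoc[of t "k' \<cdot> q" h'] comp_assoc[of t q k']
          B(1-19) w k k' c hk F(6) ch by simp
    qed (use B(1-19) w k' c hk F(6) ch' in auto)
    hence "chain_map [k' \<cdot> q, s] [c, k] h' (Ide C Y)"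
      unfolding chain_map.simps
      by (intro exI[of _ w]) (use w B(1-19) k k' R(6) F(6) in simp)
    hence "chain_map G (ds @ [c, k]) (Ide C X) (Ide C Y)"
      unfolding G_def chain_map_append[OF F(4)] using h'(1) by blast
    moreover have lG: "length G = i + 1" using F(4) R(3) ds by (simp add: G_def)
    moreover have hG: "hd G = hd F" using F(2) by (simp add: G_def)
    have GE: "rev G \<in> extensions C i X Y"
      using rG lG F FX hG B by (simp add: extensions_iff last_rev G_def hd_rev)
    ultimately have "ext_morphism C i X Y (rev G) E"
      using assms(1) R(1) ds by (simp add: ext_morphism_iff)
    moreover have "chain_map G (rev T) (Ide C X) (Ide C Y)"
    proof -
      obtain Z os where T: "is_zero_object C Z" "length T = i + 1" "T ! 0 = Ide C Y" "T ! i = Ide C X"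
        "\<forall>j. 0 < j \<longrightarrow> j < i \<longrightarrow> T ! j = Zero C (os j) (os (Suc j))"
        "os 0 = Y" "os 1 = Y" "os i = X" "\<forall>j. 1 < j \<longrightarrow> j < i \<longrightarrow> os j = Z" "\<forall>j \<le> i. os j \<in> Obj C"
        by (rule trivial_extension_two[OF assms(4) i XY])
      have iF: "i = Suc (length F)" using lG by (simp add: G_def)
      have G: "G ! 0 = hd G" "G ! (i - 1) = k' \<cdot> q" "G ! i = s"
        using F(2) iF by (simp_all add: G_def hd_conv_nth nth_append)
      have GA: "G ! j \<in> Arr C" if "j \<le> i" for j
        using rev_exact_arrs[OF rG] lG that by (auto simp: subset_iff)
      have GC: "Cod C (G ! Suc j) = Dom C (G ! j)" "G ! j \<cdot> G ! Suc j = Zero C (Dom C (G ! Suc j)) (Cod C (G ! j))"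
        if "j < i" for j
        using rev_exact_nth[OF rG, of j] lG that exact_comp_zero[of "G ! Suc j" "G ! j"] by auto
      have G0: "Cod C (G ! 0) = X" using G(1) hG FX by simp
      have GD: "Dom C (G ! (i - 1)) = P" "Dom C (G ! i) = Y" using G B k' F(6) by auto
      \<comment> \<open>The morphism from \<open>G\<close> to \<open>T\<close>, counted from the
        right: the epimorphism \<open>hd G\<close> onto \<open>X\<close>, zero in the middle, and
        the projection \<open>p\<close> onto \<open>Y\<close> at the left. For \<open>j > 0\<close>,
        \<open>H j\<close> starts at the domain of \<open>G ! (j - 1)\<close>, whose counterpart in
        \<open>T\<close> is \<open>os (i - (j - 1))\<close>.\<close>
      define H where "H = (\<lambda>j. if j = 0 then Ide C X else if j = 1 then hd G
        else if j < i then Zero C (Dom C (G ! (j - 1))) (os (i - (j - 1)))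
        else if j = i then p else Ide C Y)"
      have DT: "Dom C (T ! j) = os j" if "j \<le> i" for j
      proof -
        consider "j = 0" | "0 < j" "j < i" | "j = i" using \<open>j \<le> i\<close> by linarith
        thus ?thesis using T(3-8) T(10)[rule_format, of j] T(10)[rule_format, of "Suc j"] XY by cases auto
      qed
      have Hz: "H j \<cdot> G ! j = Zero C (Dom C (G ! j)) (os (Suc (i - j)))" if "0 < j" "j < i" for j
      proof (cases "j = 1")
        case True
        have "os (Suc (i - j)) = X" using T(8) True that by simp
        thus ?thesis using True GC(2)[of 0] G(1) G0 that by (simp add: H_def)
      next
        case False
        have "H j = Zero C (Dom C (G ! (j - 1))) (os (Suc (i - j)))"
          using False that by (simp add: H_def Suc_diff_le)
        thus ?thesis using GC(1)[of "j - 1"] GA[of j] T(10)[rule_format, of "Suc (i - j)"] that False by simp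
      qed
      have HT: "H (Suc j) \<in> Hom C (Dom C (G ! j)) (os (i - j)) \<and> T ! (i - j) \<cdot> H (Suc j) = H j \<cdot> (G ! j)"
        if "j \<le> i" for j
      proof -
        consider "j = 0" | "0 < j" "Suc j < i" | "0 < j" "Suc j = i" | "j = i" using \<open>j \<le> i\<close> by linarith
        thus ?thesis
        proof cases
          case 1
          thus ?thesis using G(1) G0 GA[of 0] T(4,8) XY by (simp add: H_def Hom_iff)
        next
          case 2
          have "H (Suc j) = Zero C (Dom C (G ! j)) (os (i - j))" using 2 by (simp add: H_def)
          thus ?thesis using 2 Hz[of j] T(5)[rule_format, of "i - j"] T(10)[rule_format, of "i - j"] T(10)[rule_format, of "Suc (i - j)"] GA[of j]
            by (simp add: Hom_iff)
        next
          case 3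
          have "H (Suc j) = p" "i - j = 1" using 3 by (auto simp: H_def)
          moreover have "Dom C (G ! j) = P" using 3 GD(1) by auto
          ultimately show ?thesis using 3 Hz[of j] T(5)[rule_format, of 1] T(7) T(10)[rule_format, of "Suc 1"] B(1-15) XY
            by (simp add: Hom_iff)
        next
          case 4
          have "H (Suc j) = Ide C Y" "H j = p" using 4 i by (auto simp: H_def)
          thus ?thesis using 4 T(3,6) GD(2) G(3) B XY by (simp add: Hom_iff)
        qed
      qed
      have "chain_map G (rev T) (Ide C X) (Ide C Y) \<longleftrightarrow> (\<exists>H. H 0 = Ide C X \<and> H (length G) = Ide C Y \<and>
        (\<forall>j<length G. H (Suc j) \<in> Hom C (Dom C (G ! j)) (Dom C (rev T ! j)) \<and>
           rev T ! j \<cdot> H (Suc j) = H j \<cdot> (G ! j)))"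
        by (rule chain_map_iff) (use T(2) lG in simp)
      moreover have "rev T ! j = T ! (i - j)" if "j < length G" for j
        using that T(2) lG by (simp add: rev_nth)
      moreover have "H 0 = Ide C X" "H (length G) = Ide C Y" using lG i by (auto simp: H_def)
      ultimately show ?thesis using HT DT lG by (auto simp: less_Suc_eq_le intro!: exI[of _ H])
    qed
    hence "ext_morphism C i X Y (rev G) T"
      using TE(1) GE by (simp add: ext_morphism_iff)
    ultimately show ?thesis
      by (meson equivclp_trans equivclp_sym r_into_equivclp)
  qed
qed

text \<open>Two descriptions for two uses. The one by \<open>null_extension\<close> is free of
  zigzags and serves dimension shifting. The one by equivalence treats both ends of an extension
  alike and therefore survives passage to the opposite category, where \<open>lifts\<close> would
  turn into a different condition.\<close>

lemma Ext_vanishes_iff_equiv: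
  assumes "i \<ge> 1" "X \<in> Obj C" "Y \<in> Obj C"
  shows "Ext_vanishes C i X Y \<longleftrightarrow>
    (\<forall>E \<in> extensions C i X Y. \<forall>T. trivial_extension C i X Y T \<longrightarrow> equivclp (ext_morphism C i X Y) T E)"
    (is "_ \<longleftrightarrow> ?R")
    and Ext_vanishes_iff_null_extension:
    "Ext_vanishes C i X Y \<longleftrightarrow> (\<forall>E \<in> extensions C i X Y. null_extension E)" (is "_ \<longleftrightarrow> ?Z")
proof -
  note triv = trivial_extension_null_extension[OF _ assms]
  obtain T0 where T0: "trivial_extension C i X Y T0"
    using trivial_extension_ex[OF assms] by blast
  have 1: ?Z if "Ext_vanishes C i X Y"
  proof
    fix E assume E: "E \<in> extensions C i X Y"
    have "yoneda_equiv C i X Y `` {E} \<in> Ext C i X Y"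
      unfolding Ext_def by (rule quotientI) fact
    hence "yoneda_equiv C i X Y `` {E} = Ext_zero C i X Y"
      using that by (simp add: Ext_vanishes_def)
    moreover have "E \<in> yoneda_equiv C i X Y `` {E}" using E by (simp add: yoneda_equiv_def)
    ultimately obtain T where "trivial_extension C i X Y T" "equivclp (ext_morphism C i X Y) T E"
      by (auto simp: Ext_zero_def yoneda_equiv_def)
    thus "null_extension E" using triv null_extension_cong assms by blast
  qed
  have 2: ?R if ?Z
    using that null_extension_imp_equiv_trivial assms by blast
  have 3: "Ext_vanishes C i X Y" if R: ?R
  proof -
    have eq: "(E, F) \<in> yoneda_equiv C i X Y"
      if "E \<in> extensions C i X Y" "F \<in> extensions C i X Y" for E F
    proof -
      have "equivclp (ext_morphism C i X Y) T0 E" "equivclp (ext_morphism C i X Y) T0 F"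
        using R T0 that by auto
      thus ?thesis using that unfolding yoneda_equiv_def
        by (auto intro: equivclp_trans equivclp_sym)
    qed
    have cl: "yoneda_equiv C i X Y `` {E} = extensions C i X Y" if "E \<in> extensions C i X Y" for E
      using eq that by (auto simp: yoneda_equiv_def)
    have "Ext_zero C i X Y = extensions C i X Y"
      using eq T0 triv by (auto simp: Ext_zero_def yoneda_equiv_def)
    moreover have "Ext C i X Y = {extensions C i X Y}"
      using cl triv(1)[OF T0] unfolding Ext_def quotient_def by auto
    ultimately show ?thesis by (simp add: Ext_vanishes_def)
  qed
  show "Ext_vanishes C i X Y \<longleftrightarrow> ?R" "Ext_vanishes C i X Y \<longleftrightarrow> ?Z" using 1 2 3 by blast+
qed

subsection \<open>Dimension shifting\<close>

text \<open>This is exactness of \<open>Ext^i(X,B) \<rightarrow> Ext^i(X,K) \<rightarrow>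
  Ext^(i+1)(X,K')\<close> in the middle. Splicing \<open>E\<close> with the short exact sequence is
  the connecting map; triviality of the result yields an extension \<open>F\<close> by
  \<open>B\<close> that maps to \<open>E\<close>, and the lifts for \<open>F\<close> are pushed
  forward.\<close>

lemma dimension_shift:
  assumes "ses k g" "Dom C k = K'" "Dom C g = B" "Cod C g = K"
    "\<forall>E \<in> extensions C i X B. null_extension E" "\<forall>E \<in> extensions C (Suc i) X K'. null_extension E" "i \<ge> 1"
  shows "\<forall>E \<in> extensions C i X K. null_extension E"
proof
  fix E assume E: "E \<in> extensions C i X K"
  obtain R k0 where R: "E = k0 # rev R" "rev_exact (R @ [k0])" "length R = i" "R \<noteq> []" "is_epi C (hd R)"
    "Dom C k0 = K" "Cod C (hd R) = X" "is_mono C k0"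
    using extensionsE[OF E assms(7)] by metis
  note S = sesD[OF assms(1)]
  have X: "X \<in> Obj C" using R epi_arr[OF R(5)] by auto
  have r: "rev_exact (R @ [k0 \<cdot> g, k])"
    by (rule rev_exact_snoc_ses[OF R(2,4) assms(1) _ R(8)]) (use assms R in simp)
  have "k # rev (R @ [k0 \<cdot> g]) \<in> extensions C (Suc i) X K'"
    by (rule extensions_rev) (use r R assms in simp_all)
  hence "lifts (R @ [k0 \<cdot> g]) (Ide C (Cod C (hd (R @ [k0 \<cdot> g]))))"
    using assms(6) null_extension_rev[of "R @ [k0 \<cdot> g]" k] by simp
  hence L: "lifts (R @ [k0 \<cdot> g]) (Ide C X)" using R by simp
  have d: "Dom C (k0 \<cdot> g) = B" using R S assms by simp
  obtain F kF where F: "rev_exact (F @ [kF])" "F \<noteq> []" "is_epi C (hd F)" "length F = length R"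
    "Cod C (hd F) = Dom C (Ide C X)" "Dom C kF = Dom C (k0 \<cdot> g)"
    "chain_map (F @ [kF]) (R @ [k0 \<cdot> g]) (Ide C X) (Ide C (Dom C (k0 \<cdot> g)))"
    by (rule lifts_extract[OF L R(4) r]) (use X R in simp_all)
  have "kF # rev F \<in> extensions C i X B"
    by (rule extensions_rev) (use F R d X in simp_all)
  hence "lifts F (Ide C X)" using assms(5) null_extension_rev[OF F(2), of kF] F(5) X by simp
  moreover obtain h' where "chain_map F R (Ide C X) h'"
    using F(7) chain_map_append[OF F(4)] by blast
  moreover have "composable F" "composable R"
    using F(1) R(2) rev_exact_composable composable_appendD by blast+
  ultimately have "lifts R (Ide C X \<cdot> Ide C X)"
    by (intro lifts_chain_map[of F R _ h']) (use F(5) R(7) X in simp_all)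
  thus "null_extension E" using R null_extension_rev X by simp
qed

text \<open>A resolution of length zero is an isomorphism \<open>B \<rightarrow> K\<close> and not
  an equality, so vanishing has to be carried along it.\<close>

lemma null_extension_iso:
  assumes "is_mono C f" "is_epi C f" "i \<ge> 1" "\<forall>E \<in> extensions C i X (Dom C f). null_extension E"
  shows "\<forall>E \<in> extensions C i X (Cod C f). null_extension E"
proof
  fix E assume E: "E \<in> extensions C i X (Cod C f)"
  obtain R k where R: "E = k # rev R" "rev_exact (R @ [k])" "length R = i" "R \<noteq> []" "is_epi C (hd R)"
    "Dom C k = Cod C f" "Cod C (hd R) = X" "is_mono C k"
    using extensionsE[OF E assms(3)] by metis
  have "rev_exact (R @ [k \<cdot> f])"
    using rev_exact_append_comp[OF R(2,4) assms(2), of "[]"] mono_comp[OF assms(1) R(8)] R by simp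
  hence "(k \<cdot> f) # rev R \<in> extensions C i X (Dom C f)"
    using R assms by (intro extensions_rev) simp_all
  thus "null_extension E" using assms(4) R null_extension_rev by blast
qed

text \<open>One dimension shift per term. Passing to the first syzygy shortens the resolution by one
  and raises the degree by one, so \<open>l + j\<close> stays constant; this is why the degree bound
  \<open>l\<close> varies in the induction.\<close>

lemma resolution_null_extension:
  assumes "rev_exact R" "is_epi C (hd R)" "length R = Suc j" "Dom C ` set R \<subseteq> S"
    "\<And>B i. \<lbrakk>B \<in> S; 1 \<le> i; i \<le> l + j\<rbrakk> \<Longrightarrow> \<forall>E \<in> extensions C i X B. null_extension E"
    "1 \<le> i" "i \<le> l"
  shows "\<forall>E \<in> extensions C i X (Cod C (hd R)). null_extension E"
  using assms
proof (induction j arbitrary: R l i)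
  case 0
  then obtain f where "R = [f]" by (cases R) auto
  moreover have "\<forall>E \<in> extensions C i X (Dom C f). null_extension E"
    using 0(3-7) calculation by (intro 0(5)) auto
  moreover have "is_mono C f" "is_epi C f" using 0(1,2) \<open>R = [f]\<close> by simp_all
  ultimately show ?case using null_extension_iso[OF _ _ 0(6)] by (metis list.sel(1))
next
  case (Suc j)
  have "length R = Suc (Suc j)" using Suc.prems(3) .
  then obtain p f R' where R: "R = p # f # R'" by (auto simp: length_Suc_conv)
  obtain m e where me: "f = m \<cdot> e" "ses m p" "Cod C e = Dom C m" "is_epi C e" "rev_exact (e # R')"
    using rev_exact_ConsE[of p f R'] Suc.prems R by auto
  note S = sesD[OF me(2)]
  have "Dom C f = Dom C e" using me S by simp
  hence "\<forall>E \<in> extensions C (Suc i) X (Cod C (hd (e # R'))). null_extension E"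
    using Suc.prems me R by (intro Suc.IH[of _ "Suc l"]) auto
  hence A: "\<forall>E \<in> extensions C (Suc i) X (Dom C m). null_extension E" using me by simp
  have B: "\<forall>E \<in> extensions C i X (Dom C p). null_extension E"
    using Suc.prems(4,6,7) R by (intro Suc.prems(5)) auto
  show ?case using dimension_shift[OF me(2) refl refl refl B A Suc.prems(6)] R by simp
qed

lemma res_class_Ext_vanishes:
  assumes "K \<in> res_class C (n - 1) S" "n \<ge> 1" "X \<in> Obj C" "S \<subseteq> Obj C"
    "\<forall>B \<in> S. \<forall>i \<in> {1..n}. Ext_vanishes C i X B"
  shows "Ext_vanishes C 1 X K"
proof -
  obtain j fs where j: "K \<in> Obj C" "j \<le> n - 1" "length fs = j + 1" "exact_from_zero_to_zero C fs"
    "Cod C (last fs) = K" "Dom C ` set fs \<subseteq> S" using assms(1) by (auto simp: res_class_def)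
  \<comment> \<open>With \<open>l = 1\<close> the degrees involved are \<open>1\<close> to
    \<open>1 + j\<close>, and \<open>j \<le> n - 1\<close> keeps them within
    \<open>1..n\<close>.\<close>
  have "\<forall>E \<in> extensions C 1 X (Cod C (hd (rev fs))). null_extension E"
  proof (rule resolution_null_extension[where j = j and S = S and l = 1])
    show "rev_exact (rev fs)" "is_epi C (hd (rev fs))"
      using j(4) exact_from_zero_to_zero_iff by (auto simp: hd_rev)
    fix B i assume "B \<in> S" "1 \<le> i" "i \<le> 1 + j"
    thus "\<forall>E \<in> extensions C i X B. null_extension E"
      using Ext_vanishes_iff_null_extension[of i X B] assms j(2) by auto
  qed (use j in auto)
  thus ?thesis using Ext_vanishes_iff_null_extension[of 1 X K] assms j by (simp add: hd_rev)
qed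

section \<open>Lifting and splitting from the vanishing of the first Ext\<close>

lemma short_exactE:
  assumes "short_exact C X Y Z"
  obtains f g where "ses f g" "Dom C f = X" "Dom C g = Y" "Cod C g = Z"
proof -
  obtain f g where fg: "f \<in> Hom C X Y" "g \<in> Hom C Y Z" "exact_from_zero_to_zero C [f, g]"
    using assms by (auto simp: short_exact_def)
  hence "exact_at C f g" "is_mono C f" "is_epi C g"
    by (auto simp: exact_from_zero_to_zero_iff)
  hence "ses f g" using exact_mono_kernel ses_kernel by blast
  thus ?thesis using that fg by (auto simp: Hom_iff)
qed

text \<open>The obstruction to lifting \<open>h\<close> along \<open>g\<close> is the short exact
  sequence pulled back along \<open>h\<close>; a section of the pullback composes to the
  lift.\<close>

lemma Ext_vanishes_lift:
  assumes "ses f g" "Ext_vanishes C 1 (Dom C h) (Dom C f)" "h \<in> Arr C" "Cod C h = Cod C g"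
  obtains l where "l \<in> Arr C" "Dom C l = Dom C h" "Cod C l = Dom C g" "g \<cdot> l = h"
proof -
  note S = sesD[OF assms(1)]
  obtain k' e v where e: "ses k' e" "Cod C e = Dom C h" "Dom C k' = Dom C f"
    "v \<in> Arr C" "Cod C v = Dom C g" "Dom C v = Dom C e" "g \<cdot> v = h \<cdot> e"
    using pullback[OF assms(1,3,4)] by metis
  note S' = sesD[OF e(1)]
  have "[k', e] \<in> extensions C 1 (Dom C h) (Dom C f)"
    using extensions_rev[of "[e]" k'] S' ses_exact[OF e(1)] e by simp
  hence "null_extension [k', e]"
    using Ext_vanishes_iff_null_extension[of 1 "Dom C h" "Dom C f"] assms S by auto
  then obtain l where l: "l \<in> Arr C" "Dom C l = Dom C h" "Cod C l = Dom C e" "e \<cdot> l = Ide C (Dom C h)"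
    using e assms(3) by (auto simp: null_extension_def)
  have "g \<cdot> (v \<cdot> l) = h \<cdot> (e \<cdot> l)"
    by (rule comp_reassoc) (use e S S' l assms in auto)
  thus ?thesis using that[of "v \<cdot> l"] l e assms by simp
qed

text \<open>The missing projection \<open>q\<close> is \<open>1 - l \<cdot> g\<close> factored
  through the kernel \<open>f\<close>. The summand \<open>Cod C g\<close> is put first because
  \<open>closed_under_summands\<close> speaks of the first one.\<close>

lemma split_epi_biproduct:
  assumes "ses f g" "l \<in> Arr C" "Dom C l = Cod C g" "Cod C l = Dom C g" "g \<cdot> l = Ide C (Cod C g)"
  shows "\<exists>q. is_biproduct C (Dom C g) (Cod C g) (Dom C f) l f g q"
proof -
  note S = sesD[OF assms(1)]
  have lg: "g \<cdot> (l \<cdot> g) = g" using S assms comp_assoc[of g l g] by simp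
  hence "g \<cdot> Sub (Ide C (Dom C g)) (l \<cdot> g) = Zero C (Dom C g) (Cod C g)"
    using S(6) assms(2-4) by (simp add: comp_sub)
  then obtain q where q: "q \<in> Arr C" "Dom C q = Dom C g" "Cod C q = Dom C f"
    "f \<cdot> q = Sub (Ide C (Dom C g)) (l \<cdot> g)"
    using kernel_lift[OF S(1), of "Sub (Ide C (Dom C g)) (l \<cdot> g)"] S(6) assms(2-4) by auto
  have "f \<cdot> (q \<cdot> f) = Sub f (l \<cdot> (g \<cdot> f))"
    using q S(5-7) assms(2-4) comp_assoc[of f q f] by (simp add: sub_comp comp_assoc)
  hence "f \<cdot> (q \<cdot> f) = f \<cdot> Ide C (Dom C f)" using S(5-8) assms(2-4) by simp
  hence qf: "q \<cdot> f = Ide C (Dom C f)"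
    by (rule mono_cancel[OF S(3), rotated -1]) (use q S(5-7) in auto)
  have "f \<cdot> (q \<cdot> l) = Sub l (l \<cdot> (g \<cdot> l))"
    using q S(5-7) assms(2-4) comp_assoc[of l q f] by (simp add: sub_comp comp_assoc)
  hence "f \<cdot> (q \<cdot> l) = Zero C (Dom C (q \<cdot> l)) (Cod C f)" using q S(5-7) assms(2-5) by simp
  hence ql: "q \<cdot> l = Zero C (Cod C g) (Dom C f)"
    using mono_zero[OF S(3), of "q \<cdot> l"] q assms(2-4) by simp
  have "f \<cdot> q \<boxplus> l \<cdot> g = Ide C (Dom C g)"
    using sub_add[of "Ide C (Dom C g)" "l \<cdot> g"] q(4) S(6) assms(2-4) by simp
  hence "l \<cdot> g \<boxplus> f \<cdot> q = Ide C (Dom C g)"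
    using add_commute[of "l \<cdot> g" "f \<cdot> q"] q(1-3) S(5-7) assms(2-4) by simp
  thus ?thesis using qf ql q S(5-8) assms(2-5) unfolding is_biproduct_def
    by (intro exI[of _ q]) (auto simp: Hom_iff)
qed

subsection \<open>Duality for Ext\<close>

lemma biproduct_swap:
  assumes "is_biproduct C P X Y i j p q"
  shows "is_biproduct C P Y X j i q p"
  using biproductD[OF assms] add_commute[of "i \<cdot> p" "j \<cdot> q"]
  by (auto simp: is_biproduct_def Hom_iff)

lemma op_exact_from_zero_to_zero:
  assumes "exact_from_zero_to_zero C fs"
  shows "exact_from_zero_to_zero (op_cat C) (rev fs)"
proof -
  from assms obtain Z where Z: "fs \<noteq> []" "set fs \<subseteq> Arr C" "is_zero_object C Z"
    "successively (exact_at C) (Zero C Z (Dom C (hd fs)) # fs @ [Zero C (Cod C (last fs)) Z])"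
    by (auto simp: exact_from_zero_to_zero_def)
  from Z(4) have "successively (\<lambda>g f. exact_at (op_cat C) g f)
    (rev (Zero C Z (Dom C (hd fs)) # fs @ [Zero C (Cod C (last fs)) Z]))"
    unfolding successively_rev by (rule successively_mono) (auto intro: op_exact_at)
  thus ?thesis using Z(1-3) unfolding exact_from_zero_to_zero_def
    by (auto simp: hd_rev last_rev intro!: exI[of _ Z])
qed

lemma op_extensions:
  assumes "fs \<in> extensions C i X Y"
  shows "rev fs \<in> extensions (op_cat C) i Y X"
proof -
  have "fs \<noteq> []" using assms by (auto simp: extensions_def)
  thus ?thesis using assms op_exact_from_zero_to_zero
    by (auto simp: extensions_def hd_rev last_rev)
qed

text \<open>Reversal turns morphisms of extensions around, which the generated equivalence does not
  notice.\<close>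

lemma op_ext_morphism:
  assumes "ext_morphism C i X Y fs gs"
  shows "ext_morphism (op_cat C) i Y X (rev gs) (rev fs)"
proof -
  from assms obtain h where E: "fs \<in> extensions C i X Y" "gs \<in> extensions C i X Y"
    and h: "h 0 = Ide C Y" "h (i + 1) = Ide C X"
      "\<forall>j \<le> i. h j \<in> Hom C (Dom C (fs ! j)) (Dom C (gs ! j)) \<and>
                h (j + 1) \<in> Hom C (Cod C (fs ! j)) (Cod C (gs ! j)) \<and>
                (gs ! j) \<cdot> h j = h (j + 1) \<cdot> (fs ! j)"
    by (auto simp: ext_morphism_def)
  have nth: "rev fs ! j = fs ! (i - j)" "rev gs ! j = gs ! (i - j)" if "j \<le> i" for j
    using E that by (auto simp: rev_nth extensions_def)
  have "h (i + 1 - j) \<in> Hom C (Cod C (rev fs ! j)) (Cod C (rev gs ! j)) \<and>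
        h (i + 1 - (j + 1)) \<in> Hom C (Dom C (rev fs ! j)) (Dom C (rev gs ! j)) \<and>
        h (i + 1 - j) \<cdot> (rev fs ! j) = (rev gs ! j) \<cdot> h (i + 1 - (j + 1))" if j: "j \<le> i" for j
  proof -
    have "i + 1 - j = (i - j) + 1" "i + 1 - (j + 1) = i - j" using j by auto
    thus ?thesis using h(3)[rule_format, of "i - j"] by (simp add: nth[OF j])
  qed
  thus ?thesis unfolding ext_morphism_def
    using op_extensions[OF E(1)] op_extensions[OF E(2)] h(1,2)
    by (intro conjI exI[of _ "\<lambda>j. h (i + 1 - j)"]) simp_all
qed

lemma op_equivclp_ext_morphism:
  "equivclp (ext_morphism C i X Y) fs gs \<Longrightarrow> equivclp (ext_morphism (op_cat C) i Y X) (rev fs) (rev gs)"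
proof (induction rule: equivclp_induct)
  case (step gs hs)
  hence "ext_morphism (op_cat C) i Y X (rev gs) (rev hs) \<or> ext_morphism (op_cat C) i Y X (rev hs) (rev gs)"
    using op_ext_morphism by blast
  thus ?case using step(3) equivclp_into_equivclp by metis
qed simp

lemma op_trivial_extension:
  assumes "trivial_extension C i X Y T" "i \<ge> 1"
  shows "trivial_extension (op_cat C) i Y X (rev T)"
proof (cases "i = 1")
  case True
  then obtain P s t p q where bp: "is_biproduct C P Y X s t p q" and T: "T = [s, q]"
    using assms(1) by (auto simp: trivial_extension_def)
  \<comment> \<open>The reversed extension starts at \<open>X\<close>, so the two summands have to
    be swapped in addition to dualizing.\<close>
  have "is_biproduct (op_cat C) P X Y q p t s" using biproduct_swap[OF bp] by simp
  thus ?thesis using True T by (auto simp: trivial_extension_def)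
next
  case False
  then obtain Z where Z: "is_zero_object C Z"
    and T: "T = (let os = [Y, Y] @ replicate (i - 2) Z @ [X, X] in
         map (\<lambda>j. if j = 0 then Ide C Y else if j = i then Ide C X
                       else Zero C (os ! j) (os ! (j + 1))) [0..<i + 1])"
    using assms by (auto simp: trivial_extension_def Let_def)
  define os where "os = [Y, Y] @ replicate (i - 2) Z @ [X, X]"
  have ros: "[X, X] @ replicate (i - 2) Z @ [Y, Y] = rev os" by (simp add: os_def)
  have los: "length os = i + 2" using False assms(2) by (simp add: os_def)
  have "rev T = map (\<lambda>j. if j = 0 then Ide C X else if j = i then Ide C Y
                       else Zero C (rev os ! (j + 1)) (rev os ! j)) [0..<i + 1]" (is "_ = ?T'")
  proof (rule nth_equalityI)
    show "length (rev T) = length ?T'" by (simp add: T Let_def)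
    fix j assume "j < length (rev T)"
    hence j: "j \<le> i" by (simp add: T Let_def)
    have "length T = i + 1" by (simp add: T Let_def)
    hence "rev T ! j = T ! (i - j)" using j by (simp add: rev_nth)
    also have "\<dots> = (if i - j = 0 then Ide C Y else if i - j = i then Ide C X
                       else Zero C (os ! (i - j)) (os ! (i - j + 1)))"
      unfolding T Let_def os_def[symmetric] by (subst nth_map) (use j in \<open>simp_all del: upt_Suc\<close>)
    also have "\<dots> = (if j = 0 then Ide C X else if j = i then Ide C Y
                       else Zero C (rev os ! (j + 1)) (rev os ! j))"
      using j False assms(2) by (auto simp: rev_nth los Suc_diff_le)
    also have "\<dots> = ?T' ! j" by (subst nth_map) (use j in \<open>simp_all del: upt_Suc\<close>)
    finally show "rev T ! j = ?T' ! j" .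
  qed
  thus ?thesis
    unfolding trivial_extension_def Let_def if_not_P[OF False] op_simps op_zero_object ros[symmetric]
    using Z by (intro exI[of _ Z] conjI)
qed

lemma op_Ext_vanishes:
  assumes "Ext_vanishes C i X Y" "i \<ge> 1" "X \<in> Obj C" "Y \<in> Obj C"
  shows "Ext_vanishes (op_cat C) i Y X"
proof -
  interpret op: abelian_category "op_cat C" by (rule op_abelian)
  have "equivclp (ext_morphism (op_cat C) i Y X) T E"
    if "E \<in> extensions (op_cat C) i Y X" "trivial_extension (op_cat C) i Y X T" for E T
  proof -
    have "rev E \<in> extensions C i X Y" "trivial_extension C i X Y (rev T)"
      using op.op_extensions[OF that(1)] op.op_trivial_extension[OF that(2) assms(2)]
      by (simp_all only: op_op)
    hence "equivclp (ext_morphism C i X Y) (rev T) (rev E)"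
      using Ext_vanishes_iff_equiv[OF assms(2-4)] assms(1) by blast
    from op_equivclp_ext_morphism[OF this] show ?thesis by (simp only: rev_rev_ident)
  qed
  thus ?thesis using op.Ext_vanishes_iff_equiv[of i Y X] assms(2-4) by (simp only: op_simps) blast
qed

lemma op_Ext_vanishes_iff:
  assumes "i \<ge> 1" "X \<in> Obj C" "Y \<in> Obj C"
  shows "Ext_vanishes (op_cat C) i Y X \<longleftrightarrow> Ext_vanishes C i X Y"
  using op_Ext_vanishes[OF _ assms] abelian_category.op_Ext_vanishes[OF op_abelian, of i Y X] assms
  by (auto simp only: op_op op_simps)

lemma op_left_perp:
  assumes "i \<ge> 1" "S \<subseteq> Obj C"
  shows "left_perp (op_cat C) i S = right_perp C i S"
  using op_Ext_vanishes_iff[OF assms(1)] subsetD[OF assms(2)]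
  unfolding left_perp_def right_perp_def by (auto simp del: One_nat_def)

lemma op_res_class: "cores_class C k S \<subseteq> res_class (op_cat C) k S"
proof
  fix M assume "M \<in> cores_class C k S"
  then obtain j fs where j: "M \<in> Obj C" "j \<le> k" "length fs = j + 1" "exact_from_zero_to_zero C fs"
    "Dom C (hd fs) = M" "Cod C ` set fs \<subseteq> S" by (auto simp: cores_class_def)
  have "fs \<noteq> []" using j(3) by auto
  thus "M \<in> res_class (op_cat C) k S" unfolding res_class_def
    using j op_exact_from_zero_to_zero[OF j(4)]
    by (auto simp: last_rev intro!: exI[of _ j] exI[of _ "rev fs"])
qed

lemma op_short_exact: "short_exact C X Y Z \<Longrightarrow> short_exact (op_cat C) Z Y X"
  unfolding short_exact_def using op_exact_from_zero_to_zero[of "[_, _]"] by (auto simp: conj_ac)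

end

lemma op_closed_under_summands [simp]: "closed_under_summands (op_cat C) S = closed_under_summands C S"
  unfolding closed_under_summands_def op_biproduct by blast

lemma op_special_precovering:
  assumes "abelian_category C" "S \<subseteq> Obj C"
  shows "special_precovering (op_cat C) S = special_preenveloping C S"
proof -
  interpret abelian_category C by fact
  interpret op: abelian_category "op_cat C" by (rule op_abelian)
  have "right_perp (op_cat C) 1 S = left_perp C 1 S"
    using op.op_left_perp[of 1 S] assms by simp
  thus ?thesis
    unfolding special_precovering_def special_preenveloping_def is_special_precover_def
      is_special_preenvelope_def is_precover_def is_preenvelope_def
    by simp
qed

subsection \<open>Higher cotorsion pairs\<close>

context abelian_category
begin

context
  fixes n :: nat and \<A> \<B> :: "'o set"
  assumes n: "n \<ge> 1" and cot: "n_cotorsion_pair C n \<A> \<B>"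
begin

lemma cotorsion_classes:
  "\<A> \<subseteq> Obj C" "\<B> \<subseteq> Obj C"
  "closed_under_summands C \<A>"
  "\<And>A B i. \<lbrakk>A \<in> \<A>; B \<in> \<B>; 1 \<le> i; i \<le> n\<rbrakk> \<Longrightarrow> Ext_vanishes C i A B"
  using cot by (auto simp: n_cotorsion_pair_def)

lemma cotorsion_approximation:
  assumes "X \<in> Obj C"
  obtains f g where "ses f g" "Dom C g \<in> \<A>" "Cod C g = X" "Dom C f \<in> res_class C (n - 1) \<B>"
  using cot assms unfolding n_cotorsion_pair_def by (metis short_exactE)

lemma cotorsion_left_perp: "\<A> = (\<Inter>i \<in> {1..n}. left_perp C i \<B>)"
proof
  show "\<A> \<subseteq> (\<Inter>i \<in> {1..n}. left_perp C i \<B>)"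
    using cotorsion_classes by (auto simp: left_perp_def)
  show "(\<Inter>i \<in> {1..n}. left_perp C i \<B>) \<subseteq> \<A>"
  proof
    fix X assume "X \<in> (\<Inter>i \<in> {1..n}. left_perp C i \<B>)"
    hence X: "X \<in> Obj C" "\<forall>B \<in> \<B>. \<forall>i \<in> {1..n}. Ext_vanishes C i X B"
      using n by (auto simp: left_perp_def)
    obtain f g where fg: "ses f g" "Dom C g \<in> \<A>" "Cod C g = X" "Dom C f \<in> res_class C (n - 1) \<B>"
      using cotorsion_approximation[OF X(1)] by metis
    have "Ext_vanishes C 1 X (Dom C f)"
      using res_class_Ext_vanishes[OF fg(4) n X(1) cotorsion_classes(2) X(2)] .
    then obtain l where "l \<in> Arr C" "Dom C l = Cod C g" "Cod C l = Dom C g" "g \<cdot> l = Ide C (Cod C g)"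
      using Ext_vanishes_lift[OF fg(1), of "Ide C X"] X(1) fg(3) by auto
    then obtain q where "is_biproduct C (Dom C g) (Cod C g) (Dom C f) l f g q"
      using split_epi_biproduct[OF fg(1)] by blast
    thus "X \<in> \<A>" using cotorsion_classes(3) fg(2,3) unfolding closed_under_summands_def by metis
  qed
qed

lemma cotorsion_special_precovering: "special_precovering C \<A>"
  unfolding special_precovering_def
proof
  fix X assume X: "X \<in> Obj C"
  obtain f g where fg: "ses f g" "Dom C g \<in> \<A>" "Cod C g = X" "Dom C f \<in> res_class C (n - 1) \<B>"
    using cotorsion_approximation[OF X] by metis
  note S = sesD[OF fg(1)]
  have van: "Ext_vanishes C 1 A (Dom C f)" if "A \<in> \<A>" for A
    using res_class_Ext_vanishes[OF fg(4) n _ cotorsion_classes(2), of A] that cotorsion_classes by auto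
  have "\<exists>h \<in> Hom C A (Dom C g). g \<cdot> h = a" if A: "A \<in> \<A>" and a': "a \<in> Hom C A X" for A a
  proof -
    have a: "a \<in> Arr C" "Dom C a = A" "Cod C a = Cod C g" using a' fg(3) by (auto simp: Hom_iff)
    obtain l where "l \<in> Arr C" "Dom C l = Dom C a" "Cod C l = Dom C g" "g \<cdot> l = a"
      by (rule Ext_vanishes_lift[OF fg(1) _ a(1,3)]) (use van[OF A] a(2) in simp_all)
    thus ?thesis using a by (auto simp: Hom_iff)
  qed
  hence "is_precover C \<A> X g" using fg S by (simp add: is_precover_def)
  moreover have "Dom C f \<in> right_perp C 1 \<A>" using van S by (simp add: right_perp_def)
  ultimately show "\<exists>g. is_special_precover C \<A> X g"
    using S by (auto simp: is_special_precover_def)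
qed

lemma op_cotorsion_pair: "n_cotorsion_pair (op_cat C) n \<B> \<A>"
proof -
  have "Ext_vanishes (op_cat C) i B A" if "A \<in> \<A>" "B \<in> \<B>" "1 \<le> i" "i \<le> n" for A B i
    using cotorsion_classes that by (intro op_Ext_vanishes) auto
  moreover have "\<exists>B\<in>\<B>. \<exists>K\<in>res_class (op_cat C) (n - 1) \<A>. short_exact (op_cat C) K B X"
    if "X \<in> Obj C" for X
    using cot that op_res_class[of "n - 1" \<A>] op_short_exact unfolding n_cotorsion_pair_def by blast
  moreover have "\<exists>A\<in>\<A>. \<exists>L\<in>cores_class (op_cat C) (n - 1) \<B>. short_exact (op_cat C) X A L"
    if X: "X \<in> Obj C" for X
  proof -
    have "res_class C (n - 1) \<B> \<subseteq> cores_class (op_cat C) (n - 1) \<B>"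
    proof
      fix M assume "M \<in> res_class C (n - 1) \<B>"
      then obtain j fs where j: "M \<in> Obj C" "j \<le> n - 1" "length fs = j + 1" "exact_from_zero_to_zero C fs"
        "Cod C (last fs) = M" "Dom C ` set fs \<subseteq> \<B>" by (auto simp: res_class_def)
      have "fs \<noteq> []" using j(3) by auto
      thus "M \<in> cores_class (op_cat C) (n - 1) \<B>" unfolding cores_class_def
        using j op_exact_from_zero_to_zero[OF j(4)]
        by (auto simp: hd_rev intro!: exI[of _ j] exI[of _ "rev fs"])
    qed
    thus ?thesis using cot X op_short_exact unfolding n_cotorsion_pair_def by blast
  qed
  ultimately show ?thesis using cot unfolding n_cotorsion_pair_def by simp
qed

end

lemma cotorsion_right_perp:
  assumes "n \<ge> 1" "n_cotorsion_pair C n \<A> \<B>"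
  shows "\<B> = (\<Inter>i \<in> {1..n}. right_perp C i \<A>)"
proof -
  have "left_perp (op_cat C) i \<A> = right_perp C i \<A>" if "i \<in> {1..n}" for i
    using that op_left_perp[of i \<A>] cotorsion_classes(1)[OF assms] by simp
  with abelian_category.cotorsion_left_perp[OF op_abelian assms(1) op_cotorsion_pair[OF assms]]
  show ?thesis by simp
qed

lemma cotorsion_special_preenveloping:
  assumes "n \<ge> 1" "n_cotorsion_pair C n \<A> \<B>"
  shows "special_preenveloping C \<B>"
  using abelian_category.cotorsion_special_precovering[OF op_abelian assms(1) op_cotorsion_pair[OF assms]]
    op_special_precovering[OF abelian_category_axioms cotorsion_classes(2)[OF assms]] by simp

end

theorem proposition5p25:
  fixes C :: "('o, 'm) additive_data"
    and \<A> \<B> :: "'o set"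
    and n :: nat
  assumes "abelian_category C"
    and "n \<ge> 1"
    and "n_cotorsion_pair C n \<A> \<B>"
  shows "((\<exists>m. 1 \<le> m \<and> m \<le> n \<and>
            \<A> \<inter> \<B> = (\<Inter>i \<in> {1..m}. left_perp C i (\<A> \<inter> \<B>)) \<and>
            \<A> \<inter> \<B> = (\<Inter>i \<in> {1..m}. right_perp C i (\<A> \<inter> \<B>)))
          \<longrightarrow> \<A> = \<B> \<and> \<A> \<inter> \<B> = \<A> \<and>
              special_precovering C (\<A> \<inter> \<B>) \<and> special_preenveloping C (\<A> \<inter> \<B>))
       \<and> (cluster_tilting C (n + 1) (\<A> \<inter> \<B>) \<longleftrightarrow> \<A> = \<B>)"
proof -
  interpret abelian_category C by fact
  note cls = cotorsion_classes[OF assms(2,3)]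
  note pre = cotorsion_special_precovering[OF assms(2,3)]
    and env = cotorsion_special_preenveloping[OF assms(2,3)]
  let ?D = "\<A> \<inter> \<B>"
  \<comment> \<open>Orthogonality in degrees up to \<open>n\<close> puts \<open>\<A>\<close> into
    the left orthogonal and \<open>\<B>\<close> into the right orthogonal of
    \<open>\<A> \<inter> \<B>\<close> in degrees up to \<open>m\<close>; by hypothesis both
    orthogonals are the intersection itself.\<close>
  have eq: "\<A> = \<B>" if m: "m \<le> n"
    and L: "?D = (\<Inter>i \<in> {1..m}. left_perp C i ?D)"
    and R: "?D = (\<Inter>i \<in> {1..m}. right_perp C i ?D)" for m
  proof -
    have "\<A> \<subseteq> ?D"
      by (subst L) (use cls m in \<open>auto simp: left_perp_def\<close>)
    moreover have "\<B> \<subseteq> ?D"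
      by (subst R) (use cls m in \<open>auto simp: right_perp_def\<close>)
    ultimately show ?thesis by blast
  qed
  \<comment> \<open>The strict bound in cluster tilting accounts for the shift from \<open>n\<close>
    to \<open>n + 1\<close>.\<close>
  have int: "{0<..<n + 1} = {1..n}" by auto
  have "cluster_tilting C (n + 1) ?D \<longleftrightarrow> \<A> = \<B>"
  proof
    assume "cluster_tilting C (n + 1) ?D"
    hence "?D = Obj C \<inter> (\<Inter>i \<in> {1..n}. left_perp C i ?D)"
      "?D = Obj C \<inter> (\<Inter>i \<in> {1..n}. right_perp C i ?D)"
      unfolding cluster_tilting_def int by auto
    \<comment> \<open>Cluster tilting intersects with \<open>Obj C\<close>; since
      \<open>n \<ge> 1\<close>, the family is nonempty and this changes nothing.\<close>
    moreover have "(\<Inter>i \<in> {1..n}. left_perp C i ?D) \<subseteq> Obj C" "(\<Inter>i \<in> {1..n}. right_perp C i ?D) \<subseteq> Obj C"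
      using assms(2) by (auto simp: left_perp_def right_perp_def)
    ultimately show "\<A> = \<B>" by (intro eq[of n]) (simp_all only: Int_absorb1 order_refl)
  next
    assume AB: "\<A> = \<B>"
    have "precovering C \<A>" "preenveloping C \<A>"
      using pre env AB unfolding precovering_def preenveloping_def special_precovering_def
        special_preenveloping_def is_special_precover_def is_special_preenvelope_def by blast+
    \<comment> \<open>In a cotorsion pair each class is the orthogonal of the other; for
      \<open>\<A> = \<B>\<close> these descriptions become the two equations of cluster
      tilting.\<close>
    moreover have l: "\<A> = (\<Inter>i \<in> {1..n}. left_perp C i \<A>)"
      using cotorsion_left_perp[OF assms(2,3)] unfolding AB .
    have r: "\<A> = (\<Inter>i \<in> {1..n}. right_perp C i \<A>)"
      using cotorsion_right_perp[OF assms(2,3)] unfolding AB .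
    have "\<A> = Obj C \<inter> (\<Inter>i \<in> {1..n}. left_perp C i \<A>)"
      "\<A> = Obj C \<inter> (\<Inter>i \<in> {1..n}. right_perp C i \<A>)"
      by (simp_all only: l[symmetric] r[symmetric] Int_absorb1[OF cls(1)])
    ultimately show "cluster_tilting C (n + 1) ?D"
      using cls(1) AB unfolding cluster_tilting_def int by simp
  qed
  moreover have "special_precovering C ?D \<and> special_preenveloping C ?D" if "\<A> = \<B>"
    using that pre env by simp
  ultimately show ?thesis using eq by blast
qed

end
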